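(* Let $G=\mathrm{PSL}(2,\mathbb C)$ (as a discrete group) and let $P\subset G$ be the image of the group of upper triangular matrices with $1$ on the diagonal. Then the complex $\bar B_*(G,P)=\bar C_*(G,P)\otimes_{\mathbb Z[G]}\mathbb Z$ of labeled truncated simplices computes the relative homology of the pair $(G,P)$: there is an isomorphism $$H_*(\bar B_*(G,P))\cong H_*(G,P).$$
   Context: For a discrete group $G$ and a subgroup $H$, $H_*(G,H)$ denotes the reduced singular homology (integer coefficients) of the mapping cone of the map $BH\to BG$ of classifying spaces induced by inclusion; equivalently $H_*(BG,BH;\mathbb Z)$. (Only degrees $n\ge 1$ are relevant; $H_0(G,H)=0$.) Truncated complex. For $n\ge 1$, a truncated $n$-simplex has vertices indexed by ordered pairs $ij$ of distinct elements of $\{0,\dots,n\}$ (the vertex $ij$ lies near the $i$-th vertex of the $n$-simplex, on the edge going to the $j$-th vertex). $\bar C_n(G,P)$, $n\ge1$, is the free abelian group on labelings $\{g^{ij}\}$ of these vertices by elements of $G$ such that (i) for fixed $i$ the elements $g^{ij}$ ($j\ne i$) are pairwise distinct and lie in the same left $P$-coset; (ii) each $(g^{ij})^{-1}g^{ji}$ is counter diagonal, i.e. of the form $\begin{pmatrix}0 & -a^{-1} \\ a & 0\end{pmatrix}$. $G$ acts by left multiplication on all labels. The boundary map is $\partial=\sum_{k=0}^n(-1)^kd_k$ (from degree $n$ to $n-1$, for $n\geq 2$), where $d_k$ discards all labels whose index pair contains $k$ and renumbers the remaining indices in an order preserving way. The complex lives in degrees $n\ge1$. *)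

theory Defs
  imports "HOL-Analysis.Analysis" "HOL-Homology.Homology"
begin

section \<open>Classifying spaces and relative homology of discrete groups\<close>

text \<open>
  Milnor's model of the universal bundle of a discrete group \<open>G\<close>: the infinite join
  \<open>E G = G * G * G * \<dots>\<close>.  A point is a formal convex combination of pairs \<open>(i, g)\<close>, where \<open>g\<close> is
  taken from the \<open>i\<close>-th copy of \<open>G\<close>; it is encoded by its coefficient function, so that for
  every \<open>i\<close> at most one coefficient \<open>f (i, g)\<close> is nonzero.  Milnor's topology is the coarsest one
  making the barycentric coordinates \<open>t\<^sub>i\<close> and the partial maps \<open>g\<^sub>i\<close> (into the discrete set \<open>G\<close>)
  continuous.  On finitely supported functions of total mass 1 this is the topology of pointwise
  convergence, i.e. the one inherited from the product topology on functions.
\<close>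

definition milnor_E :: "('g, 'm) monoid_scheme \<Rightarrow> (nat \<times> 'g \<Rightarrow> real) set" where
  "milnor_E G = {f. (\<forall>p. 0 \<le> f p) \<and>
                    finite {p. f p \<noteq> 0} \<and> {p. f p \<noteq> 0} \<subseteq> UNIV \<times> carrier G \<and>
                    (\<Sum>p | f p \<noteq> 0. f p) = 1 \<and>
                    (\<forall>i x y. f (i, x) \<noteq> 0 \<longrightarrow> f (i, y) \<noteq> 0 \<longrightarrow> x = y)}"

text \<open>The left translation \<open>\<Sum> t\<^sub>i g\<^sub>i \<mapsto> \<Sum> t\<^sub>i (h g\<^sub>i)\<close> in terms of coefficient functions.\<close>

definition milnor_translate ::
    "('g, 'm) monoid_scheme \<Rightarrow> 'g \<Rightarrow> (nat \<times> 'g \<Rightarrow> real) \<Rightarrow> nat \<times> 'g \<Rightarrow> real" where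
  "milnor_translate G h f =
     (\<lambda>(i, x). if x \<in> carrier G then f (i, inv\<^bsub>G\<^esub> h \<otimes>\<^bsub>G\<^esub> x) else 0)"

definition milnor_orbit ::
    "('g, 'm) monoid_scheme \<Rightarrow> (nat \<times> 'g \<Rightarrow> real) \<Rightarrow> (nat \<times> 'g \<Rightarrow> real) set" where
  "milnor_orbit G f = (\<lambda>h. milnor_translate G h f) ` carrier G"

text \<open>\<open>B G = E G / G\<close> with the quotient topology.\<close>

definition classifying_space ::
    "('g, 'm) monoid_scheme \<Rightarrow> (nat \<times> 'g \<Rightarrow> real) set topology" where
  "classifying_space G =
     topology (\<lambda>U. U \<subseteq> milnor_orbit G ` milnor_E G \<and>
                   openin (top_of_set (milnor_E G)) {f \<in> milnor_E G. milnor_orbit G f \<in> U})"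

text \<open>
  For a subgroup \<open>H\<close> of \<open>G\<close>, the map \<open>B H \<rightarrow> B G\<close> induced by the inclusion sends an \<open>H\<close>-orbit to
  the \<open>G\<close>-orbit containing it.  It is a topological embedding (see \<open>embedding_classifying_map\<close>),
  so that \<open>B H\<close> can be regarded as a subspace of \<open>B G\<close>.
\<close>

definition classifying_map ::
    "('g, 'm) monoid_scheme \<Rightarrow> (nat \<times> 'g \<Rightarrow> real) set \<Rightarrow> (nat \<times> 'g \<Rightarrow> real) set" where
  "classifying_map G c = (\<Union>f\<in>c. milnor_orbit G f)"

definition relative_group_homology ::
    "nat \<Rightarrow> ('g, 'm) monoid_scheme \<Rightarrow> 'g set \<Rightarrow> (nat \<times> 'g \<Rightarrow> real) set chain set monoid" where
  "relative_group_homology n G H =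
     relative_homology_group (int n) (classifying_space G)
       (classifying_map G ` topspace (classifying_space (G\<lparr>carrier := H\<rparr>)))"

lemma istopology_classifying:
  "istopology (\<lambda>U. U \<subseteq> milnor_orbit G ` milnor_E G \<and>
                   openin (top_of_set (milnor_E G)) {f \<in> milnor_E G. milnor_orbit G f \<in> U})"
  unfolding istopology_def
proof (intro conjI allI impI; (elim conjE)?)
  fix S T
  assume "openin (top_of_set (milnor_E G)) {f \<in> milnor_E G. milnor_orbit G f \<in> S}"
    and "openin (top_of_set (milnor_E G)) {f \<in> milnor_E G. milnor_orbit G f \<in> T}"
  then have "openin (top_of_set (milnor_E G))
     ({f \<in> milnor_E G. milnor_orbit G f \<in> S} \<inter> {f \<in> milnor_E G. milnor_orbit G f \<in> T})"
    by (rule openin_Int)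
  then show "openin (top_of_set (milnor_E G)) {f \<in> milnor_E G. milnor_orbit G f \<in> S \<inter> T}"
    by (rule back_subst) auto
next
  fix \<K>
  assume *: "\<forall>K\<in>\<K>. K \<subseteq> milnor_orbit G ` milnor_E G \<and>
               openin (top_of_set (milnor_E G)) {f \<in> milnor_E G. milnor_orbit G f \<in> K}"
  then have "openin (top_of_set (milnor_E G))
               (\<Union>K\<in>\<K>. {f \<in> milnor_E G. milnor_orbit G f \<in> K})"
    by blast
  then show "openin (top_of_set (milnor_E G)) {f \<in> milnor_E G. milnor_orbit G f \<in> \<Union>\<K>}"
    by (rule back_subst) auto
  show "\<Union>\<K> \<subseteq> milnor_orbit G ` milnor_E G"
    using * by blast
qed auto

lemma openin_classifying_space:
  "openin (classifying_space G) U \<longleftrightarrow>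
     U \<subseteq> milnor_orbit G ` milnor_E G \<and>
     openin (top_of_set (milnor_E G)) {f \<in> milnor_E G. milnor_orbit G f \<in> U}"
  unfolding classifying_space_def using istopology_classifying[of G]
  by (subst topology_inverse') auto

lemma topspace_classifying_space [simp]:
  "topspace (classifying_space G) = milnor_orbit G ` milnor_E G"
proof -
  have "{f \<in> milnor_E G. milnor_orbit G f \<in> milnor_orbit G ` milnor_E G} = milnor_E G"
    by auto
  then have "openin (classifying_space G) (milnor_orbit G ` milnor_E G)"
    unfolding openin_classifying_space by simp
  moreover have "topspace (classifying_space G) \<subseteq> milnor_orbit G ` milnor_E G"
    using openin_classifying_space[of G "topspace (classifying_space G)"] by simp
  ultimately show ?thesis
    using openin_subset by blast
qed

lemma quotient_map_milnor_orbit: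
  "quotient_map (top_of_set (milnor_E G)) (classifying_space G) (milnor_orbit G)"
  by (auto simp: quotient_map_def openin_classifying_space)

lemma milnor_translate_one:
  fixes G (structure)
  assumes "group G" "f \<in> milnor_E G"
  shows "milnor_translate G \<one>\<^bsub>G\<^esub> f = f"
proof -
  interpret group G by fact
  show ?thesis
    using assms by (force simp: milnor_translate_def milnor_E_def fun_eq_iff)
qed

lemma milnor_translate_translate:
  fixes G (structure)
  assumes "group G" "h \<in> carrier G" "k \<in> carrier G"
  shows "milnor_translate G h (milnor_translate G k f) = milnor_translate G (h \<otimes>\<^bsub>G\<^esub> k) f"
proof -
  interpret group G by fact
  show ?thesis
    using assms by (auto simp: milnor_translate_def fun_eq_iff inv_mult_group m_assoc)
qed

lemma milnor_translate_in:
  fixes G (structure)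
  assumes "group G" "h \<in> carrier G" "f \<in> milnor_E G"
  shows "milnor_translate G h f \<in> milnor_E G"
proof -
  interpret group G by fact
  let ?\<phi> = "\<lambda>(i::nat, x). (i, h \<otimes>\<^bsub>G\<^esub> x)"
  have sub: "{p. f p \<noteq> 0} \<subseteq> UNIV \<times> carrier G"
    using assms by (simp add: milnor_E_def)
  have supp: "{p. milnor_translate G h f p \<noteq> 0} = ?\<phi> ` {p. f p \<noteq> 0}"
  proof (intro equalityI subsetI)
    fix p assume p: "p \<in> {p. milnor_translate G h f p \<noteq> 0}"
    obtain i x where ix: "p = (i, x)" by (cases p)
    have "x \<in> carrier G" "f (i, inv h \<otimes> x) \<noteq> 0"
      using p by (auto simp: ix milnor_translate_def split: if_splits)
    moreover have "?\<phi> (i, inv h \<otimes> x) = p"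
      using \<open>x \<in> carrier G\<close> assms by (simp add: ix m_assoc[symmetric])
    ultimately show "p \<in> ?\<phi> ` {p. f p \<noteq> 0}" by (metis (mono_tags, lifting) image_eqI mem_Collect_eq)
  next
    fix p assume "p \<in> ?\<phi> ` {p. f p \<noteq> 0}"
    then obtain i x where "f (i, x) \<noteq> 0" "p = (i, h \<otimes> x)" by auto
    moreover from this have "x \<in> carrier G" using sub by auto
    ultimately show "p \<in> {p. milnor_translate G h f p \<noteq> 0}"
      using assms by (simp add: milnor_translate_def m_assoc[symmetric])
  qed
  have val: "milnor_translate G h f (?\<phi> p) = f p" if "f p \<noteq> 0" for p
    using that sub assms by (cases p) (auto simp: milnor_translate_def m_assoc[symmetric])
  have inj: "inj_on ?\<phi> {p. f p \<noteq> 0}"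
  proof (rule inj_onI)
    fix p q assume p: "p \<in> {p. f p \<noteq> 0}" and q: "q \<in> {p. f p \<noteq> 0}" and eq: "?\<phi> p = ?\<phi> q"
    have "snd p \<in> carrier G" "snd q \<in> carrier G" using p q sub by auto
    then show "p = q" using eq assms(2) by (cases p, cases q) auto
  qed
  have "(\<Sum>p | milnor_translate G h f p \<noteq> 0. milnor_translate G h f p) = (\<Sum>p | f p \<noteq> 0. f p)"
    unfolding supp by (subst sum.reindex[OF inj]) (auto intro!: sum.cong simp: val)
  moreover have "finite {p. milnor_translate G h f p \<noteq> 0}"
    unfolding supp using assms by (auto simp: milnor_E_def)
  moreover have "{p. milnor_translate G h f p \<noteq> 0} \<subseteq> UNIV \<times> carrier G"
    by (auto simp: milnor_translate_def split: if_splits)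
  moreover have "x = y"
    if "milnor_translate G h f (i, x) \<noteq> 0" "milnor_translate G h f (i, y) \<noteq> 0" for i x y
  proof -
    have xy: "x \<in> carrier G" "y \<in> carrier G" "f (i, inv h \<otimes> x) \<noteq> 0" "f (i, inv h \<otimes> y) \<noteq> 0"
      using that by (auto simp: milnor_translate_def split: if_splits)
    then have "inv h \<otimes> x = inv h \<otimes> y"
      using assms(3) unfolding milnor_E_def by blast
    then show ?thesis using xy assms by simp
  qed
  moreover have "0 \<le> milnor_translate G h f p" for p
    using assms by (cases p) (auto simp: milnor_translate_def milnor_E_def)
  moreover have "(\<Sum>p | f p \<noteq> 0. f p) = 1"
    using assms by (simp add: milnor_E_def)
  ultimately show ?thesis
    unfolding milnor_E_def mem_Collect_eq by (intro conjI allI impI) (simp | blast)+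
qed

lemma milnor_orbit_eq_iff:
  fixes G (structure)
  assumes "group G" "f \<in> milnor_E G" "f' \<in> milnor_E G"
  shows "milnor_orbit G f = milnor_orbit G f' \<longleftrightarrow> (\<exists>h\<in>carrier G. f' = milnor_translate G h f)"
proof
  interpret group G by fact
  have "f' \<in> milnor_orbit G f'"
    unfolding milnor_orbit_def using milnor_translate_one[OF assms(1,3)] one_closed by (metis image_eqI)
  then show "\<exists>h\<in>carrier G. f' = milnor_translate G h f" if "milnor_orbit G f = milnor_orbit G f'"
    using that by (auto simp: milnor_orbit_def)
next
  interpret group G by fact
  assume "\<exists>h\<in>carrier G. f' = milnor_translate G h f"
  then obtain h where h: "h \<in> carrier G" "f' = milnor_translate G h f" by blast
  have "milnor_translate G k f' \<in> milnor_orbit G f" if "k \<in> carrier G" for k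
    unfolding milnor_orbit_def using that h assms by (auto simp: milnor_translate_translate)
  moreover have "milnor_translate G k f \<in> milnor_orbit G f'" if "k \<in> carrier G" for k
  proof -
    have "milnor_translate G k f = milnor_translate G (k \<otimes> inv h) f'"
      using that h assms by (simp add: milnor_translate_translate m_assoc)
    then show ?thesis unfolding milnor_orbit_def using that h by (metis image_eqI inv_closed m_closed)
  qed
  ultimately show "milnor_orbit G f = milnor_orbit G f'"
    by (auto simp: milnor_orbit_def)
qed

context
  fixes G :: "('g, 'm) monoid_scheme" (structure) and H :: "'g set"
  assumes G: "group G" and H: "subgroup H G"
begin

lemma milnor_E_subgroup:
  "f \<in> milnor_E (G\<lparr>carrier := H\<rparr>) \<longleftrightarrow> f \<in> milnor_E G \<and> (\<forall>i x. f (i, x) \<noteq> 0 \<longrightarrow> x \<in> H)"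
  using subgroup.subset[OF H] by (auto simp: milnor_E_def)

lemma milnor_translate_subgroup:
  assumes "h \<in> H" "f \<in> milnor_E (G\<lparr>carrier := H\<rparr>)"
  shows "milnor_translate (G\<lparr>carrier := H\<rparr>) h f = milnor_translate G h f"
proof -
  interpret group G by (fact G)
  interpret H: subgroup H G by (fact H)
  have "x \<in> H" if "x \<in> carrier G" "f (i, inv h \<otimes> x) \<noteq> 0" for i x
  proof -
    have "inv h \<otimes> x \<in> H" using that assms milnor_E_subgroup by blast
    then have "h \<otimes> (inv h \<otimes> x) \<in> H" using assms by blast
    then show ?thesis using that assms by (simp add: m_assoc[symmetric])
  qed
  then show ?thesis
    using assms m_inv_consistent[OF H]
    by (auto simp: milnor_translate_def fun_eq_iff)
qed

lemma classifying_map_orbit: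
  assumes "f \<in> milnor_E (G\<lparr>carrier := H\<rparr>)"
  shows "classifying_map G (milnor_orbit (G\<lparr>carrier := H\<rparr>) f) = milnor_orbit G f"
proof -
  interpret group G by (fact G)
  interpret H: subgroup H G by (fact H)
  have "milnor_orbit G (milnor_translate (G\<lparr>carrier := H\<rparr>) h f) = milnor_orbit G f"
    if "h \<in> H" for h
    using that assms milnor_translate_in[OF G, of h f] milnor_orbit_eq_iff[OF G, of f "milnor_translate G h f"]
    by (auto simp: milnor_translate_subgroup milnor_E_subgroup)
  then have "(\<Union>h\<in>H. milnor_orbit G (milnor_translate (G\<lparr>carrier := H\<rparr>) h f)) = milnor_orbit G f"
    using H.one_closed by blast
  then show ?thesis
    by (simp add: classifying_map_def milnor_orbit_def[of "G\<lparr>carrier := H\<rparr>"])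
qed

lemma milnor_translate_in_subgroup:
  assumes "f \<in> milnor_E G" "h \<in> carrier G" "x \<in> H" "f (i, x) \<noteq> 0"
    "milnor_translate G h f \<in> milnor_E (G\<lparr>carrier := H\<rparr>)"
  shows "h \<in> H"
proof -
  interpret group G by (fact G)
  interpret H: subgroup H G by (fact H)
  have "milnor_translate G h f (i, h \<otimes> x) \<noteq> 0"
    using assms by (simp add: milnor_translate_def m_assoc[symmetric])
  then have "h \<otimes> x \<in> H" using assms milnor_E_subgroup by blast
  then have "(h \<otimes> x) \<otimes> inv x \<in> H" using assms by blast
  then show ?thesis using assms by (simp add: m_assoc)
qed

lemma milnor_E_nonzero:
  assumes "f \<in> milnor_E G"
  obtains i x where "f (i, x) \<noteq> 0"
proof -
  have "(\<Sum>p | f p \<noteq> 0. f p) = 1" using assms by (simp add: milnor_E_def)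
  then have "{p. f p \<noteq> 0} \<noteq> {}" by (metis sum.empty zero_neq_one)
  then show ?thesis using that by auto
qed

lemma inj_on_classifying_map:
  "inj_on (classifying_map G) (topspace (classifying_space (G\<lparr>carrier := H\<rparr>)))"
proof -
  interpret group G by (fact G)
  have GH: "group (G\<lparr>carrier := H\<rparr>)" by (rule subgroup_imp_group[OF H])
  have *: "milnor_orbit (G\<lparr>carrier := H\<rparr>) f = milnor_orbit (G\<lparr>carrier := H\<rparr>) f'"
    if f: "f \<in> milnor_E (G\<lparr>carrier := H\<rparr>)" and f': "f' \<in> milnor_E (G\<lparr>carrier := H\<rparr>)"
      and eq: "milnor_orbit G f = milnor_orbit G f'" for f f'
  proof -
    have E: "f \<in> milnor_E G" "f' \<in> milnor_E G" using f f' milnor_E_subgroup by auto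
    obtain h where h: "h \<in> carrier G" "f' = milnor_translate G h f"
      using eq milnor_orbit_eq_iff[OF G E] by blast
    obtain i x where ix: "f (i, x) \<noteq> 0" using milnor_E_nonzero E by blast
    then have "h \<in> H"
      using milnor_translate_in_subgroup[OF E(1) h(1)] f f' h milnor_E_subgroup by blast
    then show ?thesis
      using milnor_orbit_eq_iff[OF GH f f'] h milnor_translate_subgroup f by auto
  qed
  show ?thesis
    unfolding topspace_classifying_space
  proof (rule inj_onI, elim imageE)
    fix c c' f f'
    assume eq: "classifying_map G c = classifying_map G c'"
      and c: "c = milnor_orbit (G\<lparr>carrier := H\<rparr>) f" "c' = milnor_orbit (G\<lparr>carrier := H\<rparr>) f'"
      and f: "f \<in> milnor_E (G\<lparr>carrier := H\<rparr>)" "f' \<in> milnor_E (G\<lparr>carrier := H\<rparr>)"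
    have "milnor_orbit G f = milnor_orbit G f'"
      using eq unfolding c classifying_map_orbit[OF f(1)] classifying_map_orbit[OF f(2)] .
    then show "c = c'" unfolding c by (rule *[OF f])
  qed
qed

lemma continuous_milnor_translate:
  "continuous_on UNIV (milnor_translate G h)"
proof (rule continuous_on_coordinatewise_then_product)
  fix p :: "nat \<times> 'g"
  show "continuous_on UNIV (\<lambda>f. milnor_translate G h f p)"
    by (cases p, cases "snd p \<in> carrier G") (simp_all add: milnor_translate_def)
qed

lemma embedding_classifying_map:
  "embedding_map (classifying_space (G\<lparr>carrier := H\<rparr>)) (classifying_space G) (classifying_map G)"
proof -
  interpret group G by (fact G)
  interpret H: subgroup H G by (fact H)
  let ?GH = "G\<lparr>carrier := H\<rparr>"
  have GH: "group ?GH" by (rule subgroup_imp_group[OF H])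
  let ?S = "classifying_map G ` topspace (classifying_space ?GH)"
  have subE: "milnor_E ?GH \<subseteq> milnor_E G" using milnor_E_subgroup by auto
  have S: "?S = milnor_orbit G ` milnor_E ?GH"
    by (auto simp: classifying_map_orbit image_image)
  have "continuous_map (top_of_set (milnor_E ?GH)) (classifying_space G) (milnor_orbit G)"
    using quotient_imp_continuous_map[OF quotient_map_milnor_orbit] subE
    by (metis continuous_map_from_subtopology_mono)
  then have "continuous_map (top_of_set (milnor_E ?GH)) (classifying_space G)
               (classifying_map G \<circ> milnor_orbit ?GH)"
    by (rule continuous_map_eq) (simp add: classifying_map_orbit)
  then have cont: "continuous_map (classifying_space ?GH) (classifying_space G) (classifying_map G)"
    using continuous_compose_quotient_map[OF quotient_map_milnor_orbit] by blast
  have opn: "open_map (classifying_space ?GH) (subtopology (classifying_space G) ?S)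
               (classifying_map G)"
    unfolding open_map_def
  proof (intro allI impI)
    fix U assume U: "openin (classifying_space ?GH) U"
    define U' where "U' = {f \<in> milnor_E ?GH. milnor_orbit ?GH f \<in> U}"
    have U': "U = milnor_orbit ?GH ` U'" "openin (top_of_set (milnor_E ?GH)) U'"
      using U by (auto simp: openin_classifying_space U'_def)
    have U'_inv: "milnor_translate G h f \<in> U'" if "h \<in> H" "f \<in> U'" for h f
    proof -
      have f: "f \<in> milnor_E ?GH" "milnor_orbit ?GH f \<in> U" using that U'_def by auto
      have tr: "milnor_translate G h f \<in> milnor_E ?GH"
        using milnor_translate_in[OF GH, of h f] that f milnor_translate_subgroup by simp
      then have "milnor_orbit ?GH (milnor_translate G h f) = milnor_orbit ?GH f"
        using milnor_orbit_eq_iff[OF GH f(1) tr] that f milnor_translate_subgroup by auto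
      then show ?thesis using tr f by (simp add: U'_def)
    qed
    obtain W where W: "open W" "U' = milnor_E ?GH \<inter> W"
      using U'(2) by (auto simp: openin_open)
    define V where "V = {f \<in> milnor_E G. \<exists>i. \<exists>h\<in>carrier G.
        milnor_translate G h f \<in> W \<and> milnor_translate G h f (i, \<one>) \<noteq> 0}"
    have "open {f. milnor_translate G h f \<in> W \<and> milnor_translate G h f (i, \<one>) \<noteq> 0}" for i h
    proof -
      have c2: "continuous_on UNIV (\<lambda>f. milnor_translate G h f (i, \<one>))"
        using continuous_on_product_then_coordinatewise[OF continuous_milnor_translate] by blast
      have "open ((milnor_translate G h) -` W)"
        using open_vimage[OF W(1) continuous_milnor_translate] .
      moreover have "open ((\<lambda>f. milnor_translate G h f (i, \<one>)) -` (- {0}))"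
        by (rule open_vimage[OF _ c2]) auto
      ultimately have "open ((milnor_translate G h) -` W \<inter> (\<lambda>f. milnor_translate G h f (i, \<one>)) -` (- {0}))"
        by blast
      then show ?thesis by (rule back_subst) auto
    qed
    then have "open (\<Union>i. \<Union>h\<in>carrier G.
        {f. milnor_translate G h f \<in> W \<and> milnor_translate G h f (i, \<one>) \<noteq> 0})"
      by blast
    moreover have "V = milnor_E G \<inter> (\<Union>i. \<Union>h\<in>carrier G.
        {f. milnor_translate G h f \<in> W \<and> milnor_translate G h f (i, \<one>) \<noteq> 0})"
      by (auto simp: V_def)
    ultimately have Vopen: "openin (top_of_set (milnor_E G)) V"
      by (auto simp: openin_open)
    have VG: "V \<subseteq> milnor_E G" by (auto simp: V_def)
    have V_inv: "milnor_translate G k f \<in> V" if f: "f \<in> V" and k: "k \<in> carrier G" for f k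
    proof -
      obtain i h where h: "h \<in> carrier G" "milnor_translate G h f \<in> W"
          "milnor_translate G h f (i, \<one>) \<noteq> 0" using f by (auto simp: V_def)
      have "milnor_translate G (h \<otimes> inv k) (milnor_translate G k f) = milnor_translate G h f"
        using h k by (simp add: milnor_translate_translate[OF G] m_assoc)
      then show ?thesis
        using h k f milnor_translate_in[OF G k] unfolding V_def
        by (smt (verit, best) inv_closed m_closed mem_Collect_eq)
    qed
    have "{f \<in> milnor_E G. milnor_orbit G f \<in> milnor_orbit G ` V} = V"
    proof (intro equalityI subsetI)
      fix f assume f: "f \<in> {f \<in> milnor_E G. milnor_orbit G f \<in> milnor_orbit G ` V}"
      then obtain v where v: "v \<in> V" "milnor_orbit G v = milnor_orbit G f" by auto
      then show "f \<in> V"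
        using milnor_orbit_eq_iff[OF G, of v f] f V_inv VG by blast
    qed (use VG in blast)
    then have Vq: "openin (classifying_space G) (milnor_orbit G ` V)"
      using Vopen VG by (auto simp: openin_classifying_space)
    have VE: "V \<inter> milnor_E ?GH = U'"
    proof (intro equalityI subsetI)
      fix f assume f: "f \<in> V \<inter> milnor_E ?GH"
      then obtain i h where h: "h \<in> carrier G" "milnor_translate G h f \<in> W"
          "milnor_translate G h f (i, \<one>) \<noteq> 0" by (auto simp: V_def)
      have "f (i, inv h) \<noteq> 0" using h by (simp add: milnor_translate_def)
      then have "inv h \<in> H" using f milnor_E_subgroup by blast
      then have hH: "h \<in> H" using h by (metis H.m_inv_closed inv_inv)
      then have "milnor_translate G h f \<in> milnor_E ?GH"
        using milnor_translate_in[OF GH, of h f] f milnor_translate_subgroup by simp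
      then have "milnor_translate G h f \<in> U'" using W h by auto
      then have "milnor_translate G (inv h) (milnor_translate G h f) \<in> U'" using U'_inv hH by blast
      moreover have "milnor_translate G (inv h) (milnor_translate G h f) = f"
        using h f by (simp add: milnor_translate_translate[OF G] milnor_translate_one[OF G] V_def)
      ultimately show "f \<in> U'" by simp
    next
      fix f assume f: "f \<in> U'"
      then have fE: "f \<in> milnor_E ?GH" "f \<in> milnor_E G" using W subE by auto
      obtain i x where ix: "f (i, x) \<noteq> 0" using milnor_E_nonzero fE by blast
      then have x: "x \<in> H" using fE milnor_E_subgroup by blast
      have "milnor_translate G (inv x) f \<in> W" using U'_inv[of "inv x" f] x f W by blast
      moreover have "milnor_translate G (inv x) f (i, \<one>) \<noteq> 0"
        using ix x by (simp add: milnor_translate_def)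
      moreover have "inv x \<in> carrier G" using x by simp
      ultimately have "f \<in> V" unfolding V_def mem_Collect_eq using fE(2) by (intro conjI exI bexI)
      then show "f \<in> V \<inter> milnor_E ?GH" using fE(1) by simp
    qed
    have "classifying_map G ` U = milnor_orbit G ` U'"
      using U'(1) W(2) by (auto simp: classifying_map_orbit image_image)
    also have "\<dots> = milnor_orbit G ` V \<inter> ?S"
    proof (intro equalityI subsetI)
      fix c assume "c \<in> milnor_orbit G ` V \<inter> ?S"
      then obtain v f where vf: "v \<in> V" "f \<in> milnor_E ?GH" "c = milnor_orbit G v" "c = milnor_orbit G f"
        unfolding S by auto
      then have "f \<in> V"
        using milnor_orbit_eq_iff[OF G, of v f] V_inv subE VG by blast
      then show "c \<in> milnor_orbit G ` U'" using vf VE by blast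
    qed (use VE S in auto)
    finally show "openin (subtopology (classifying_space G) ?S) (classifying_map G ` U)"
      using Vq by (auto simp: openin_subtopology)
  qed
  have "homeomorphic_map (classifying_space ?GH) (subtopology (classifying_space G) ?S)
          (classifying_map G)"
  proof (rule bijective_open_imp_homeomorphic_map[OF _ opn _ inj_on_classifying_map])
    show "continuous_map (classifying_space ?GH) (subtopology (classifying_space G) ?S) (classifying_map G)"
      using cont by (auto simp: continuous_map_in_subtopology)
    show "?S = topspace (subtopology (classifying_space G) ?S)"
      using continuous_map_image_subset_topspace[OF cont] by auto
  qed
  then show ?thesis by (simp add: embedding_map_def)
qed

end


section \<open>Chain complexes and tensor products with the trivial module\<close>

definition chain_homology ::
    "(nat \<Rightarrow> 'a monoid) \<Rightarrow> (nat \<Rightarrow> 'a \<Rightarrow> 'a) \<Rightarrow> nat \<Rightarrow> 'a set monoid" where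
  "chain_homology C d n =
     subgroup_generated (C n) (if n = 0 then carrier (C 0) else kernel (C n) (C (n - 1)) (d n))
       Mod (d (Suc n) ` carrier (C (Suc n)))"

text \<open>
  \<open>M \<otimes>\<^bsub>\<int>[G]\<^esub> \<int>\<close> for an abelian group \<open>M\<close> with a left action of \<open>G\<close>, made into a right
  \<open>\<int>[G]\<close>-module by \<open>x g = g\<^sup>-\<^sup>1 x\<close>, and the trivial module \<open>\<int>\<close>: the abelian group generated by
  the symbols \<open>x \<otimes> k\<close> subject to biadditivity and \<open>x g \<otimes> k = x \<otimes> g k\<close>.
\<close>

definition tensor_relators ::
    "('g, 'm) monoid_scheme \<Rightarrow> ('g \<Rightarrow> 'a \<Rightarrow> 'a) \<Rightarrow> 'a monoid \<Rightarrow> (('a \<times> int) \<Rightarrow>\<^sub>0 int) set" where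
  "tensor_relators G act M =
     {frag_of (x \<otimes>\<^bsub>M\<^esub> y, k) - frag_of (x, k) - frag_of (y, k) | x y k.
        x \<in> carrier M \<and> y \<in> carrier M} \<union>
     {frag_of (x, k + l) - frag_of (x, k) - frag_of (x, l) | x k l. x \<in> carrier M} \<union>
     {frag_of (act (inv\<^bsub>G\<^esub> g) x, k) - frag_of (x, k) | g x k. g \<in> carrier G \<and> x \<in> carrier M}"

definition tensor_relations ::
    "('g, 'm) monoid_scheme \<Rightarrow> ('g \<Rightarrow> 'a \<Rightarrow> 'a) \<Rightarrow> 'a monoid \<Rightarrow> (('a \<times> int) \<Rightarrow>\<^sub>0 int) set" where
  "tensor_relations G act M =
     generate (free_Abelian_group (carrier M \<times> UNIV)) (tensor_relators G act M)"

definition tensor_trivial ::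
    "('g, 'm) monoid_scheme \<Rightarrow> ('g \<Rightarrow> 'a \<Rightarrow> 'a) \<Rightarrow> 'a monoid \<Rightarrow> (('a \<times> int) \<Rightarrow>\<^sub>0 int) set monoid"
  where
  "tensor_trivial G act M =
     free_Abelian_group (carrier M \<times> UNIV) Mod tensor_relations G act M"

text \<open>
  The map \<open>\<phi> \<otimes> id\<close> induced by an equivariant homomorphism \<open>\<phi>\<close> from \<open>M\<close> to \<open>N\<close> (with actions
  \<open>act\<close> and \<open>act'\<close>; only the target relations enter).  All elements of a coset \<open>X\<close> have images in the
  same coset, so the union is over copies of a single coset.
\<close>

definition tensor_map ::
    "('g, 'm) monoid_scheme \<Rightarrow> ('g \<Rightarrow> 'b \<Rightarrow> 'b) \<Rightarrow> 'b monoid \<Rightarrow> ('a \<Rightarrow> 'b) \<Rightarrow>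
     (('a \<times> int) \<Rightarrow>\<^sub>0 int) set \<Rightarrow> (('b \<times> int) \<Rightarrow>\<^sub>0 int) set" where
  "tensor_map G act' N \<phi> X =
     (\<Union>z\<in>X. tensor_relations G act' N #>\<^bsub>free_Abelian_group (carrier N \<times> UNIV)\<^esub>
               frag_extend (\<lambda>(x, k). frag_of (\<phi> x, k)) z)"


section \<open>\<open>PSL(2, \<complex>)\<close> and labeled truncated simplices\<close>

definition SL2C :: "(complex^2^2) monoid" where
  "SL2C = \<lparr>carrier = {A. det A = 1}, mult = (**), one = mat 1\<rparr>"

definition PSL2C :: "(complex^2^2) set monoid" where
  "PSL2C = SL2C Mod {mat 1, - mat 1}"

definition to_PSL2C :: "complex^2^2 \<Rightarrow> (complex^2^2) set" where
  "to_PSL2C A = {mat 1, - mat 1} #>\<^bsub>SL2C\<^esub> A"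

definition PSL2C_P :: "(complex^2^2) set set" where
  "PSL2C_P = to_PSL2C ` {A. A $ 1 $ 1 = 1 \<and> A $ 2 $ 2 = 1 \<and> A $ 2 $ 1 = 0}"

lemma group_SL2C: "group SL2C"
proof (rule groupI)
  fix A assume "A \<in> carrier SL2C"
  then have A: "det A = 1" by (simp add: SL2C_def)
  then obtain B where B: "B ** A = mat 1"
    by (metis invertible_det_nz invertible_def zero_neq_one)
  then have "det B = 1"
    using A det_mul[of B A] by (simp add: det_I)
  with B show "\<exists>B\<in>carrier SL2C. B \<otimes>\<^bsub>SL2C\<^esub> A = \<one>\<^bsub>SL2C\<^esub>"
    by (auto simp: SL2C_def)
qed (auto simp: SL2C_def det_mul matrix_mul_assoc det_I)

lemma normal_center_SL2C: "{mat 1, - mat 1} \<lhd> SL2C"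
proof -
  interpret group SL2C by (rule group_SL2C)
  have neg: "(- A) ** B = - (A ** B)" "A ** (- B) = - (A ** B)" for A B :: "complex^2^2"
    by (simp_all add: matrix_matrix_mult_def vec_eq_iff sum_negf)
  have sub: "subgroup {mat 1, - mat 1} SL2C"
  proof (rule subgroupI)
    show "{mat 1, - mat 1} \<subseteq> carrier SL2C"
      by (auto simp: SL2C_def det_2 mat_def)
    then show "inv\<^bsub>SL2C\<^esub> A \<in> {mat 1, - mat 1}" if "A \<in> {mat 1, - mat 1}" for A
      using that by (intro back_subst[of "\<lambda>B. B \<in> {mat 1, - mat 1}" A, OF that] inv_equality[symmetric])
         (auto simp: SL2C_def neg)
  qed (auto simp: SL2C_def neg)
  show ?thesis
    unfolding normal_inv_iff
  proof (intro conjI sub ballI)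
    fix A B :: "complex^2^2" assume A: "A \<in> carrier SL2C" and B: "B \<in> {mat 1, - mat 1}"
    then have "A \<otimes>\<^bsub>SL2C\<^esub> B = B \<otimes>\<^bsub>SL2C\<^esub> A"
      by (auto simp: SL2C_def neg)
    moreover have "B \<in> carrier SL2C" using sub B subgroup.subset by blast
    ultimately have "A \<otimes>\<^bsub>SL2C\<^esub> B \<otimes>\<^bsub>SL2C\<^esub> inv\<^bsub>SL2C\<^esub> A = B"
      using A by (simp add: m_assoc)
    then show "A \<otimes>\<^bsub>SL2C\<^esub> B \<otimes>\<^bsub>SL2C\<^esub> inv\<^bsub>SL2C\<^esub> A \<in> {mat 1, - mat 1}"
      using B by simp
  qed
qed

lemma group_PSL2C: "group PSL2C"
  unfolding PSL2C_def by (rule normal.factorgroup_is_group[OF normal_center_SL2C])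

lemma subgroup_PSL2C_P: "subgroup PSL2C_P PSL2C"
proof -
  interpret group SL2C by (rule group_SL2C)
  interpret N: normal "{mat 1, - mat 1}" SL2C by (rule normal_center_SL2C)
  let ?U = "{A :: complex^2^2. A $ 1 $ 1 = 1 \<and> A $ 2 $ 2 = 1 \<and> A $ 2 $ 1 = 0}"
  have "subgroup ?U SL2C"
  proof (rule subgroupI)
    show "?U \<noteq> {}" by (auto simp: mat_def intro!: exI[of _ "mat 1"])
    fix A assume A: "A \<in> ?U"
    define B :: "complex^2^2" where "B = vector [vector [1, - A $ 1 $ 2], vector [0, 1]]"
    have "B \<in> ?U" by (simp add: B_def vector_2)
    moreover have "inv\<^bsub>SL2C\<^esub> A = B"
      using A by (intro inv_equality)
        (auto simp: SL2C_def B_def det_2 mat_def matrix_matrix_mult_def sum_2 vec_eq_iff forall_2 vector_2)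
    ultimately show "inv\<^bsub>SL2C\<^esub> A \<in> ?U" by simp
  qed (auto simp: SL2C_def det_2 matrix_matrix_mult_def sum_2)
  moreover have "group_hom SL2C PSL2C to_PSL2C"
    unfolding to_PSL2C_def PSL2C_def
    by (intro group_hom.intro group_hom_axioms.intro group_SL2C N.factorgroup_is_group N.r_coset_hom_Mod)
  ultimately show ?thesis
    unfolding PSL2C_P_def by (intro group_hom.subgroup_img_is_subgroup)
qed
definition counter_diagonal :: "(complex^2^2) set set" where
  "counter_diagonal = {to_PSL2C (vector [vector [0, - inverse a], vector [a, 0]]) | a. a \<noteq> 0}"

definition truncated_vertices :: "nat \<Rightarrow> (nat \<times> nat) set" where
  "truncated_vertices n = {(i, j). i \<le> n \<and> j \<le> n \<and> i \<noteq> j}"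

text \<open>The complex lives in degrees \<open>n \<ge> 1\<close>, so there are no labelings for \<open>n = 0\<close>.\<close>

definition labelings :: "nat \<Rightarrow> (nat \<times> nat \<Rightarrow> (complex^2^2) set) set" where
  "labelings n = {g \<in> truncated_vertices n \<rightarrow>\<^sub>E carrier PSL2C.
     n \<ge> 1 \<and>
     (\<forall>i\<le>n. \<forall>j\<le>n. \<forall>k\<le>n. j \<noteq> i \<and> k \<noteq> i \<and> j \<noteq> k \<longrightarrow>
        g (i, j) \<noteq> g (i, k) \<and> g (i, j) <#\<^bsub>PSL2C\<^esub> PSL2C_P = g (i, k) <#\<^bsub>PSL2C\<^esub> PSL2C_P) \<and>
     (\<forall>i\<le>n. \<forall>j\<le>n. i \<noteq> j \<longrightarrow>
        inv\<^bsub>PSL2C\<^esub> (g (i, j)) \<otimes>\<^bsub>PSL2C\<^esub> g (j, i) \<in> counter_diagonal)}"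

definition truncated_chains :: "nat \<Rightarrow> ((nat \<times> nat \<Rightarrow> (complex^2^2) set) \<Rightarrow>\<^sub>0 int) monoid" where
  "truncated_chains n = free_Abelian_group (labelings n)"

definition truncated_act :: "nat \<Rightarrow> (complex^2^2) set \<Rightarrow>
    ((nat \<times> nat \<Rightarrow> (complex^2^2) set) \<Rightarrow>\<^sub>0 int) \<Rightarrow> ((nat \<times> nat \<Rightarrow> (complex^2^2) set) \<Rightarrow>\<^sub>0 int)" where
  "truncated_act n h =
     frag_extend (\<lambda>g. frag_of (\<lambda>v\<in>truncated_vertices n. h \<otimes>\<^bsub>PSL2C\<^esub> g v))"

text \<open>The order preserving bijection from \<open>\<nat>\<close> to \<open>\<nat> - {k}\<close>.\<close>

definition skip :: "nat \<Rightarrow> nat \<Rightarrow> nat" where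
  "skip k i = (if i < k then i else Suc i)"

definition truncated_face ::
    "nat \<Rightarrow> nat \<Rightarrow> (nat \<times> nat \<Rightarrow> (complex^2^2) set) \<Rightarrow> nat \<times> nat \<Rightarrow> (complex^2^2) set" where
  "truncated_face n k g = (\<lambda>(i, j)\<in>truncated_vertices (n - 1). g (skip k i, skip k j))"

definition truncated_boundary :: "nat \<Rightarrow>
    ((nat \<times> nat \<Rightarrow> (complex^2^2) set) \<Rightarrow>\<^sub>0 int) \<Rightarrow> ((nat \<times> nat \<Rightarrow> (complex^2^2) set) \<Rightarrow>\<^sub>0 int)" where
  "truncated_boundary n =
     (if n \<ge> 2
      then frag_extend (\<lambda>g. \<Sum>k\<le>n. frag_cmul ((-1) ^ k) (frag_of (truncated_face n k g)))
      else (\<lambda>_. 0))"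

definition B_bar ::
    "nat \<Rightarrow> ((((nat \<times> nat \<Rightarrow> (complex^2^2) set) \<Rightarrow>\<^sub>0 int) \<times> int) \<Rightarrow>\<^sub>0 int) set monoid" where
  "B_bar n = tensor_trivial PSL2C (truncated_act n) (truncated_chains n)"

definition B_bar_boundary :: "nat \<Rightarrow>
    ((((nat \<times> nat \<Rightarrow> (complex^2^2) set) \<Rightarrow>\<^sub>0 int) \<times> int) \<Rightarrow>\<^sub>0 int) set \<Rightarrow>
    ((((nat \<times> nat \<Rightarrow> (complex^2^2) set) \<Rightarrow>\<^sub>0 int) \<times> int) \<Rightarrow>\<^sub>0 int) set" where
  "B_bar_boundary n =
     tensor_map PSL2C (truncated_act (n - 1)) (truncated_chains (n - 1)) (truncated_boundary n)"

end

theory Submission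
  imports Defs
begin

text \<open>
  A labeling is determined by the cosets \<open>g\<^sup>i\<^sup>j P\<close>, since two cosets \<open>\<alpha>\<close>, \<open>\<beta>\<close> in general position
  contain exactly one pair \<open>x \<in> \<alpha>\<close>, \<open>y \<in> \<beta>\<close> with \<open>x\<^sup>-\<^sup>1 y\<close> counter diagonal.  So the truncated
  simplices form the complex of tuples of elements of \<open>G/P\<close> in pairwise general position, cut off
  below degree 1.  The full complex of tuples is exact, as a cycle is the boundary of the cone with a
  sufficiently general apex, and \<open>G\<close> acts freely on the tuples of degree at least 1.

  On the topological side the singular chains of \<open>E G\<close>, modulo those lying in a translate \<open>g E P\<close>,
  form a free complex whose coinvariants are the singular chains of \<open>(B G, B P)\<close>.  As \<open>E G\<close> and the
  disjoint pieces \<open>g E P\<close>, which are indexed by \<open>G/P\<close>, are contractible, its only homology is the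
  kernel of \<open>\<int>[G/P] \<rightarrow> \<int>\<close>, in degree 1.  The same holds for the truncated complex, so the two free
  complexes are equivariantly chain homotopy equivalent.
\<close>

section \<open>Contractibility of the total space\<close>

text \<open>A coset \<open>g P\<close> amounts to the first column of \<open>g\<close> up to sign,
  so G/P is the set of nonzero vectors of C^2 modulo sign, and general position is linear
  independence; an apex for a cone exists because finitely many lines do not fill C^2. The obstacle
  is degree 0: a single coset is stabilized by a conjugate of P, so single cosets span no free
  module. Hence everything starts in degree 1, and \<open>base_chain\<close> pins the comparison
  maps there by prescribing their effect on the kernel of Z[G/P] -> Z; above that degree exactness
  determines the rest. The relative complex of E G is never formed as a quotient: maps are defined
  on all singular chains upstairs, and equations hold modulo chains in the pieces g E P. Both
  comparison maps and both homotopies are instances of \<open>equivariant_lift\<close>. Coinvariants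
  enter late and again without quotients, as equations modulo \<open>act_chains\<close> or
  \<open>trivial_chains\<close>.\<close>

definition hat :: "real \<Rightarrow> real" where
  "hat x = max 0 (1 - \<bar>x\<bar>)"

lemma continuous_on_hat [continuous_intros]:
  "continuous_on S f \<Longrightarrow> continuous_on S (\<lambda>x. hat (f x))"
  unfolding hat_def by (intro continuous_intros)

lemma hat_nonneg: "0 \<le> hat x"
  by (simp add: hat_def)

lemma hat_nz: "hat x \<noteq> 0 \<longleftrightarrow> \<bar>x\<bar> < 1"
  by (auto simp: hat_def)

lemma hat_int: "hat (real a - real b) = (if a = b then 1 else 0)"
  by (auto simp: hat_def)

text \<open>The integer translates of the bump form a partition of unity: at x only the integer part
  of x and its successor contribute.\<close>

lemma sum_hat:
  assumes "0 \<le> x"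
  obtains S where "finite S" "{j. hat (real j - x) \<noteq> 0} \<subseteq> S" "(\<Sum>j\<in>S. hat (real j - x)) = 1"
proof
  let ?m = "nat \<lfloor>x\<rfloor>"
  have m: "real ?m \<le> x" "x < real ?m + 1"
    using assms by linarith+
  show "{j. hat (real j - x) \<noteq> 0} \<subseteq> {?m, Suc ?m}"
  proof
    fix j assume "j \<in> {j. hat (real j - x) \<noteq> 0}"
    then have "\<bar>real j - x\<bar> < 1" by (simp add: hat_nz)
    then have "real j < real ?m + 2" "real ?m < real j + 1" using m by linarith+
    then have "j < ?m + 2" "?m < j + 1" by linarith+
    then show "j \<in> {?m, Suc ?m}" by auto
  qed
  have "hat (real ?m - x) = 1 - (x - real ?m)" "hat (real (Suc ?m) - x) = x - real ?m"
    using m unfolding hat_def by linarith+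
  then show "(\<Sum>j\<in>{?m, Suc ?m}. hat (real j - x)) = 1"
    by simp
qed auto

text \<open>For t > 0 this is max 0 (i - (1/t - 1)): index i rests until 1/t - 1 has dropped to i,
  then moves right, and sits at 2 i at time 1. Dividing by \<open>max t (1 / (real i + 1))\<close>
  instead of t keeps the denominator away from 0, so continuity at t = 0 is visible from the
  formula.\<close>

definition drift :: "nat \<Rightarrow> real \<Rightarrow> real" where
  "drift i t = max 0 ((real i + 1) * t - 1) / max t (1 / (real i + 1))"

lemma continuous_on_drift [continuous_intros]:
  assumes "continuous_on S f"
  shows "continuous_on S (\<lambda>x. drift i (f x))"
proof -
  have "max t (1 / (real i + 1)) \<noteq> 0" for t
    by (smt (verit) divide_pos_pos of_nat_0_le_iff)
  then show ?thesis
    unfolding drift_def by (intro continuous_intros assms) auto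
qed

lemma drift_0: "drift i 0 = 0"
  by (simp add: drift_def)

lemma drift_1: "drift i 1 = real i"
  by (simp add: drift_def max_def divide_simps)

lemma drift_pos: "t > 0 \<Longrightarrow> drift i t = max 0 (real i - (1 / t - 1))"
proof (cases "t \<ge> 1 / (real i + 1)")
  case True
  assume t: "t > 0"
  have "(real i + 1) * t \<ge> 1" using True by (simp add: field_simps)
  moreover from this have "real i + 1 \<ge> 1 / t" using t by (simp add: field_simps)
  ultimately show ?thesis using True t by (simp add: drift_def max_def field_simps)
next
  case False
  assume t: "t > 0"
  have "(real i + 1) * t < 1" using False by (simp add: field_simps)
  moreover from this have "real i + 1 < 1 / t" using t by (simp add: field_simps)
  ultimately show ?thesis using False t by (simp add: drift_def max_def)
qed

lemma drift_nonneg: "0 \<le> t \<Longrightarrow> 0 \<le> drift i t"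
  by (simp add: drift_def)

text \<open>At time \<open>t\<close> the mass at index \<open>i\<close> sits at \<open>i + drift i t\<close>, spread over the two neighbouring
  integers. No two indices ever meet: either both drifts move with the same speed and the indices have
  distance 2, or the smaller one has not yet left its integer position.\<close>
lemma drift_separated:
  assumes t: "0 \<le> t"
    and i: "\<bar>real j - (real i + drift i t)\<bar> < 1" and k: "\<bar>real j - (real k + drift k t)\<bar> < 1"
  shows "i = k"
proof -
  have *: False if "i < k" "\<bar>real j - (real i + drift i t)\<bar> < 1" "\<bar>real j - (real k + drift k t)\<bar> < 1"
    for i k
  proof (cases "t = 0")
    case True
    have "j = i" "j = k"
      using that(2,3) by (auto simp: True drift_0)
    then show False using that(1) by simp
  next
    case False
    define s where "s = 1 / t - 1"
    have d: "drift m t = max 0 (real m - s)" for m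
      using drift_pos[of t m] False t by (simp add: s_def)
    have ik: "real i + 1 \<le> real k" using that(1) by linarith
    show False
    proof (cases "s \<le> real i")
      case True
      then have "drift i t = real i - s" "drift k t = real k - s" using ik by (auto simp: d)
      then show False using that ik by linarith
    next
      case s: False
      then have "drift i t = 0" by (simp add: d)
      then have "j = i" using that(2) by linarith
      then show False using that(3) ik drift_nonneg[OF t, of k] by linarith
    qed
  qed
  show ?thesis using *[of i k] *[of k i] i k by (cases i k rule: linorder_cases) auto
qed

text \<open>The weight of index i is placed at position i + \<open>drift i t\<close> and shared
  between the neighbouring integers by the bumps. Nothing moves left, so only indices i \<le> j can
  reach j; the fixed finite sum makes every coordinate continuous in t and f jointly.\<close>

definition spread :: "real \<Rightarrow> (nat \<times> 'g \<Rightarrow> real) \<Rightarrow> nat \<times> 'g \<Rightarrow> real" where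
  "spread t f = (\<lambda>(j, x). \<Sum>i\<le>j. hat (real j - (real i + drift i t)) * f (i, x))"

lemma continuous_on_spread:
  "continuous_on UNIV (\<lambda>(t, f). spread t (f :: nat \<times> 'g \<Rightarrow> real))"
proof (rule continuous_on_coordinatewise_then_product)
  fix p :: "nat \<times> 'g"
  obtain j x where p: "p = (j, x)" by (cases p)
  have "continuous_on UNIV (\<lambda>z :: real \<times> (nat \<times> 'g \<Rightarrow> real). snd z (i, x))" for i
    by (rule continuous_on_compose2[OF continuous_on_product_coordinates continuous_on_snd[OF continuous_on_id]]) simp
  then show "continuous_on UNIV (\<lambda>z. (case z of (t, f) \<Rightarrow> spread t (f :: nat \<times> 'g \<Rightarrow> real)) p)"
    unfolding spread_def p case_prod_beta by (auto intro!: continuous_intros)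
qed

lemma milnor_E_D:
  assumes "f \<in> milnor_E G"
  shows "0 \<le> f p" "finite {p. f p \<noteq> 0}" "f (i, x) \<noteq> 0 \<Longrightarrow> x \<in> carrier G"
    "(\<Sum>p | f p \<noteq> 0. f p) = 1" "f (i, x) \<noteq> 0 \<Longrightarrow> f (i, y) \<noteq> 0 \<Longrightarrow> x = y"
  using assms unfolding milnor_E_def by blast+

lemma milnor_E_I:
  assumes "\<And>p. 0 \<le> f p" "finite S" "\<And>p. f p \<noteq> 0 \<Longrightarrow> p \<in> S" "(\<Sum>p\<in>S. f p) = 1"
    "\<And>i x. f (i, x) \<noteq> 0 \<Longrightarrow> x \<in> carrier G"
    "\<And>i x y. f (i, x) \<noteq> 0 \<Longrightarrow> f (i, y) \<noteq> 0 \<Longrightarrow> x = y"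
  shows "f \<in> milnor_E G"
proof -
  have "{p. f p \<noteq> 0} \<subseteq> S" using assms(3) by auto
  moreover have "(\<Sum>p | f p \<noteq> 0. f p) = (\<Sum>p\<in>S. f p)"
    using assms(2,3) by (intro sum.mono_neutral_left) auto
  ultimately show ?thesis
    using assms finite_subset unfolding milnor_E_def by (auto)
qed

lemma spread_nzE:
  assumes "spread t f (j, x) \<noteq> 0"
  obtains i where "i \<le> j" "f (i, x) \<noteq> 0" "\<bar>real j - (real i + drift i t)\<bar> < 1"
proof -
  have "\<exists>i\<le>j. hat (real j - (real i + drift i t)) * f (i, x) \<noteq> 0"
    using assms unfolding spread_def prod.case by (meson atMost_iff sum.neutral)
  then show ?thesis using that hat_nz by auto
qed

text \<open>Exchanging the sums isolates, for each i, a sum of bumps equal to 1, so the total mass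
  is preserved. By \<open>drift_separated\<close> only one old index contributes to a new one, so no
  two group elements meet over it.\<close>

lemma spread_in:
  assumes f: "f \<in> milnor_E G" and t: "0 \<le> t"
  shows "spread t f \<in> milnor_E G"
proof -
  let ?c = "\<lambda>i. real i + drift i t"
  have nn: "0 \<le> ?c i" for i using drift_nonneg[OF t, of i] by simp
  have "\<exists>S. finite S \<and> {j. hat (real j - ?c i) \<noteq> 0} \<subseteq> S \<and> (\<Sum>j\<in>S. hat (real j - ?c i)) = 1" for i
    using sum_hat[OF nn[of i]] by metis
  then obtain J where J: "\<And>i. finite (J i)" "\<And>i. {j. hat (real j - ?c i) \<noteq> 0} \<subseteq> J i"
      "\<And>i. (\<Sum>j\<in>J i. hat (real j - ?c i)) = 1"
    by metis
  define Z where "Z = {p. f p \<noteq> 0}"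
  have Z: "finite Z" using milnor_E_D(2)[OF f] Z_def by simp
  define JJ where "JJ = (\<Union>p\<in>Z. J (fst p))"
  define S where "S = JJ \<times> snd ` Z"
  show ?thesis
  proof (rule milnor_E_I[where S = S])
    show "0 \<le> spread t f p" for p
      unfolding spread_def by (auto simp: case_prod_beta intro!: sum_nonneg mult_nonneg_nonneg hat_nonneg milnor_E_D(1)[OF f])
    show "finite S" using Z J by (auto simp: S_def JJ_def)
    show "p \<in> S" if p: "spread t f p \<noteq> 0" for p
    proof -
      obtain j x where jx: "p = (j, x)" by (cases p)
      then obtain i where i: "f (i, x) \<noteq> 0" "\<bar>real j - ?c i\<bar> < 1" using p spread_nzE by metis
      then have "(i, x) \<in> Z" "j \<in> J i" using J(2)[of i] hat_nz by (auto simp: Z_def)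
      then show ?thesis unfolding S_def JJ_def jx by force
    qed
    show "x \<in> carrier G" if "spread t f (j, x) \<noteq> 0" for j x
      using that spread_nzE milnor_E_D(3)[OF f] by metis
    show "x = y" if xy: "spread t f (j, x) \<noteq> 0" "spread t f (j, y) \<noteq> 0" for j x y
    proof -
      obtain i where i: "f (i, x) \<noteq> 0" "\<bar>real j - ?c i\<bar> < 1" using xy(1) spread_nzE by metis
      obtain k where k: "f (k, y) \<noteq> 0" "\<bar>real j - ?c k\<bar> < 1" using xy(2) spread_nzE by metis
      have "i = k" using drift_separated[OF t i(2) k(2)] .
      then show ?thesis using i k milnor_E_D(5)[OF f] by metis
    qed
    have "(\<Sum>p\<in>S. spread t f p) = (\<Sum>j\<in>JJ. \<Sum>x\<in>snd ` Z. \<Sum>i\<in>fst ` Z. hat (real j - ?c i) * f (i, x))"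
      unfolding S_def sum.cartesian_product'
    proof (intro sum.cong refl)
      fix j x assume "j \<in> JJ" "x \<in> snd ` Z"
      show "spread t f (j, x) = (\<Sum>i\<in>fst ` Z. hat (real j - ?c i) * f (i, x))"
        unfolding spread_def prod.case
      proof (rule sum.mono_neutral_cong)
        fix i assume "i \<in> fst ` Z - {..j}"
        then have "\<not> \<bar>real j - ?c i\<bar> < 1" using drift_nonneg[OF t, of i] by auto
        then show "hat (real j - ?c i) * f (i, x) = 0" using hat_nz by auto
      next
        fix i assume "i \<in> {..j} - fst ` Z"
        then have "f (i, x) = 0" unfolding Z_def by (metis (mono_tags, lifting) DiffE fst_conv image_eqI mem_Collect_eq)
        then show "hat (real j - ?c i) * f (i, x) = 0" by simp
      qed (use Z in auto)
    qed
    also have "\<dots> = (\<Sum>x\<in>snd ` Z. \<Sum>i\<in>fst ` Z. \<Sum>j\<in>JJ. hat (real j - ?c i) * f (i, x))"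
      by (subst sum.swap, rule sum.cong[OF refl], rule sum.swap)
    also have "\<dots> = (\<Sum>x\<in>snd ` Z. \<Sum>i\<in>fst ` Z. f (i, x))"
    proof (intro sum.cong refl)
      fix x i assume "x \<in> snd ` Z" "i \<in> fst ` Z"
      then have sub: "J i \<subseteq> JJ" by (auto simp: JJ_def)
      have "(\<Sum>j\<in>JJ. hat (real j - ?c i)) = (\<Sum>j\<in>J i. hat (real j - ?c i))"
        using sub J(2)[of i] Z J(1) by (intro sum.mono_neutral_right) (auto simp: JJ_def)
      then show "(\<Sum>j\<in>JJ. hat (real j - ?c i) * f (i, x)) = f (i, x)"
        by (simp add: J(3) sum_distrib_right[symmetric])
    qed
    also have "\<dots> = (\<Sum>p\<in>fst ` Z \<times> snd ` Z. f p)"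
      by (subst sum.swap) (simp add: sum.cartesian_product)
    also have "\<dots> = (\<Sum>p\<in>Z. f p)"
    proof (rule sum.mono_neutral_right)
      show "Z \<subseteq> fst ` Z \<times> snd ` Z" by force
    qed (use Z in \<open>auto simp: Z_def\<close>)
    also have "\<dots> = 1" using milnor_E_D(4)[OF f] Z_def by simp
    finally show "(\<Sum>p\<in>S. spread t f p) = 1" .
  qed
qed

lemma spread_0: "spread 0 f = f"
proof
  fix p :: "nat \<times> 'a"
  obtain j x where p: "p = (j, x)" by (cases p)
  have "(\<Sum>i\<le>j. hat (real j - real i) * f (i, x)) = (\<Sum>i\<le>j. if i = j then f (i, x) else 0)"
    by (intro sum.cong) (auto simp: hat_int)
  then show "spread 0 f p = f p"
    by (simp add: p spread_def drift_0)
qed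

text \<open>At time 1 index i has reached 2 i. The vacated odd indices leave room for a straight
  segment to a vertex at index 1, which could otherwise put two group elements over one
  index.\<close>

lemma spread_1_odd: "odd j \<Longrightarrow> spread 1 f (j, x) = 0"
proof -
  assume j: "odd j"
  have "hat (real j - (real i + drift i 1)) = 0" for i
  proof -
    have "hat (real j - (real i + drift i 1)) = hat (real j - real (2 * i))" by (simp add: drift_1)
    moreover have "j \<noteq> 2 * i" using j by auto
    ultimately show ?thesis by (simp only: hat_int) simp
  qed
  then show ?thesis by (simp add: spread_def)
qed

lemma convex_combination_in:
  assumes f: "f \<in> milnor_E G" and g: "g \<in> milnor_E G" and t: "0 \<le> t" "t \<le> 1"
    and disj: "\<And>i x y. f (i, x) \<noteq> 0 \<Longrightarrow> g (i, y) = 0"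
  shows "(\<lambda>p. (1 - t) * f p + t * g p) \<in> milnor_E G"
proof (rule milnor_E_I[where S = "{p. f p \<noteq> 0} \<union> {p. g p \<noteq> 0}"])
  let ?S = "{p. f p \<noteq> 0} \<union> {p. g p \<noteq> 0}"
  show fin: "finite ?S"
    using f g milnor_E_D(2) by (simp add: milnor_E_D(2)[OF f] milnor_E_D(2)[OF g])
  have "(\<Sum>p | f p \<noteq> 0. f p) = (\<Sum>p\<in>?S. f p)" "(\<Sum>p | g p \<noteq> 0. g p) = (\<Sum>p\<in>?S. g p)"
    using fin by (auto intro!: sum.mono_neutral_left)
  then have "(\<Sum>p\<in>?S. f p) = 1" "(\<Sum>p\<in>?S. g p) = 1"
    using milnor_E_D(4)[OF f] milnor_E_D(4)[OF g] by simp_all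
  then show "(\<Sum>p\<in>?S. (1 - t) * f p + t * g p) = 1"
    by (simp add: sum.distrib sum_distrib_left[symmetric])
next
  fix i x y
  assume "(1 - t) * f (i, x) + t * g (i, x) \<noteq> 0" "(1 - t) * f (i, y) + t * g (i, y) \<noteq> 0"
  then have "f (i, x) \<noteq> 0 \<or> g (i, x) \<noteq> 0" "f (i, y) \<noteq> 0 \<or> g (i, y) \<noteq> 0" by auto
  then show "x = y"
    using disj milnor_E_D(5)[OF f] milnor_E_D(5)[OF g] by metis
next
  fix i x assume "(1 - t) * f (i, x) + t * g (i, x) \<noteq> 0"
  then have "f (i, x) \<noteq> 0 \<or> g (i, x) \<noteq> 0" by auto
  then show "x \<in> carrier G" using milnor_E_D(3)[OF f] milnor_E_D(3)[OF g] by blast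
next
  fix p show "0 \<le> (1 - t) * f p + t * g p"
    using milnor_E_D(1)[OF f] milnor_E_D(1)[OF g] t by simp
qed auto

definition vertex_at :: "nat \<Rightarrow> 'g \<Rightarrow> nat \<times> 'g \<Rightarrow> real" where
  "vertex_at i x = (\<lambda>p. if p = (i, x) then 1 else 0)"

lemma vertex_at_in: "x \<in> carrier G \<Longrightarrow> vertex_at i x \<in> milnor_E G"
  by (rule milnor_E_I[where S = "{(i, x)}"]) (auto simp: vertex_at_def split: if_splits)

text \<open>The odd indices are emptied by \<open>spread\<close>, then everything slides linearly to
  the vertex e at index 1. The statement is about a nonempty carrier, not about a group, so that it
  also covers the join of a coset.\<close>

lemma contractible_milnor_E:
  fixes G :: "('g, 'm) monoid_scheme"
  assumes "carrier G \<noteq> {}"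
  shows "contractible_space (top_of_set (milnor_E G))"
proof -
  obtain e where e: "e \<in> carrier G" using assms by blast
  let ?X = "top_of_set (milnor_E G)"
  have pt: "vertex_at 1 e \<in> milnor_E G" using vertex_at_in[OF e] .
  have h1: "homotopic_with_canon (\<lambda>_. True) (milnor_E G) (milnor_E G) id (spread 1)"
    unfolding homotopic_with_def prod_topology_subtopology_eu
  proof (intro exI conjI allI ballI TrueI)
    show "continuous_map (top_of_set ({0..1} \<times> milnor_E G)) (top_of_set (milnor_E G)) (\<lambda>(t, f). spread t f)"
      using spread_in by (auto intro!: continuous_on_subset[OF continuous_on_spread])
  qed (auto simp: spread_0)
  have h2: "homotopic_with_canon (\<lambda>_. True) (milnor_E G) (milnor_E G) (spread 1) (\<lambda>_. vertex_at 1 e)"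
    unfolding homotopic_with_def prod_topology_subtopology_eu
  proof (intro exI conjI allI ballI TrueI)
    let ?h = "\<lambda>(t, f). \<lambda>p. (1 - t) * spread 1 f p + t * vertex_at 1 e p"
    have "continuous_on UNIV (\<lambda>z :: real \<times> (nat \<times> 'g \<Rightarrow> real). spread 1 (snd z) p)" for p
    proof -
      have "continuous_on UNIV (\<lambda>z :: real \<times> (nat \<times> 'g \<Rightarrow> real). (\<lambda>(t, f). spread t f) (1, snd z))"
        by (rule continuous_on_compose2[OF continuous_on_spread])
           (intro continuous_on_Pair continuous_on_const continuous_on_snd continuous_on_id, simp)
      then show ?thesis
        by (auto dest: continuous_on_product_then_coordinatewise[where i = p])
    qed
    then have "continuous_on UNIV ?h"
      unfolding case_prod_beta
      by (intro continuous_on_coordinatewise_then_product continuous_on_add continuous_on_mult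
            continuous_on_diff continuous_on_const continuous_on_fst continuous_on_id) blast+
    moreover have "?h z \<in> milnor_E G" if z: "z \<in> {0..1} \<times> milnor_E G" for z
    proof -
      obtain t f where tf: "z = (t, f)" "0 \<le> t" "t \<le> 1" "f \<in> milnor_E G" using z by auto
      have "vertex_at 1 e (i, y) = 0" if "spread 1 f (i, x) \<noteq> 0" for i x y
        using that spread_1_odd[of i f x] by (auto simp: vertex_at_def)
      then show ?thesis
        using convex_combination_in[OF spread_in[OF tf(4), of 1] pt tf(2,3)] tf by simp
    qed
    ultimately show "continuous_map (top_of_set ({0..1} \<times> milnor_E G)) (top_of_set (milnor_E G)) ?h"
      by (auto intro: continuous_on_subset)
  qed auto
  show ?thesis
    unfolding contractible_space_top_of_set contractible_def
    using homotopic_with_trans[OF h1 h2] by blast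
qed

section \<open>Cycles in contractible spaces\<close>

lemma contractible_boundary_const:
  assumes "contractible_space X" "topspace X \<noteq> {}" "singular_relcycle p X {} c"
  obtains a where "a \<in> topspace X" "singular_relboundary p X {} (c - chain_map p (\<lambda>_. a) c)"
proof -
  obtain a where h: "homotopic_with (\<lambda>_. True) X X id (\<lambda>_. a)"
    using assms(1) by (auto simp: contractible_space_def)
  have "continuous_map X X (\<lambda>_. a)"
    using homotopic_with_imp_continuous_maps[OF h] by blast
  then have a: "a \<in> topspace X" using assms(2) by (auto simp: continuous_map_const)
  have h': "homotopic_with (\<lambda>h. h \<in> {} \<rightarrow> {}) X X id (\<lambda>_. a)"
    using h by (rule homotopic_with_mono) auto
  have "homologous_rel p X {} (chain_map p id c) (chain_map p (\<lambda>_. a) c)"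
    using homotopic_imp_homologous_rel_chain_maps[OF h' assms(3)] .
  moreover have "chain_map p id c = c"
    using assms(3) chain_map_id_gen[of p X c id] by (simp add: singular_cycle)
  ultimately show ?thesis
    using that a by (simp add: homologous_rel_def)
qed

text \<open>The contraction makes c homologous to its image under a constant map. That image is a
  cycle in a one-point space, and such a cycle bounds in positive degree.\<close>

lemma contractible_cycle_bounds:
  assumes X: "contractible_space X" and c: "singular_chain p X c" "chain_boundary p c = 0"
    and p: "p \<ge> 1"
  obtains w where "singular_chain (Suc p) X w" "chain_boundary (Suc p) w = c"
proof (cases "topspace X = {}")
  case True
  then show ?thesis using that[of 0] c singular_chain_empty by auto
next
  case False
  have cyc: "singular_relcycle p X {} c" using c by (simp add: singular_cycle)
  obtain a where a: "a \<in> topspace X" "singular_relboundary p X {} (c - chain_map p (\<lambda>_. a) c)"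
    using contractible_boundary_const[OF X False cyc] .
  let ?A = "subtopology X {a}"
  have "singular_relcycle p ?A {} (chain_map p (\<lambda>_. a) c)"
    using a by (intro singular_relcycle_chain_map[OF cyc]) (auto simp: continuous_map_const)
  moreover have "topspace ?A = {a}" using a by auto
  ultimately have "singular_relboundary p ?A {} (chain_map p (\<lambda>_. a) c)"
    using singular_boundary_eq_cycle_singleton[of ?A a p] p by simp
  then have "singular_relboundary p X {} (chain_map p (\<lambda>_. a) c)"
    using singular_boundary_mono[of "{a}" "topspace X" p X] a by simp
  then have "singular_relboundary p X {} c"
    using singular_relboundary_add[OF _ a(2), of "chain_map p (\<lambda>_. a) c"] by simp
  then show ?thesis using that by (auto simp: singular_boundary)
qed

text \<open>Collapsing all generators to a single one encodes the augmentation; whether the result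
  vanishes does not depend on the generator chosen.\<close>

lemma frag_extend_const: "frag_extend (\<lambda>_. frag_of a) c = 0 \<Longrightarrow> frag_extend (\<lambda>_. b) c = 0"
  using frag_extend_compose[of "\<lambda>_. b" "\<lambda>_. a" c] by (simp add: o_def)

text \<open>In degree 0 the constant chain left over by the contraction is the augmentation of c
  times one simplex, so it vanishes outright.\<close>

lemma contractible_zero_chain_bounds:
  assumes X: "contractible_space X" and c: "singular_chain 0 X c"
    and aug: "frag_extend (\<lambda>_. frag_of a) c = 0"
  obtains w where "singular_chain (Suc 0) X w" "chain_boundary (Suc 0) w = c"
proof (cases "topspace X = {}")
  case True
  then show ?thesis using that[of 0] c singular_chain_empty by auto
next
  case False
  have cyc: "singular_relcycle 0 X {} c" using c by (simp add: singular_cycle chain_boundary_def)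
  obtain x where x: "x \<in> topspace X" "singular_relboundary 0 X {} (c - chain_map 0 (\<lambda>_. x) c)"
    using contractible_boundary_const[OF X False cyc] .
  have "chain_map 0 (\<lambda>_. x) c = frag_extend (\<lambda>_. frag_of (restrict (\<lambda>_. x) (standard_simplex 0))) c"
    by (simp add: chain_map_def simplex_map_def o_def)
  also have "\<dots> = 0" using frag_extend_const[OF aug] .
  finally show ?thesis using x that by (auto simp: singular_boundary)
qed

section \<open>Lifting singular simplices to the total space\<close>

lemma milnor_E_nonzeroE:
  assumes "f \<in> milnor_E G"
  obtains i x where "f (i, x) \<noteq> 0" "x \<in> carrier G"
proof -
  have "{p. f p \<noteq> 0} \<noteq> {}" using milnor_E_D(4)[OF assms] by (metis sum.empty zero_neq_one)
  then show ?thesis using that milnor_E_D(3)[OF assms] by auto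
qed

lemma continuous_on_locally:
  assumes "\<And>z. z \<in> S \<Longrightarrow> \<exists>U. open U \<and> z \<in> U \<and> continuous_on (S \<inter> U) f"
  shows "continuous_on S f"
  unfolding continuous_on_def
proof
  fix z assume z: "z \<in> S"
  then obtain U where U: "open U" "z \<in> U" "continuous_on (S \<inter> U) f" using assms by blast
  then have "(f \<longlongrightarrow> f z) (at z within (S \<inter> U))"
    using z by (auto simp: continuous_on_def)
  moreover have "at z within (S \<inter> U) = at z within S"
    by (rule at_within_nhd[OF U(2,1)]) auto
  ultimately show "(f \<longlongrightarrow> f z) (at z within S)" by simp
qed

lemma topology_standard_simplex:
  "subtopology (powertop_real UNIV) (standard_simplex n) = top_of_set (standard_simplex n)"
  by (simp add: euclidean_product_topology)

definition lift_on ::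
    "('g, 'm) monoid_scheme \<Rightarrow> ('t::topological_space \<Rightarrow> (nat \<times> 'g \<Rightarrow> real) set) \<Rightarrow> 't set \<Rightarrow>
     ('t \<Rightarrow> nat \<times> 'g \<Rightarrow> real) \<Rightarrow> bool" where
  "lift_on G H S L \<longleftrightarrow> continuous_on S L \<and> (\<forall>z\<in>S. L z \<in> milnor_E G \<and> milnor_orbit G (L z) = H z)"

lemma lift_on_subset: "lift_on G H S L \<Longrightarrow> T \<subseteq> S \<Longrightarrow> lift_on G H T L"
  unfolding lift_on_def using continuous_on_subset by blast

lemma lift_on_cong: "lift_on G H S L \<Longrightarrow> (\<And>z. z \<in> S \<Longrightarrow> L z = L' z) \<Longrightarrow> lift_on G H S L'"
  unfolding lift_on_def using continuous_on_eq by metis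

context
  fixes G :: "('g, 'm) monoid_scheme" (structure)
  assumes G: "group G"
begin

interpretation group G by (fact G)

lemma milnor_translate_apply:
  assumes "h \<in> carrier G" "x \<in> carrier G"
  shows "milnor_translate G h f (i, h \<otimes> x) = f (i, x)"
  using assms by (simp add: milnor_translate_def m_assoc[symmetric])

text \<open>A nonzero coordinate (i, x) is moved to (i, h x), and a point carries only one group
  element over i; hence h x = x.\<close>

lemma milnor_translate_free:
  assumes "h \<in> carrier G" "f \<in> milnor_E G" "milnor_translate G h f = f"
  shows "h = \<one>"
proof -
  obtain i x where ix: "f (i, x) \<noteq> 0" "x \<in> carrier G" using milnor_E_nonzeroE assms(2) by metis
  then have "f (i, h \<otimes> x) \<noteq> 0" using milnor_translate_apply[OF assms(1) ix(2), of f i] assms(3) by simp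
  then have "h \<otimes> x = x" using milnor_E_D(5)[OF assms(2)] ix by metis
  then show ?thesis using assms(1) ix(2) by (metis r_cancel_one)
qed

lemma milnor_orbit_translate:
  assumes "h \<in> carrier G" "f \<in> milnor_E G"
  shows "milnor_orbit G (milnor_translate G h f) = milnor_orbit G f"
  using milnor_orbit_eq_iff[OF G assms(2) milnor_translate_in[OF G assms]] assms(1) by blast

lemma lift_on_translate:
  assumes "lift_on G H S L" "h \<in> carrier G"
  shows "lift_on G H S (\<lambda>z. milnor_translate G h (L z))"
  using assms unfolding lift_on_def
  by (auto simp: milnor_orbit_translate milnor_translate_in[OF G]
      intro!: continuous_on_compose2[OF continuous_milnor_translate[OF G subgroup_self], of S L])

lemma lift_on_fibre:
  assumes "lift_on G H S L" "lift_on G H' T L'" "z \<in> S" "w \<in> T" "H z = H' w"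
  obtains h where "h \<in> carrier G" "milnor_translate G h (L z) = L' w"
  using assms milnor_orbit_eq_iff[OF G, of "L z" "L' w"] unfolding lift_on_def by metis

text \<open>Wherever both lifts have a nonzero coordinate at the same (i, x), the translation that
  relates them must fix x, so it is trivial. By continuity of coordinates this is an open
  condition.\<close>

lemma lifts_agree_near:
  assumes L: "lift_on G H S L" and L': "lift_on G H S L'" and z: "z \<in> S" "L z = L' z"
  obtains U where "open U" "z \<in> U" "\<And>y. y \<in> S \<inter> U \<Longrightarrow> L y = L' y"
proof -
  have "L z \<in> milnor_E G" using L z by (auto simp: lift_on_def)
  then obtain i x where ix: "L z (i, x) \<noteq> 0" "x \<in> carrier G" using milnor_E_nonzeroE by metis
  have "continuous_on S (\<lambda>y. L y (i, x))" "continuous_on S (\<lambda>y. L' y (i, x))"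
    using L L' continuous_on_product_then_coordinatewise by (auto simp: lift_on_def)
  then have "continuous_on S (\<lambda>y. L y (i, x) * L' y (i, x))" by (intro continuous_intros)
  then have "openin (top_of_set S) (S \<inter> (\<lambda>y. L y (i, x) * L' y (i, x)) -` (- {0}))"
    by (rule continuous_openin_preimage_gen) auto
  then obtain U where U: "open U" "S \<inter> (\<lambda>y. L y (i, x) * L' y (i, x)) -` (- {0}) = S \<inter> U"
    by (auto simp: openin_open)
  show ?thesis
  proof
    show "open U" by fact
    show "z \<in> U" using U(2) z ix by auto
    fix y assume y: "y \<in> S \<inter> U"
    then have nz: "L y (i, x) \<noteq> 0" "L' y (i, x) \<noteq> 0" using U(2) by auto
    obtain h where h: "h \<in> carrier G" "milnor_translate G h (L y) = L' y"
      using lift_on_fibre[OF L L', of y y] y by auto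
    have "L' y (i, h \<otimes> x) \<noteq> 0" using milnor_translate_apply[OF h(1) ix(2), of "L y" i] h nz by simp
    moreover have "L' y \<in> milnor_E G" "L y \<in> milnor_E G" using L L' y by (auto simp: lift_on_def)
    ultimately have "h \<otimes> x = x" using nz milnor_E_D(5) by metis
    then have "h = \<one>" using h ix by (metis r_cancel_one)
    then show "L y = L' y" using h milnor_translate_one[OF G \<open>L y \<in> milnor_E G\<close>] by simp
  qed
qed

text \<open>The set of agreement is open and closed: near a point of disagreement the second lift
  equals the translate of the first by some h \<noteq> 1, and freeness of the action then rules out
  agreement.\<close>

lemma lift_on_unique:
  assumes L: "lift_on G H S L" and L': "lift_on G H S L'" and S: "connected S"
    and z: "z \<in> S" "L z = L' z" and y: "y \<in> S"
  shows "L y = L' y"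
proof -
  define A where "A = {y \<in> S. L y = L' y}"
  have "openin (top_of_set S) A"
  proof (subst openin_subopen, intro ballI)
    fix y assume y: "y \<in> A"
    then obtain U where U: "open U" "y \<in> U" "\<And>x. x \<in> S \<inter> U \<Longrightarrow> L x = L' x"
      using lifts_agree_near[OF L L'] unfolding A_def by blast
    then show "\<exists>T. openin (top_of_set S) T \<and> y \<in> T \<and> T \<subseteq> A"
      using y by (intro exI[of _ "S \<inter> U"]) (auto simp: A_def openin_open)
  qed
  moreover have "openin (top_of_set S) (S - A)"
  proof (subst openin_subopen, intro ballI)
    fix y assume y: "y \<in> S - A"
    then obtain h where h: "h \<in> carrier G" "milnor_translate G h (L y) = L' y"
      using lift_on_fibre[OF L L', of y y] by auto
    have "h \<noteq> \<one>" using y h milnor_translate_one[OF G, of "L y"] L by (auto simp: A_def lift_on_def)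
    obtain U where U: "open U" "y \<in> U" "\<And>x. x \<in> S \<inter> U \<Longrightarrow> milnor_translate G h (L x) = L' x"
      using lifts_agree_near[OF lift_on_translate[OF L h(1)] L'] y h(2) unfolding A_def by blast
    have "x \<notin> A" if "x \<in> S \<inter> U" for x
    proof
      assume "x \<in> A"
      then have "milnor_translate G h (L x) = L x" using U(3)[OF that] by (simp add: A_def)
      then show False using milnor_translate_free[OF h(1)] L that \<open>h \<noteq> \<one>\<close> by (auto simp: lift_on_def)
    qed
    then show "\<exists>T. openin (top_of_set S) T \<and> y \<in> T \<and> T \<subseteq> S - A"
      using y U by (intro exI[of _ "S \<inter> U"]) (auto simp: openin_open)
  qed
  then have "closedin (top_of_set S) A" by (auto simp: closedin_def A_def)
  ultimately have "A = {} \<or> A = S" using S unfolding connected_clopen by blast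
  then show ?thesis using z y by (auto simp: A_def)
qed

text \<open>The saturation of an open set is a union of its preimages under translations, all of
  them open.\<close>

lemma open_map_milnor_orbit:
  assumes "openin (top_of_set (milnor_E G)) U"
  shows "openin (classifying_space G) (milnor_orbit G ` U)"
proof -
  have UE: "U \<subseteq> milnor_E G" using openin_subset[OF assms] by simp
  have "{f \<in> milnor_E G. milnor_orbit G f \<in> milnor_orbit G ` U} =
        (\<Union>h\<in>carrier G. milnor_E G \<inter> milnor_translate G h -` U)" (is "?l = ?r")
  proof (intro equalityI subsetI)
    fix f assume "f \<in> ?l"
    then obtain u where u: "f \<in> milnor_E G" "u \<in> U" "milnor_orbit G f = milnor_orbit G u" by auto
    then show "f \<in> ?r" using milnor_orbit_eq_iff[OF G, of f u] UE by auto
  next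
    fix f assume "f \<in> ?r"
    then obtain h where h: "h \<in> carrier G" "f \<in> milnor_E G" "milnor_translate G h f \<in> U" by auto
    then have "milnor_orbit G f = milnor_orbit G (milnor_translate G h f)"
      using milnor_orbit_translate by simp
    then show "f \<in> ?l" using h by blast
  qed
  moreover have "openin (top_of_set (milnor_E G)) (milnor_E G \<inter> milnor_translate G h -` U)"
    if "h \<in> carrier G" for h
    using continuous_on_subset[OF continuous_milnor_translate[OF G subgroup_self] subset_UNIV] milnor_translate_in[OF G that]
    by (intro continuous_openin_preimage[OF _ _ assms]) auto
  ultimately have "openin (top_of_set (milnor_E G)) {f \<in> milnor_E G. milnor_orbit G f \<in> milnor_orbit G ` U}"
    by (simp only:) (rule openin_Union, blast)
  then show ?thesis using UE by (auto simp: openin_classifying_space)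
qed

text \<open>The open set W of points with a nonzero coordinate (i, x) meets each orbit at most once,
  so the orbit map can be inverted on its image. Openness of the orbit map makes this section
  continuous.\<close>

lemma local_lift:
  assumes H: "continuous_map (top_of_set S) (classifying_space G) H" and z: "z \<in> S"
  obtains U L where "open U" "z \<in> U" "lift_on G H (S \<inter> U) L"
proof -
  have "H z \<in> milnor_orbit G ` milnor_E G" using continuous_map_funspace[OF H] z by auto
  then obtain f where f: "f \<in> milnor_E G" "H z = milnor_orbit G f" by blast
  then obtain i x where ix: "f (i, x) \<noteq> 0" "x \<in> carrier G" using milnor_E_nonzeroE by metis
  define W where "W = {f \<in> milnor_E G. f (i, x) \<noteq> 0}"
  have "open ((\<lambda>f :: nat \<times> 'g \<Rightarrow> real. f (i, x)) -` (- {0}))"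
    by (rule open_vimage[OF _ continuous_on_product_coordinates]) auto
  moreover have "W = milnor_E G \<inter> ((\<lambda>f :: nat \<times> 'g \<Rightarrow> real. f (i, x)) -` (- {0}))"
    by (auto simp: W_def)
  ultimately have W: "openin (top_of_set (milnor_E G)) W" by (auto simp: openin_open)
  have pre: "openin (top_of_set S) {y \<in> S. H y \<in> milnor_orbit G ` V}"
    if "openin (top_of_set (milnor_E G)) V" for V
    using openin_continuous_map_preimage[OF H open_map_milnor_orbit[OF that]] by simp
  obtain U where U: "open U" "{y \<in> S. H y \<in> milnor_orbit G ` W} = S \<inter> U"
    using pre[OF W] by (auto simp: openin_open)
  define L where "L y = (SOME f. f \<in> W \<and> milnor_orbit G f = H y)" for y
  have L: "L y \<in> W \<and> milnor_orbit G (L y) = H y" if y: "y \<in> S \<inter> U" for y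
  proof -
    have "H y \<in> milnor_orbit G ` W" using U(2) y by blast
    then have "\<exists>f. f \<in> W \<and> milnor_orbit G f = H y" by auto
    then show ?thesis unfolding L_def by (rule someI_ex)
  qed
  have uniq: "f = f'" if that: "f \<in> W" "f' \<in> W" and eq: "milnor_orbit G f = milnor_orbit G f'" for f f'
  proof -
    have E: "f \<in> milnor_E G" "f' \<in> milnor_E G" and nz: "f' (i, x) \<noteq> 0" using that by (auto simp: W_def)
    obtain h where h: "h \<in> carrier G" "f' = milnor_translate G h f"
      using milnor_orbit_eq_iff[OF G E] eq by blast
    have "f' (i, h \<otimes> x) \<noteq> 0" using milnor_translate_apply[OF h(1) ix(2), of f i] h that by (auto simp: W_def)
    then have "h \<otimes> x = x" using milnor_E_D(5)[OF E(2) _ nz] by blast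
    then have "h = \<one>" using h ix by (metis r_cancel_one)
    then show ?thesis using h milnor_translate_one[OF G E(1)] by simp
  qed
  have "continuous_on (S \<inter> U) L"
    unfolding continuous_on_topological
  proof (intro ballI allI impI)
    fix y V assume y: "y \<in> S \<inter> U" and V: "open V" "L y \<in> V"
    have "openin (top_of_set (milnor_E G)) (W \<inter> V)" using W V openin_Int_open by blast
    then obtain A where A: "open A" "{y \<in> S. H y \<in> milnor_orbit G ` (W \<inter> V)} = S \<inter> A"
      using pre[of "W \<inter> V"] by (fastforce simp: openin_open)
    show "\<exists>A. open A \<and> y \<in> A \<and> (\<forall>y\<in>S \<inter> U. y \<in> A \<longrightarrow> L y \<in> V)"
    proof (intro exI[of _ A] conjI ballI impI A(1))
      have "H y = milnor_orbit G (L y)" "L y \<in> W \<inter> V" using L[OF y] V by auto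
      then have "y \<in> {y \<in> S. H y \<in> milnor_orbit G ` (W \<inter> V)}" using y by blast
      then show "y \<in> A" using A(2) by blast
      fix w assume w: "w \<in> S \<inter> U" "w \<in> A"
      then have "w \<in> {y \<in> S. H y \<in> milnor_orbit G ` (W \<inter> V)}" using A(2) by blast
      then obtain f where f: "f \<in> W" "f \<in> V" "H w = milnor_orbit G f" by blast
      then show "L w \<in> V" using uniq[of "L w" f] L[OF w(1)] by simp
    qed
  qed
  then have "lift_on G H (S \<inter> U) L" using L by (auto simp: lift_on_def W_def)
  moreover have "z \<in> S \<inter> U" using U(2) z f ix by (auto simp: W_def)
  ultimately show ?thesis using that U(1) by blast
qed

text \<open>Each local lift over [a, b] is translated to match L at (x, a), and its neighbourhood is
  shrunk until it matches L all along time a. Any two of them then coincide on each vertical segment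
  by uniqueness, so they glue to each other and to L.\<close>

lemma lift_step:
  fixes K :: "'c::topological_space set" and a b :: real
  assumes L: "lift_on G H (K \<times> {0..a}) L" and ab: "0 \<le> a" "a \<le> b"
    and loc: "\<And>x. x \<in> K \<Longrightarrow> \<exists>U M. open U \<and> x \<in> U \<and> lift_on G H ((K \<inter> U) \<times> {a..b}) M"
  shows "\<exists>L'. lift_on G H (K \<times> {0..b}) L'"
proof -
  have "\<exists>U M. open U \<and> x \<in> U \<and> lift_on G H ((K \<inter> U) \<times> {a..b}) M \<and> (\<forall>y\<in>K \<inter> U. M (y, a) = L (y, a))"
    if x: "x \<in> K" for x
  proof -
    obtain U M where U: "open U" "x \<in> U" and M: "lift_on G H ((K \<inter> U) \<times> {a..b}) M"
      using loc[OF x] by blast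
    obtain h where h: "h \<in> carrier G" "milnor_translate G h (M (x, a)) = L (x, a)"
      using lift_on_fibre[OF M L, of "(x, a)" "(x, a)"] x U ab by auto
    let ?M = "\<lambda>z. milnor_translate G h (M z)"
    have M': "lift_on G H ((K \<inter> U) \<times> {a..b}) ?M" using lift_on_translate[OF M h(1)] .
    have "lift_on G H ((K \<inter> U) \<times> {a}) ?M" "lift_on G H ((K \<inter> U) \<times> {a}) L"
      using ab by (auto intro: lift_on_subset[OF M'] lift_on_subset[OF L])
    then obtain V where V: "open V" "(x, a) \<in> V" "\<And>y. y \<in> (K \<inter> U) \<times> {a} \<inter> V \<Longrightarrow> ?M y = L y"
      using lifts_agree_near[of H "(K \<inter> U) \<times> {a}" ?M L "(x, a)"] x U h(2) by blast
    obtain V1 V2 where V12: "open V1" "open V2" "(x, a) \<in> V1 \<times> V2" "V1 \<times> V2 \<subseteq> V"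
      using open_prod_elim[OF V(1,2)] by blast
    show ?thesis
    proof (intro exI conjI ballI)
      show "open (U \<inter> V1)" "x \<in> U \<inter> V1" using U V12 by auto
      show "lift_on G H ((K \<inter> (U \<inter> V1)) \<times> {a..b}) ?M" by (rule lift_on_subset[OF M']) auto
      show "?M (y, a) = L (y, a)" if "y \<in> K \<inter> (U \<inter> V1)" for y using that V(3)[of "(y, a)"] V12 by auto
    qed
  qed
  then obtain U M where U: "\<And>x. x \<in> K \<Longrightarrow> open (U x)" "\<And>x. x \<in> K \<Longrightarrow> x \<in> U x"
    and M: "\<And>x. x \<in> K \<Longrightarrow> lift_on G H ((K \<inter> U x) \<times> {a..b}) (M x)"
    and MeqL: "\<And>x y. x \<in> K \<Longrightarrow> y \<in> K \<inter> U x \<Longrightarrow> M x (y, a) = L (y, a)"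
    by metis
  \<comment> \<open>The local lift used at a point is the one belonging to its own base point;
    \<open>L'M\<close> shows that any other local lift defined there gives the same value.\<close>
  define L' where "L' z = (if snd z \<le> a then L z else M (fst z) z)" for z
  have L'M: "(if snd z \<le> a then L z else M x z) = L' z" if x: "x \<in> K" and z: "z \<in> (K \<inter> U x) \<times> {0..b}" for x z
  proof (cases "snd z \<le> a")
    case True
    then show ?thesis by (simp add: L'_def)
  next
    case False
    obtain y t where yt: "z = (y, t)" by (cases z)
    have y: "y \<in> K" "y \<in> U x" "t \<in> {a..b}" using z yt False by auto
    have c: "connected ({y} \<times> {a..b})" by (intro connected_Times) auto
    have l: "lift_on G H ({y} \<times> {a..b}) (M x)" "lift_on G H ({y} \<times> {a..b}) (M y)"
      using y U by (auto intro!: lift_on_subset[OF M[OF x]] lift_on_subset[OF M[OF y(1)]])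
    have e: "M x (y, a) = M y (y, a)" using MeqL[OF x] MeqL[OF y(1)] y U by auto
    have "M x (y, t) = M y (y, t)"
      by (rule lift_on_unique[OF l c _ e]) (use y ab in auto)
    then show ?thesis by (simp add: L'_def yt)
  qed
  have "lift_on G H ((K \<inter> U x) \<times> {0..b}) L'" if x: "x \<in> K" for x
  proof -
    have "(K \<inter> U x) \<times> {0..b} = (K \<inter> U x) \<times> {0..a} \<union> (K \<inter> U x) \<times> {a..b}" using ab by auto
    moreover have "continuous_on ((K \<inter> U x) \<times> {0..a} \<union> (K \<inter> U x) \<times> {a..b}) (\<lambda>z. if snd z \<le> a then L z else M x z)"
    proof (rule continuous_on_cases_local)
      have "closed (UNIV \<times> {..a} :: ('c \<times> real) set)" "closed (UNIV \<times> {a..} :: ('c \<times> real) set)"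
        by (auto intro: closed_Times)
      moreover have "(K \<inter> U x) \<times> {0..a} = ((K \<inter> U x) \<times> {0..a} \<union> (K \<inter> U x) \<times> {a..b}) \<inter> UNIV \<times> {..a}"
        "(K \<inter> U x) \<times> {a..b} = ((K \<inter> U x) \<times> {0..a} \<union> (K \<inter> U x) \<times> {a..b}) \<inter> UNIV \<times> {a..}"
        using ab by auto
      ultimately show "closedin (top_of_set ((K \<inter> U x) \<times> {0..a} \<union> (K \<inter> U x) \<times> {a..b})) ((K \<inter> U x) \<times> {0..a})"
        "closedin (top_of_set ((K \<inter> U x) \<times> {0..a} \<union> (K \<inter> U x) \<times> {a..b})) ((K \<inter> U x) \<times> {a..b})"
        unfolding closedin_closed by blast+
      show "continuous_on ((K \<inter> U x) \<times> {0..a}) L" "continuous_on ((K \<inter> U x) \<times> {a..b}) (M x)"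
        using L M[OF x] unfolding lift_on_def by (auto intro: continuous_on_subset)
      fix z assume "z \<in> (K \<inter> U x) \<times> {0..a} \<and> \<not> snd z \<le> a \<or> z \<in> (K \<inter> U x) \<times> {a..b} \<and> snd z \<le> a"
      then obtain y where "z = (y, a)" "y \<in> K \<inter> U x" by force
      then show "L z = M x z" using MeqL[OF x] by simp
    qed
    ultimately have "continuous_on ((K \<inter> U x) \<times> {0..b}) (\<lambda>z. if snd z \<le> a then L z else M x z)" by simp
    then have "lift_on G H ((K \<inter> U x) \<times> {0..b}) (\<lambda>z. if snd z \<le> a then L z else M x z)"
      using L M[OF x] ab unfolding lift_on_def by auto
    then show ?thesis by (rule lift_on_cong) (rule L'M[OF x])
  qed
  note loc' = this
  have "continuous_on (K \<times> {0..b}) L'"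
  proof (rule continuous_on_locally)
    fix z assume z: "z \<in> K \<times> {0..b}"
    then have "fst z \<in> K" by auto
    moreover have "K \<times> {0..b} \<inter> U (fst z) \<times> UNIV = (K \<inter> U (fst z)) \<times> {0..b}" by auto
    ultimately show "\<exists>U. open U \<and> z \<in> U \<and> continuous_on (K \<times> {0..b} \<inter> U) L'"
      using U z loc'[of "fst z"]
      by (intro exI[of _ "U (fst z) \<times> UNIV"]) (auto simp: lift_on_def open_Times mem_Times_iff)
  qed
  moreover have "L' z \<in> milnor_E G \<and> milnor_orbit G (L' z) = H z" if "z \<in> K \<times> {0..b}" for z
    using loc'[of "fst z"] that U(2)[of "fst z"] by (auto simp: lift_on_def)
  ultimately show ?thesis by (auto simp: lift_on_def)
qed

text \<open>A Lebesgue number e for the sets that admit lifts yields time steps shorter than e/2; a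
  ball of radius e/2 times one step then lies inside a single such set, which feeds
  \<open>lift_step\<close>.\<close>

lemma lift_homotopy:
  fixes K :: "'c::metric_space set" and H :: "'c \<times> real \<Rightarrow> _"
  assumes H: "continuous_map (top_of_set (K \<times> {0..1})) (classifying_space G) H"
    and K: "compact K" and L0: "lift_on G H (K \<times> {0}) L0"
  obtains L where "lift_on G H (K \<times> {0..1}) L"
proof -
  let ?S = "K \<times> {0..1::real}"
  let ?C = "{U. open U \<and> (\<exists>L. lift_on G H (?S \<inter> U) L)}"
  have "compact ?S" using K by (intro compact_Times) auto
  moreover have "?S \<subseteq> \<Union>?C"
  proof
    fix z assume "z \<in> ?S"
    then obtain U L where "open U" "z \<in> U" "lift_on G H (?S \<inter> U) L" using local_lift[OF H] by metis
    then show "z \<in> \<Union>?C" by blast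
  qed
  ultimately obtain e where e: "e > 0" "\<And>z. z \<in> ?S \<Longrightarrow> \<exists>U\<in>?C. ball z e \<subseteq> U"
    using Heine_Borel_lemma[of ?S ?C] by (metis (no_types, lifting) mem_Collect_eq)
  obtain N :: nat where N: "N > 0" "1 / real N < e / 2"
    using real_arch_inverse[of "e / 2"] e by (auto simp: inverse_eq_divide)
  have "\<exists>L. lift_on G H (K \<times> {0..real k / real N}) L" if "k \<le> N" for k
    using that
  proof (induction k)
    case 0
    then show ?case using L0 by auto
  next
    case (Suc k)
    then obtain L where L: "lift_on G H (K \<times> {0..real k / real N}) L" by auto
    show ?case
    proof (rule lift_step[OF L])
      fix x assume x: "x \<in> K"
      let ?a = "real k / real N" and ?b = "real (Suc k) / real N"
      have ab: "0 \<le> ?a" "?b \<le> 1" "?a \<le> ?b" "?b - ?a < e / 2"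
        using Suc.prems N by (auto simp: field_simps)
      then obtain U M where U: "ball (x, ?a) e \<subseteq> U" "lift_on G H (?S \<inter> U) M"
        using e(2)[of "(x, ?a)"] x by auto
      have "(K \<inter> ball x (e / 2)) \<times> {?a..?b} \<subseteq> ?S \<inter> ball (x, ?a) e"
      proof
        fix z assume z: "z \<in> (K \<inter> ball x (e / 2)) \<times> {?a..?b}"
        obtain y t where yt: "z = (y, t)" by (cases z)
        have "dist (x, ?a) z \<le> dist x y + dist ?a t"
          unfolding yt dist_Pair_Pair by (rule sqrt_sum_squares_le_sum) auto
        also have "\<dots> < e"
        proof -
          have "dist x y < e / 2" "dist ?a t < e / 2"
            using z ab(4) by (auto simp: yt dist_real_def simp del: of_nat_Suc)
          then show ?thesis by linarith
        qed
        finally show "z \<in> ?S \<inter> ball (x, ?a) e" using z yt ab(1,2) order_trans[OF ab(1), of t] by (auto simp del: of_nat_Suc)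
      qed
      then have "lift_on G H ((K \<inter> ball x (e / 2)) \<times> {?a..?b}) M"
        using U lift_on_subset by (metis (no_types, lifting) Int_mono order_refl order_trans)
      then show "\<exists>U M. open U \<and> x \<in> U \<and> lift_on G H ((K \<inter> U) \<times> {?a..?b}) M"
        using e(1) by (intro exI[of _ "ball x (e / 2)"]) auto
    qed (auto simp: divide_right_mono)
  qed
  from this[of N] show ?thesis using that N by auto
qed

text \<open>Contracting the standard simplex to a point v along segments gives a homotopy from the
  constant map at \<sigma> v to \<sigma>. The constant map is lifted by a constant, and the lifted
  homotopy at time 1 is \<tau>.\<close>

lemma lift_singular_simplex:
  assumes "singular_simplex n (classifying_space G) \<sigma>"
  obtains \<tau> where "singular_simplex n (top_of_set (milnor_E G)) \<tau>" "simplex_map n (milnor_orbit G) \<tau> = \<sigma>"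
proof -
  let ?K = "standard_simplex n"
  obtain v where v: "v \<in> ?K" using nonempty_standard_simplex by blast
  define r where "r z = (\<lambda>i. (1 - snd z) * v i + snd z * fst z i)" for z :: "(nat \<Rightarrow> real) \<times> real"
  have r: "r z \<in> ?K" if "z \<in> ?K \<times> {0..1}" for z
    unfolding r_def using that v by (intro convex_standard_simplex) auto
  have "continuous_on UNIV (\<lambda>z :: (nat \<Rightarrow> real) \<times> real. fst z i)" for i
    by (rule continuous_on_compose2[OF continuous_on_product_coordinates continuous_on_fst[OF continuous_on_id]]) simp
  then have "continuous_on UNIV r"
    unfolding r_def
    by (intro continuous_on_coordinatewise_then_product continuous_on_add continuous_on_mult
            continuous_on_diff continuous_on_const continuous_on_snd continuous_on_id) blast+
  then have "continuous_map (top_of_set (?K \<times> {0..1})) (top_of_set ?K) r"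
    using r by (auto intro: continuous_on_subset)
  moreover have \<sigma>: "continuous_map (top_of_set ?K) (classifying_space G) \<sigma>" "\<sigma> \<in> extensional ?K"
    using assms by (auto simp: singular_simplex_def topology_standard_simplex)
  ultimately have H: "continuous_map (top_of_set (?K \<times> {0..1})) (classifying_space G) (\<sigma> \<circ> r)"
    using continuous_map_compose by blast
  have "compactin euclidean ?K"
    using compactin_standard_simplex[of n] by (simp add: euclidean_product_topology)
  then have K: "compact ?K" by simp
  obtain f where f: "f \<in> milnor_E G" "\<sigma> v = milnor_orbit G f"
    using continuous_map_funspace[OF \<sigma>(1)] v by force
  have r0: "r (x, 0) = v" and r1: "r (x, 1) = x" for x by (auto simp: r_def)
  have "lift_on G (\<sigma> \<circ> r) (?K \<times> {0}) (\<lambda>_. f)"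
    using f r0 by (auto simp: lift_on_def)
  then obtain L where L: "lift_on G (\<sigma> \<circ> r) (?K \<times> {0..1}) L"
    using lift_homotopy[OF H K] by metis
  define \<tau> where "\<tau> = restrict (\<lambda>x. L (x, 1)) ?K"
  have "continuous_on ?K (\<lambda>x. L (x, 1))"
  proof (rule continuous_on_compose2)
    show "continuous_on (?K \<times> {0..1}) L" using L by (simp add: lift_on_def)
    show "continuous_on ?K (\<lambda>x. (x, 1 :: real))"
      by (intro continuous_on_Pair continuous_on_const continuous_on_id)
  qed auto
  moreover have "L (x, 1) \<in> milnor_E G \<and> milnor_orbit G (L (x, 1)) = \<sigma> x" if "x \<in> ?K" for x
    using L that r1 unfolding lift_on_def by force
  ultimately show ?thesis
    using that[of \<tau>] \<sigma>(2)
    by (auto simp: singular_simplex_def topology_standard_simplex simplex_map_def \<tau>_def fun_eq_iff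
       extensional_def intro!: continuous_on_eq[of _ "\<lambda>x. L (x, 1)"])
qed

text \<open>A translation makes the two simplices agree at one point, and uniqueness of lifts on the
  connected standard simplex extends this. So the fibres of the projection of simplices are exactly
  G-orbits.\<close>

lemma singular_simplices_same_image:
  assumes "singular_simplex n (top_of_set (milnor_E G)) \<sigma>" "singular_simplex n (top_of_set (milnor_E G)) \<tau>"
    "simplex_map n (milnor_orbit G) \<sigma> = simplex_map n (milnor_orbit G) \<tau>"
  obtains h where "h \<in> carrier G" "\<tau> = simplex_map n (milnor_translate G h) \<sigma>"
proof -
  let ?K = "standard_simplex n"
  let ?H = "simplex_map n (milnor_orbit G) \<sigma>"
  have "milnor_orbit G (\<tau> z) = ?H z" if "z \<in> ?K" for z
    using fun_cong[OF assms(3), of z] that by (simp add: simplex_map_def)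
  then have l: "lift_on G ?H ?K \<sigma>" "lift_on G ?H ?K \<tau>"
    using assms(1,2) unfolding lift_on_def singular_simplex_def topology_standard_simplex
    by (auto simp: simplex_map_def)
  obtain v where v: "v \<in> ?K" using nonempty_standard_simplex by blast
  obtain h where h: "h \<in> carrier G" "milnor_translate G h (\<sigma> v) = \<tau> v"
    using lift_on_fibre[OF l v v] by auto
  have "connectedin euclidean ?K" using connectedin_standard_simplex[of n] by (simp add: euclidean_product_topology)
  then have c: "connected ?K" by simp
  have "milnor_translate G h (\<sigma> x) = \<tau> x" if "x \<in> ?K" for x
    using lift_on_unique[OF lift_on_translate[OF l(1) h(1)] l(2) c v h(2) that] .
  then have "\<tau> = simplex_map n (milnor_translate G h) \<sigma>"
    using assms(2) by (auto simp: simplex_map_def singular_simplex_def extensional_def fun_eq_iff)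
  then show ?thesis using that h by blast
qed

end

section \<open>Equivariant chain maps out of free chains\<close>

text \<open>The subgroup generated by B. Membership proofs become inductions with three cases, since
  closure under differences also yields negatives and sums.\<close>

inductive_set frag_span :: "('a \<Rightarrow>\<^sub>0 int) set \<Rightarrow> ('a \<Rightarrow>\<^sub>0 int) set" for B where
  frag_span_0: "0 \<in> frag_span B"
| frag_span_base: "b \<in> B \<Longrightarrow> b \<in> frag_span B"
| frag_span_diff: "a \<in> frag_span B \<Longrightarrow> b \<in> frag_span B \<Longrightarrow> a - b \<in> frag_span B"

lemma frag_span_minus: "a \<in> frag_span B \<Longrightarrow> - a \<in> frag_span B"
  using frag_span_diff[OF frag_span_0, of a B] by simp

lemma frag_span_add: "a \<in> frag_span B \<Longrightarrow> b \<in> frag_span B \<Longrightarrow> a + b \<in> frag_span B"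
  using frag_span_diff[OF _ frag_span_minus, of a B b] by simp

lemma frag_span_image:
  fixes f :: "('a \<Rightarrow>\<^sub>0 int) \<Rightarrow> 'b \<Rightarrow>\<^sub>0 int"
  assumes "\<And>a b. f (a - b) = f a - f b" "0 \<in> D" "\<And>a b. a \<in> D \<Longrightarrow> b \<in> D \<Longrightarrow> a - b \<in> D"
    "\<And>b. b \<in> B \<Longrightarrow> f b \<in> D" "a \<in> frag_span B"
  shows "f a \<in> D"
  using assms(5)
proof (induction rule: frag_span.induct)
  case frag_span_0
  have "f 0 = 0" using assms(1)[of 0 0] by simp
  then show ?case by (simp add: assms(2))
qed (simp_all add: assms)

lemma frag_span_keys:
  assumes "\<And>b. b \<in> B \<Longrightarrow> Poly_Mapping.keys b \<subseteq> S" "a \<in> frag_span B"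
  shows "Poly_Mapping.keys a \<subseteq> S"
  using assms(2)
proof (induction rule: frag_span.induct)
  case (frag_span_diff a b)
  then show ?case using keys_diff[of a b] by blast
qed (simp_all add: assms(1))

lemma frag_cmul_diff: "frag_cmul k (a - b) = frag_cmul k a - frag_cmul k b"
  by (simp add: poly_mapping_eqI lookup_minus right_diff_distrib)

abbreviation fchains :: "'a set \<Rightarrow> ('a \<Rightarrow>\<^sub>0 int) set" where
  "fchains S \<equiv> {c. Poly_Mapping.keys c \<subseteq> S}"

lemma fchains_diff: "a \<in> fchains S \<Longrightarrow> b \<in> fchains S \<Longrightarrow> a - b \<in> fchains S"
  using keys_diff[of a b] by auto

lemma fchains_add: "a \<in> fchains S \<Longrightarrow> b \<in> fchains S \<Longrightarrow> a + b \<in> fchains S"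
  using keys_add[of a b] by auto

lemma fchains_cmul: "a \<in> fchains S \<Longrightarrow> frag_cmul k a \<in> fchains S"
  using keys_cmul[of k a] by auto

lemma fchains_sum: "(\<And>i. i \<in> I \<Longrightarrow> f i \<in> fchains S) \<Longrightarrow> sum f I \<in> fchains S"
proof (induction I rule: infinite_finite_induct)
  case (insert x F)
  then have "f x + sum f F \<in> fchains S" by (intro fchains_add) auto
  then show ?case using insert by simp
qed auto

lemma fchains_induct [consumes 1, case_names zero one diff]:
  assumes "c \<in> fchains S" "P 0" "\<And>x. x \<in> S \<Longrightarrow> P (frag_of x)" "\<And>a b. P a \<Longrightarrow> P b \<Longrightarrow> P (a - b)"
  shows "P c"
  using assms(1) by (intro frag_induction[of c S P]) (use assms in auto)

lemma fchains_additive: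
  assumes "c \<in> fchains S" "\<And>s. s \<in> S \<Longrightarrow> f (frag_of s) \<in> fchains T" "\<And>a b. f (a - b) = f a - f b"
  shows "f c \<in> fchains T"
  using assms(1)
proof (induction c rule: fchains_induct)
  case zero
  have "f 0 = 0" using assms(3)[of 0 0] by simp
  then show ?case by simp
next
  case (diff a b)
  then show ?case unfolding assms(3) by (rule fchains_diff)
qed (rule assms(2))

lemma fchains_empty: "c \<in> fchains {} \<longleftrightarrow> c = 0"
  by auto

lemma fchains_eq:
  fixes f g :: "('a \<Rightarrow>\<^sub>0 int) \<Rightarrow> 'b \<Rightarrow>\<^sub>0 int"
  assumes c: "c \<in> fchains S" and eq: "\<And>s. s \<in> S \<Longrightarrow> f (frag_of s) = g (frag_of s)"
    and f: "\<And>a b. f (a - b) = f a - f b" and g: "\<And>a b. g (a - b) = g a - g b"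
  shows "f c = g c"
proof -
  have "f c - g c \<in> fchains ({} :: 'b set)"
    by (rule fchains_additive[OF c]) (simp_all add: eq f g)
  then show ?thesis unfolding fchains_empty by simp
qed

lemma fchains_extend:
  assumes "c \<in> fchains S" "\<And>s. s \<in> S \<Longrightarrow> f s \<in> fchains T"
  shows "frag_extend f c \<in> fchains T"
  using assms keys_frag_extend[of f c] by fastforce

lemma frag_extend_additive:
  assumes "\<And>a b. f (a - b) = f a - f b"
  shows "f c = frag_extend (\<lambda>x. f (frag_of x)) c"
proof -
  have "f 0 = 0" using assms[of 0 0] by simp
  have "c \<in> fchains UNIV" by simp
  then show ?thesis
    by (induction c rule: fchains_induct) (simp_all add: assms frag_extend_diff \<open>f 0 = 0\<close>)
qed

section \<open>Chain groups with a group action on the basis\<close>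

definition map_chain :: "('a \<Rightarrow> 'b) \<Rightarrow> ('a \<Rightarrow>\<^sub>0 int) \<Rightarrow> 'b \<Rightarrow>\<^sub>0 int" where
  "map_chain a = frag_extend (frag_of \<circ> a)"

lemma map_chain_simps [simp]:
  "map_chain a 0 = 0" "map_chain a (frag_of x) = frag_of (a x)"
  "map_chain a (c - c') = map_chain a c - map_chain a c'" "map_chain a (c + c') = map_chain a c + map_chain a c'"
  "map_chain a (- c) = - map_chain a c"
  by (simp_all add: map_chain_def frag_extend_diff frag_extend_add frag_extend_minus)

lemma map_chain_cmul: "map_chain a (frag_cmul k c) = frag_cmul k (map_chain a c)"
  by (simp add: map_chain_def frag_extend_cmul)

lemma map_chain_in: "c \<in> fchains S \<Longrightarrow> (\<And>x. x \<in> S \<Longrightarrow> a x \<in> T) \<Longrightarrow> map_chain a c \<in> fchains T"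
  unfolding map_chain_def by (rule fchains_extend) auto

lemma chain_map_eq_map_chain: "chain_map n h = map_chain (simplex_map n h)"
  by (simp add: map_chain_def chain_map_def fun_eq_iff)

text \<open>The chains that become zero in the coinvariants.\<close>

definition act_chains :: "('g, 'm) monoid_scheme \<Rightarrow> 's set \<Rightarrow> ('g \<Rightarrow> 's \<Rightarrow> 's) \<Rightarrow> ('s \<Rightarrow>\<^sub>0 int) set" where
  "act_chains G S a = frag_span {frag_of (a g s) - frag_of s | g s. g \<in> carrier G \<and> s \<in> S}"

lemma act_chains_0: "0 \<in> act_chains G S a"
  unfolding act_chains_def by (rule frag_span_0)

lemma act_chains_diff: "u \<in> act_chains G S a \<Longrightarrow> v \<in> act_chains G S a \<Longrightarrow> u - v \<in> act_chains G S a"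
  unfolding act_chains_def by (rule frag_span_diff)

lemma act_chains_add: "u \<in> act_chains G S a \<Longrightarrow> v \<in> act_chains G S a \<Longrightarrow> u + v \<in> act_chains G S a"
  unfolding act_chains_def by (rule frag_span_add)

lemma act_chains_map:
  fixes f :: "_ \<Rightarrow> 'v \<Rightarrow>\<^sub>0 int"
  assumes f: "\<And>u v. f (u - v) = f u - f v"
    and D: "0 \<in> D" "\<And>u v. u \<in> D \<Longrightarrow> v \<in> D \<Longrightarrow> u - v \<in> D"
    and act: "\<And>g s. g \<in> carrier G \<Longrightarrow> s \<in> S \<Longrightarrow> f (frag_of (a g s)) - f (frag_of s) \<in> D"
    and c: "c \<in> act_chains G S a"
  shows "f c \<in> D"
  by (rule frag_span_image[where f = f and D = D, OF f D _ c[unfolded act_chains_def]])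
     (auto simp: f act)

locale gset = group G for G :: "('g, 'm) monoid_scheme" (structure) +
  fixes S :: "'s set" and act :: "'g \<Rightarrow> 's \<Rightarrow> 's"
  assumes act_in: "g \<in> carrier G \<Longrightarrow> s \<in> S \<Longrightarrow> act g s \<in> S"
    and act_one: "s \<in> S \<Longrightarrow> act \<one> s = s"
    and act_mult: "g \<in> carrier G \<Longrightarrow> h \<in> carrier G \<Longrightarrow> s \<in> S \<Longrightarrow> act (g \<otimes> h) s = act g (act h s)"
begin

lemma map_chain_act_in: "g \<in> carrier G \<Longrightarrow> c \<in> fchains S \<Longrightarrow> map_chain (act g) c \<in> fchains S"
  by (rule map_chain_in) (auto simp: act_in)

lemma map_chain_act_mult:
  assumes "g \<in> carrier G" "h \<in> carrier G" "c \<in> fchains S"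
  shows "map_chain (act (g \<otimes> h)) c = map_chain (act g) (map_chain (act h) c)"
  using assms(3) by (induction c rule: fchains_induct) (use assms act_mult in auto)

lemma act_chains_in: "c \<in> act_chains G S act \<Longrightarrow> c \<in> fchains S"
proof -
  assume "c \<in> act_chains G S act"
  then have "Poly_Mapping.keys c \<subseteq> S"
    unfolding act_chains_def
  proof (rule frag_span_keys[rotated])
    fix b assume "b \<in> {frag_of (act g s) - frag_of s | g s. g \<in> carrier G \<and> s \<in> S}"
    then obtain g s where b: "b = frag_of (act g s) - frag_of s" "g \<in> carrier G" "s \<in> S" by blast
    have "frag_of (act g s) - frag_of s \<in> fchains S"
      by (rule fchains_diff) (use b act_in in auto)
    then show "Poly_Mapping.keys b \<subseteq> S" using b by simp
  qed
  then show ?thesis by simp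
qed

lemma act_diff:
  assumes "c \<in> fchains S" "g \<in> carrier G"
  shows "map_chain (act g) c - c \<in> act_chains G S act"
  using assms(1)
proof (induction c rule: fchains_induct)
  case zero
  then show ?case by (simp add: act_chains_0)
next
  case (one x)
  then show ?case using assms(2) by (auto simp: act_chains_def intro: frag_span_base)
next
  case (diff u v)
  have "map_chain (act g) (u - v) - (u - v) = (map_chain (act g) u - u) - (map_chain (act g) v - v)" by simp
  then show ?case using act_chains_diff[OF diff] by (simp only:)
qed

end

locale free_gset = gset G S act
  for G :: "('g, 'm) monoid_scheme" (structure) and S :: "'s set" and act :: "'g \<Rightarrow> 's \<Rightarrow> 's" +
  assumes act_free: "g \<in> carrier G \<Longrightarrow> s \<in> S \<Longrightarrow> act g s = s \<Longrightarrow> g = \<one>"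
begin

lemma act_inj: "g \<in> carrier G \<Longrightarrow> h \<in> carrier G \<Longrightarrow> s \<in> S \<Longrightarrow> act g s = act h s \<Longrightarrow> g = h"
proof -
  assume a: "g \<in> carrier G" "h \<in> carrier G" "s \<in> S" "act g s = act h s"
  then have "act (inv h \<otimes> g) s = act (inv h \<otimes> h) s" by (simp only: act_mult inv_closed)
  then have "inv h \<otimes> g = \<one>" using a act_free[of "inv h \<otimes> g" s] act_one by simp
  then show ?thesis using a by (metis inv_closed inv_equality inv_inv)
qed

text \<open>A value is chosen at one representative of each orbit and transported. Freeness makes
  the transporting element \<gamma> s unique, which gives equivariance; invariance of Q carries the
  required property along.\<close>

lemma equivariant_choice:
  fixes op :: "'g \<Rightarrow> 'v \<Rightarrow> 'v"
  assumes op: "\<And>g v. g \<in> carrier G \<Longrightarrow> v \<in> V \<Longrightarrow> op g v \<in> V"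
    "\<And>g h v. g \<in> carrier G \<Longrightarrow> h \<in> carrier G \<Longrightarrow> v \<in> V \<Longrightarrow> op (g \<otimes> h) v = op g (op h v)"
    and Q: "\<And>g s v. g \<in> carrier G \<Longrightarrow> s \<in> S \<Longrightarrow> v \<in> V \<Longrightarrow> Q s v \<Longrightarrow> Q (act g s) (op g v)"
    and ex: "\<And>s. s \<in> S \<Longrightarrow> \<exists>v\<in>V. Q s v"
  shows "\<exists>F. \<forall>s\<in>S. F s \<in> V \<and> Q s (F s) \<and> (\<forall>g\<in>carrier G. F (act g s) = op g (F s))"
proof -
  define orb where "orb s = (\<lambda>g. act g s) ` carrier G" for s
  have orb: "orb (act g s) = orb s" if "g \<in> carrier G" "s \<in> S" for g s
  proof (intro equalityI subsetI)
    fix y assume "y \<in> orb (act g s)"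
    then show "y \<in> orb s" using that by (auto simp: orb_def act_mult[symmetric])
  next
    fix y assume "y \<in> orb s"
    then obtain h where h: "h \<in> carrier G" "y = act h s" by (auto simp: orb_def)
    then have "y = act (h \<otimes> inv g) (act g s)" using that by (simp add: act_mult[symmetric] m_assoc)
    then show "y \<in> orb (act g s)" using that h by (auto simp: orb_def)
  qed
  define rep where "rep s = (SOME r. r \<in> orb s)" for s
  define \<gamma> where "\<gamma> s = (THE g. g \<in> carrier G \<and> act g (rep s) = s)" for s
  have rep: "rep s \<in> S" "\<exists>!g. g \<in> carrier G \<and> act g (rep s) = s" if s: "s \<in> S" for s
  proof -
    have "s \<in> orb s" using act_one[OF s] by (auto simp: orb_def image_iff intro!: bexI[of _ \<one>])
    then have "rep s \<in> orb s" unfolding rep_def by (rule someI)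
    then obtain h where h: "h \<in> carrier G" "rep s = act h s" by (auto simp: orb_def)
    then show "rep s \<in> S" using act_in s by simp
    have "act (inv h) (rep s) = s" using h s by (simp add: act_mult[symmetric] act_one)
    then show "\<exists>!g. g \<in> carrier G \<and> act g (rep s) = s"
      using h act_inj[OF _ _ \<open>rep s \<in> S\<close>] by (metis inv_closed)
  qed
  have \<gamma>: "\<gamma> s \<in> carrier G \<and> act (\<gamma> s) (rep s) = s" if s: "s \<in> S" for s
    unfolding \<gamma>_def by (rule theI'[OF rep(2)[OF s]])
  obtain v where v: "\<And>s. s \<in> S \<Longrightarrow> v s \<in> V \<and> Q s (v s)" using ex by metis
  define F where "F s = op (\<gamma> s) (v (rep s))" for s
  have "F s \<in> V \<and> Q s (F s) \<and> (\<forall>g\<in>carrier G. F (act g s) = op g (F s))" if s: "s \<in> S" for s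
  proof (intro conjI ballI)
    show "F s \<in> V" using op(1) \<gamma>[OF s] v[OF rep(1)[OF s]] by (simp add: F_def)
    show "Q s (F s)" using Q[of "\<gamma> s" "rep s" "v (rep s)"] \<gamma>[OF s] v[OF rep(1)[OF s]] rep(1)[OF s] by (simp add: F_def)
    fix g assume g: "g \<in> carrier G"
    have r: "rep (act g s) = rep s" using orb[OF g s] by (simp add: rep_def)
    have "act (\<gamma> (act g s)) (rep s) = act (g \<otimes> \<gamma> s) (rep s)"
      using \<gamma>[OF act_in[OF g s]] \<gamma>[OF s] r g rep(1)[OF s] by (simp add: act_mult)
    then have "\<gamma> (act g s) = g \<otimes> \<gamma> s"
      using act_inj[OF _ _ rep(1)[OF s]] \<gamma>[OF act_in[OF g s]] \<gamma>[OF s] g by simp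
    then show "F (act g s) = op g (F s)"
      using op(2) g \<gamma>[OF s] v[OF rep(1)[OF s]] r by (simp add: F_def)
  qed
  then show ?thesis by blast
qed

end

lemma frag_extend_equivariant:
  assumes c: "c \<in> fchains S" and f: "\<And>s. s \<in> S \<Longrightarrow> f (a s) = map_chain b (f s)"
  shows "frag_extend f (map_chain a c) = map_chain b (frag_extend f c)"
  using c by (induction c rule: fchains_induct) (use f in \<open>auto simp: frag_extend_diff\<close>)

text \<open>Solves \<open>d f\<^sub>n\<^sub>+\<^sub>1 = \<theta>\<^sub>n\<^sub>+\<^sub>1 + l f\<^sub>n \<partial>\<close> equivariantly, modulo the chains on \<open>M\<close>, by induction on the degree:
  with \<open>\<theta> = 0\<close> and \<open>l = 1\<close> the solutions are chain maps, with \<open>l = -1\<close> they are chain homotopies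
  between maps with difference \<open>\<theta>\<close>.\<close>
lemma equivariant_lift:
  fixes G :: "('g, 'm) monoid_scheme" (structure) and S :: "nat \<Rightarrow> 's set" and T :: "nat \<Rightarrow> 't set"
    and l :: int
  assumes S: "\<And>n. free_gset G (S n) (a n)" and T: "\<And>n. gset G (T n) (b n)"
    and A: "\<And>n s g. s \<in> A n \<Longrightarrow> g \<in> carrier G \<Longrightarrow> a n g s \<in> A n" "\<And>n. A n \<subseteq> S n"
    and M: "\<And>n s g. s \<in> M n \<Longrightarrow> g \<in> carrier G \<Longrightarrow> b n g s \<in> M n"
    and del: "\<And>n c c'. del n (c - c') = del n c - del n c'"
      "\<And>n c. c \<in> fchains (S (Suc n)) \<Longrightarrow> del n c \<in> fchains (S n)"
      "\<And>n c. c \<in> fchains (A (Suc n)) \<Longrightarrow> del n c \<in> fchains (A n)"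
      "\<And>n c g. c \<in> fchains (S (Suc n)) \<Longrightarrow> del n (map_chain (a (Suc n) g) c) = map_chain (a n g) (del n c)"
      "\<And>n c. c \<in> fchains (S (Suc (Suc n))) \<Longrightarrow> del n (del (Suc n) c) = 0"
    and d: "\<And>n c c'. d n (c - c') = d n c - d n c'"
      "\<And>n c g. c \<in> fchains (T (Suc n)) \<Longrightarrow> d n (map_chain (b (Suc n) g) c) = map_chain (b n g) (d n c)"
    and \<theta>: "\<And>n c c'. \<theta> n (c - c') = \<theta> n c - \<theta> n c'"
      "\<And>n c. c \<in> fchains (S (Suc n)) \<Longrightarrow> \<theta> (Suc n) c \<in> fchains (T n)"
      "\<And>n c. c \<in> fchains (A (Suc n)) \<Longrightarrow> \<theta> (Suc n) c \<in> fchains (M n)"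
      "\<And>n c g. c \<in> fchains (S (Suc n)) \<Longrightarrow> g \<in> carrier G \<Longrightarrow>
          \<theta> (Suc n) (map_chain (a (Suc n) g) c) = map_chain (b n g) (\<theta> (Suc n) c)"
      "\<And>n c. c \<in> fchains (S (Suc (Suc n))) \<Longrightarrow>
          d n (\<theta> (Suc (Suc n)) c) + frag_cmul l (\<theta> (Suc n) (del (Suc n) c)) \<in> fchains (M n)"
    and l: "l * l = 1"
    and exact: "\<And>n v. v \<in> fchains (T (Suc n)) \<Longrightarrow> d n v \<in> fchains (M n) \<Longrightarrow>
          \<exists>w\<in>fchains (T (Suc (Suc n))). d (Suc n) w - v \<in> fchains (M (Suc n))"
    and Q: "\<And>s. s \<in> S 0 \<Longrightarrow> \<exists>v\<in>fchains (T 0). Q s v \<and> (s \<in> A 0 \<longrightarrow> v = 0)"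
      "\<And>g s v. g \<in> carrier G \<Longrightarrow> s \<in> S 0 \<Longrightarrow> v \<in> fchains (T 0) \<Longrightarrow> Q s v \<Longrightarrow>
          Q (a 0 g s) (map_chain (b 0 g) v)"
    and start: "\<And>f c. (\<And>s. s \<in> S 0 \<Longrightarrow> f s \<in> fchains (T 0)) \<Longrightarrow> (\<And>s. s \<in> S 0 \<Longrightarrow> Q s (f s)) \<Longrightarrow>
          c \<in> fchains (S (Suc 0)) \<Longrightarrow>
          \<exists>w\<in>fchains (T (Suc 0)). d 0 w - (\<theta> (Suc 0) c + frag_cmul l (frag_extend f (del 0 c))) \<in> fchains (M 0)"
  obtains f where
    "\<And>n c c'. f n (c - c') = f n c - f n c'"
    "\<And>n c. c \<in> fchains (S n) \<Longrightarrow> f n c \<in> fchains (T n)" "\<And>n c. c \<in> fchains (A n) \<Longrightarrow> f n c = 0"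
    "\<And>n c g. c \<in> fchains (S n) \<Longrightarrow> g \<in> carrier G \<Longrightarrow> f n (map_chain (a n g) c) = map_chain (b n g) (f n c)"
    "\<And>n c. c \<in> fchains (S (Suc n)) \<Longrightarrow>
       d n (f (Suc n) c) - (\<theta> (Suc n) c + frag_cmul l (f n (del n c))) \<in> fchains (M n)"
    "\<And>s. s \<in> S 0 \<Longrightarrow> Q s (f 0 (frag_of s))"
proof -
  let ?rhs = "\<lambda>n f c. \<theta> (Suc n) c + frag_cmul l (frag_extend f (del n c))"
  have d0: "d n 0 = 0" for n using d(1)[of n 0 0] by simp
  \<comment> \<open>An orbit that meets A lies in A, so prescribing the value 0 on A is compatible
    with transport along orbits.\<close>
  have unact: "s \<in> A n" if "a n g s \<in> A n" "g \<in> carrier G" "s \<in> S n" for n g s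
  proof -
    interpret Sn: free_gset G "S n" "a n" by (rule S)
    have "a n (inv g) (a n g s) \<in> A n" using A(1)[OF that(1)] that(2) by simp
    then show ?thesis using that by (simp add: Sn.act_mult[symmetric] Sn.act_one)
  qed
  \<comment> \<open>Besides the properties of f in degree n, the invariant records that the equation
    of the next degree is solvable for every single chain; the induction step then only has to make
    the solutions equivariant and to restore this promise one degree higher.\<close>
  define P where "P n f \<longleftrightarrow> (n = 0 \<longrightarrow> (\<forall>s\<in>S 0. Q s (f s))) \<and> (\<forall>s\<in>S n. f s \<in> fchains (T n)) \<and> (\<forall>s\<in>A n. f s = 0) \<and>
     (\<forall>s\<in>S n. \<forall>g\<in>carrier G. f (a n g s) = map_chain (b n g) (f s)) \<and>
     (\<forall>c\<in>fchains (S (Suc n)). \<exists>w\<in>fchains (T (Suc n)). d n w - ?rhs n f c \<in> fchains (M n))" for n f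
  define R where "R n f f' \<longleftrightarrow> (\<forall>c\<in>fchains (S (Suc n)). d n (frag_extend f' c) - ?rhs n f c \<in> fchains (M n))" for n f f'
  have "\<exists>f. \<forall>n. P n (f n) \<and> R n (f n) (f (Suc n))"
  proof (rule dependent_nat_choice)
    interpret S0: free_gset G "S 0" "a 0" by (rule S)
    interpret T0: gset G "T 0" "b 0" by (rule T)
    have "\<exists>F. \<forall>s\<in>S 0. F s \<in> fchains (T 0) \<and> (Q s (F s) \<and> (s \<in> A 0 \<longrightarrow> F s = 0)) \<and>
             (\<forall>g\<in>carrier G. F (a 0 g s) = map_chain (b 0 g) (F s))"
    proof (rule S0.equivariant_choice)
      fix g s v assume "g \<in> carrier G" "s \<in> S 0" "v \<in> fchains (T 0)" "Q s v \<and> (s \<in> A 0 \<longrightarrow> v = 0)"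
      then show "Q (a 0 g s) (map_chain (b 0 g) v) \<and> (a 0 g s \<in> A 0 \<longrightarrow> map_chain (b 0 g) v = 0)"
        using Q(2) unact by auto
    qed (use Q(1) T0.map_chain_act_mult T0.map_chain_act_in in blast)+
    then obtain F where F: "\<And>s. s \<in> S 0 \<Longrightarrow> F s \<in> fchains (T 0)" "\<And>s. s \<in> S 0 \<Longrightarrow> Q s (F s)"
      "\<And>s. s \<in> S 0 \<Longrightarrow> s \<in> A 0 \<Longrightarrow> F s = 0"
      "\<And>s g. s \<in> S 0 \<Longrightarrow> g \<in> carrier G \<Longrightarrow> F (a 0 g s) = map_chain (b 0 g) (F s)" by blast
    then have "P 0 F" using start[OF F(1,2)] A(2)[of 0] unfolding P_def by blast
    then show "\<exists>f. P 0 f" by blast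
  next
    fix f n assume P: "P n f"
    interpret Sn: free_gset G "S (Suc n)" "a (Suc n)" by (rule S)
    interpret Tn: gset G "T (Suc n)" "b (Suc n)" by (rule T)
    have f: "\<And>s. s \<in> S n \<Longrightarrow> f s \<in> fchains (T n)" "\<And>s. s \<in> A n \<Longrightarrow> f s = 0"
      "\<And>s g. s \<in> S n \<Longrightarrow> g \<in> carrier G \<Longrightarrow> f (a n g s) = map_chain (b n g) (f s)"
      "\<And>c. c \<in> fchains (S (Suc n)) \<Longrightarrow> \<exists>w\<in>fchains (T (Suc n)). d n w - ?rhs n f c \<in> fchains (M n)"
      using P unfolding P_def by blast+
    have fA: "frag_extend f c = 0" if "c \<in> fchains (A n)" for c
      using that by (induction c rule: fchains_induct) (auto simp: f(2) frag_extend_diff)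
    have "\<exists>F. \<forall>s\<in>S (Suc n). F s \<in> fchains (T (Suc n)) \<and>
             (d n (F s) - ?rhs n f (frag_of s) \<in> fchains (M n) \<and> (s \<in> A (Suc n) \<longrightarrow> F s = 0)) \<and>
             (\<forall>g\<in>carrier G. F (a (Suc n) g s) = map_chain (b (Suc n) g) (F s))"
    proof (rule Sn.equivariant_choice)
      fix s assume s: "s \<in> S (Suc n)"
      show "\<exists>w\<in>fchains (T (Suc n)). d n w - ?rhs n f (frag_of s) \<in> fchains (M n) \<and> (s \<in> A (Suc n) \<longrightarrow> w = 0)"
      proof (cases "s \<in> A (Suc n)")
        case True
        then have c: "frag_of s \<in> fchains (A (Suc n))" by simp
        \<comment> \<open>On A the value 0 solves the equation modulo M: f vanishes on the boundary
          of s, and \<theta> takes s to a chain on M.\<close>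
        have "- ?rhs n f (frag_of s) \<in> fchains (M n)"
          unfolding fA[OF del(3)[OF c]] using \<theta>(3)[OF c] by simp
        then show ?thesis by (intro bexI[of _ 0]) (simp_all add: d0)
      next
        case False
        then show ?thesis using f(4)[of "frag_of s"] s by auto
      qed
    next
      fix g s v
      assume g: "g \<in> carrier G" and s: "s \<in> S (Suc n)" and v: "v \<in> fchains (T (Suc n))"
        and Q: "d n v - ?rhs n f (frag_of s) \<in> fchains (M n) \<and> (s \<in> A (Suc n) \<longrightarrow> v = 0)"
      have c: "frag_of s \<in> fchains (S (Suc n))" using s by simp
      have "?rhs n f (frag_of (a (Suc n) g s)) = map_chain (b n g) (?rhs n f (frag_of s))"
        using frag_extend_equivariant[OF del(2)[OF c], of f "a n g" "b n g"] f(3) g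
          \<theta>(4)[OF c g] del(4)[OF c, of g] by (simp add: map_chain_cmul)
      then have "d n (map_chain (b (Suc n) g) v) - ?rhs n f (frag_of (a (Suc n) g s)) =
          map_chain (b n g) (d n v - ?rhs n f (frag_of s))"
        using d(2)[OF v] by simp
      moreover have "map_chain (b n g) (d n v - ?rhs n f (frag_of s)) \<in> fchains (M n)"
        using Q M(1) g by (intro map_chain_in[of _ "M n"]) auto
      ultimately show "d n (map_chain (b (Suc n) g) v) - ?rhs n f (frag_of (a (Suc n) g s)) \<in> fchains (M n) \<and>
           (a (Suc n) g s \<in> A (Suc n) \<longrightarrow> map_chain (b (Suc n) g) v = 0)"
        using Q unact[OF _ g s] by auto
    qed (use Tn.map_chain_act_mult Tn.map_chain_act_in in blast)+
    then obtain F where F: "\<And>s. s \<in> S (Suc n) \<Longrightarrow> F s \<in> fchains (T (Suc n))"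
        "\<And>s. s \<in> S (Suc n) \<Longrightarrow> d n (F s) - ?rhs n f (frag_of s) \<in> fchains (M n)"
        "\<And>s. s \<in> S (Suc n) \<Longrightarrow> s \<in> A (Suc n) \<Longrightarrow> F s = 0"
        "\<And>s g. s \<in> S (Suc n) \<Longrightarrow> g \<in> carrier G \<Longrightarrow> F (a (Suc n) g s) = map_chain (b (Suc n) g) (F s)"
      by blast
    have F_chain: "d n (frag_extend F c) - ?rhs n f c \<in> fchains (M n)" if "c \<in> fchains (S (Suc n))" for c
      by (rule fchains_additive[OF that, of "\<lambda>c. d n (frag_extend F c) - ?rhs n f c"])
         (use F(2) in \<open>simp_all add: d(1) \<theta>(1) del(1) frag_extend_diff frag_cmul_diff\<close>)
    have "\<exists>w\<in>fchains (T (Suc (Suc n))). d (Suc n) w - ?rhs (Suc n) F c \<in> fchains (M (Suc n))"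
      if c: "c \<in> fchains (S (Suc (Suc n)))" for c
    proof (rule exact)
      show "?rhs (Suc n) F c \<in> fchains (T (Suc n))"
        using F(1) by (intro fchains_add fchains_cmul \<theta>(2)[OF c] fchains_extend[OF del(2)[OF c]])
      let ?c = "del (Suc n) c"
      have dadd: "d n (x + frag_cmul l y) = d n x + frag_cmul l (d n y)" for x y
        using frag_extend_additive[of "d n", OF d(1)] frag_extend_add frag_extend_cmul by metis
      \<comment> \<open>The equation of degree n is applied to the boundary of c, where the term
        with the double boundary drops out. Combined with the compatibility of \<theta> it shows
        that the new right-hand side is a cycle modulo M, which is what \<open>exact\<close> asks
        for.\<close>
      have "d n (frag_extend F ?c) - (\<theta> (Suc n) ?c) \<in> fchains (M n)"
        using F_chain[OF del(2)[OF c]] del(5)[OF c] by simp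
      then have "frag_cmul l (d n (frag_extend F ?c) - \<theta> (Suc n) ?c) +
           (d n (\<theta> (Suc (Suc n)) c) + frag_cmul l (\<theta> (Suc n) ?c)) \<in> fchains (M n)"
        by (intro fchains_add fchains_cmul \<theta>(5)[OF c])
      then show "d n (?rhs (Suc n) F c) \<in> fchains (M n)"
        by (simp add: dadd frag_cmul_distrib2 frag_cmul_diff algebra_simps)
    qed
    then have "P (Suc n) F \<and> R n f F"
      unfolding P_def R_def using F F_chain A(2)[of "Suc n"] by (simp add: subset_iff)
    then show "\<exists>F. P (Suc n) F \<and> R n f F" by blast
  qed
  then obtain f where f: "\<And>n. P n (f n)" "\<And>n. R n (f n) (f (Suc n))" by blast
  have f': "\<And>n s. s \<in> S n \<Longrightarrow> f n s \<in> fchains (T n)" "\<And>n s. s \<in> A n \<Longrightarrow> f n s = 0"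
    "\<And>n s g. s \<in> S n \<Longrightarrow> g \<in> carrier G \<Longrightarrow> f n (a n g s) = map_chain (b n g) (f n s)"
    "\<And>s. s \<in> S 0 \<Longrightarrow> Q s (f 0 s)"
    using f(1)[unfolded P_def] by simp_all
  show ?thesis
  proof (rule that[of "\<lambda>n. frag_extend (f n)"])
    show "frag_extend (f n) c = 0" if "c \<in> fchains (A n)" for n c
      by (rule fchains_eq[OF that, of _ "\<lambda>_. 0"]) (auto simp: f'(2) frag_extend_diff)
    show "frag_extend (f n) c \<in> fchains (T n)" if "c \<in> fchains (S n)" for n c
      by (rule fchains_extend[OF that f'(1)])
    show "frag_extend (f n) (map_chain (a n g) c) = map_chain (b n g) (frag_extend (f n) c)"
      if "c \<in> fchains (S n)" "g \<in> carrier G" for n c g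
      by (rule frag_extend_equivariant[OF that(1)]) (rule f'(3)[OF _ that(2)])
  qed (use f(2) f'(4) in \<open>auto simp: R_def frag_extend_diff\<close>)
qed

section \<open>Singular chains relative to the translates of the total space of a subgroup\<close>

text \<open>The alternating sum of faces, written so that prefixing an entry is visibly a cone
  operator. A tuple with one entry has the empty tuple as its boundary, so the complex carries its
  augmentation with it.\<close>

primrec tuple_boundary :: "'a list \<Rightarrow> 'a list \<Rightarrow>\<^sub>0 int" where
  "tuple_boundary [] = 0"
| "tuple_boundary (x # xs) = frag_of xs - map_chain (Cons x) (tuple_boundary xs)"

abbreviation bd :: "('a list \<Rightarrow>\<^sub>0 int) \<Rightarrow> 'a list \<Rightarrow>\<^sub>0 int" where
  "bd \<equiv> frag_extend tuple_boundary"

lemma bd_cone: "bd (map_chain (Cons x) c) = c - map_chain (Cons x) (bd c)"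
proof -
  have "c \<in> fchains UNIV" by simp
  then show ?thesis
    by (induction c rule: fchains_induct) (auto simp: frag_extend_diff algebra_simps)
qed

lemma bd_bd: "bd (bd c) = 0"
proof -
  have *: "bd (tuple_boundary xs) = 0" for xs :: "'a list"
    by (induction xs) (auto simp: frag_extend_diff bd_cone)
  have "c \<in> fchains UNIV" by simp
  then show ?thesis
    by (induction c rule: fchains_induct) (simp_all add: frag_extend_diff *)
qed

lemma map_chain_compose: "map_chain f (map_chain g c) = map_chain (f \<circ> g) c"
  unfolding map_chain_def frag_extend_compose by (simp add: comp_assoc)

lemma tuple_boundary_map: "tuple_boundary (map f xs) = map_chain (map f) (tuple_boundary xs)"
proof (induction xs)
  case (Cons x xs)
  have "Cons (f x) \<circ> map f = map f \<circ> Cons x" by (simp add: fun_eq_iff)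
  then show ?case by (simp add: Cons map_chain_compose)
qed simp

lemma bd_map: "bd (map_chain (map f) c) = map_chain (map f) (bd c)"
proof -
  have "c \<in> fchains UNIV" by simp
  then show ?thesis
    by (induction c rule: fchains_induct) (auto simp: frag_extend_diff tuple_boundary_map)
qed

lemma keys_tuple_boundary:
  assumes "ys \<in> Poly_Mapping.keys (tuple_boundary xs)" "sorted_wrt R xs"
  shows "Suc (length ys) = length xs \<and> set ys \<subseteq> set xs \<and> sorted_wrt R ys"
  using assms
proof (induction xs arbitrary: ys)
  case (Cons x xs)
  have "ys \<in> Poly_Mapping.keys (frag_of xs) \<union> Poly_Mapping.keys (map_chain (Cons x) (tuple_boundary xs))"
    using Cons.prems(1) keys_diff[of "frag_of xs" "map_chain (Cons x) (tuple_boundary xs)"] by auto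
  then consider "ys = xs" | zs where "zs \<in> Poly_Mapping.keys (tuple_boundary xs)" "ys = x # zs"
    using keys_frag_extend[of "frag_of \<circ> Cons x" "tuple_boundary xs"] by (auto simp: map_chain_def)
  then show ?case
  proof cases
    case 2
    then show ?thesis using Cons.IH[of zs] Cons.prems(2) by auto
  qed (use Cons.prems in auto)
qed simp

text \<open>Together with \<open>base_element\<close> this extracts a group element from each point
  of E G. Translations do not change indices, so choosing the least one makes the extraction
  equivariant.\<close>

definition base_index :: "(nat \<times> 'g \<Rightarrow> real) \<Rightarrow> nat" where
  "base_index f = (LEAST i. \<exists>x. f (i, x) \<noteq> 0)"

definition base_element :: "(nat \<times> 'g \<Rightarrow> real) \<Rightarrow> 'g" where
  "base_element f = (SOME x. f (base_index f, x) \<noteq> 0)"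

lemma base_element:
  assumes "f \<in> milnor_E G"
  shows "f (base_index f, base_element f) \<noteq> 0"
proof -
  have "\<exists>i x. f (i, x) \<noteq> 0" using milnor_E_nonzeroE[OF assms] by metis
  then have "\<exists>x. f (base_index f, x) \<noteq> 0" unfolding base_index_def by (rule LeastI_ex)
  then show ?thesis unfolding base_element_def by (rule someI_ex)
qed

lemma base_element_translate:
  fixes G (structure)
  assumes G: "group G" and h: "h \<in> carrier G" and f: "f \<in> milnor_E G"
  shows "base_element (milnor_translate G h f) = h \<otimes> base_element f"
proof -
  interpret group G by fact
  let ?f = "milnor_translate G h f"
  have "(\<exists>x. ?f (i, x) \<noteq> 0) \<longleftrightarrow> (\<exists>x. f (i, x) \<noteq> 0)" for i
  proof
    assume "\<exists>x. ?f (i, x) \<noteq> 0"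
    then show "\<exists>x. f (i, x) \<noteq> 0" by (auto simp: milnor_translate_def split: if_splits)
  next
    assume "\<exists>x. f (i, x) \<noteq> 0"
    then obtain x where "f (i, x) \<noteq> 0" "x \<in> carrier G" using milnor_E_D(3)[OF f] by blast
    then show "\<exists>x. ?f (i, x) \<noteq> 0" using milnor_translate_apply[OF G h] by metis
  qed
  then have i: "base_index ?f = base_index f" by (simp add: base_index_def)
  have "base_element f \<in> carrier G" using base_element[OF f] milnor_E_D(3)[OF f] by blast
  then have "?f (base_index ?f, h \<otimes> base_element f) \<noteq> 0"
    using milnor_translate_apply[OF G h] base_element[OF f] i by metis
  moreover have "?f (base_index ?f, base_element ?f) \<noteq> 0"
    using base_element[OF milnor_translate_in[OF G h f]] .
  ultimately show ?thesis using milnor_E_D(5)[OF milnor_translate_in[OF G h f]] by metis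
qed

text \<open>The relation \<open>gp\<close> is fixed here but constrained only in
  \<open>general_position\<close>, so that facts about cosets are at hand while the axioms are
  verified for a concrete relation.\<close>

locale coset_tuples = group G for G :: "('g, 'm) monoid_scheme" (structure) +
  fixes P :: "'g set" and gp :: "'g set \<Rightarrow> 'g set \<Rightarrow> bool"
  assumes P: "subgroup P G"
begin

definition cosets :: "'g set set" where
  "cosets = (\<lambda>g. g <# P) ` carrier G"

lemma coset_subset: "\<alpha> \<in> cosets \<Longrightarrow> \<alpha> \<subseteq> carrier G"
  using l_coset_subset_G[OF subgroup.subset[OF P]] by (auto simp: cosets_def)

lemma coset_nonempty: "\<alpha> \<in> cosets \<Longrightarrow> \<alpha> \<noteq> {}"
  using subgroup.one_closed[OF P] by (auto simp: cosets_def l_coset_def)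

lemma coset_eq: "\<alpha> \<in> cosets \<Longrightarrow> x \<in> \<alpha> \<Longrightarrow> x <# P = \<alpha>"
  using l_repr_independence[OF _ _ P] by (auto simp: cosets_def)

lemma translate_coset: "g \<in> carrier G \<Longrightarrow> \<alpha> \<in> cosets \<Longrightarrow> g <# \<alpha> \<in> cosets"
  using lcos_m_assoc[OF subgroup.subset[OF P]] by (auto simp: cosets_def)

lemma P_coset: "P \<in> cosets"
  using lcos_mult_one[OF subgroup.subset[OF P]] by (force simp: cosets_def)

lemma translate_coset_mult:
  "g \<in> carrier G \<Longrightarrow> h \<in> carrier G \<Longrightarrow> \<alpha> \<in> cosets \<Longrightarrow> (g \<otimes> h) <# \<alpha> = g <# (h <# \<alpha>)"
  using lcos_m_assoc[OF coset_subset] by simp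

text \<open>The translate g E P, seen as the join of copies of the coset g P. Only the carrier of
  the record matters; with this carrier it need not be a group.\<close>

abbreviation "piece \<alpha> \<equiv> milnor_E (G\<lparr>carrier := \<alpha>\<rparr>)"

definition "sing n = singular_simplex_set n (top_of_set (milnor_E G))"

definition "sact n g = simplex_map n (milnor_translate G g)"

definition "sing_piece n \<alpha> = singular_simplex_set n (top_of_set (piece \<alpha>))"

definition "sing_coset n = (\<Union>\<alpha>\<in>cosets. sing_piece n \<alpha>)"

lemma piece_iff: "\<alpha> \<in> cosets \<Longrightarrow> f \<in> piece \<alpha> \<longleftrightarrow> f \<in> milnor_E G \<and> (\<forall>i x. f (i, x) \<noteq> 0 \<longrightarrow> x \<in> \<alpha>)"
  using coset_subset[of \<alpha>] by (auto simp: milnor_E_def)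

lemma fchains_sing: "c \<in> fchains (sing n) \<longleftrightarrow> singular_chain n (top_of_set (milnor_E G)) c"
  by (simp add: sing_def singular_chain_def)

lemma fchains_sing_piece: "c \<in> fchains (sing_piece n \<alpha>) \<longleftrightarrow> singular_chain n (top_of_set (piece \<alpha>)) c"
  by (simp add: sing_piece_def singular_chain_def)

lemma sing_piece_subset: "\<alpha> \<in> cosets \<Longrightarrow> sing_piece n \<alpha> \<subseteq> sing n"
proof -
  assume "\<alpha> \<in> cosets"
  then have "piece \<alpha> \<subseteq> milnor_E G" using piece_iff by blast
  then show ?thesis
    unfolding sing_piece_def sing_def by (auto simp: singular_simplex_def topology_standard_simplex Pi_iff subset_iff)
qed

lemma sing_coset_subset: "sing_coset n \<subseteq> sing n"
  unfolding sing_coset_def using sing_piece_subset by blast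

lemma boundary_sing: "c \<in> fchains (sing (Suc n)) \<Longrightarrow> chain_boundary (Suc n) c \<in> fchains (sing n)"
  unfolding fchains_sing by (rule singular_chain_boundary_alt)

lemma boundary_sing_piece:
  "c \<in> fchains (sing_piece (Suc n) \<alpha>) \<Longrightarrow> chain_boundary (Suc n) c \<in> fchains (sing_piece n \<alpha>)"
  unfolding fchains_sing_piece by (rule singular_chain_boundary_alt)

lemma fchains_mono: "c \<in> fchains S \<Longrightarrow> S \<subseteq> T \<Longrightarrow> c \<in> fchains T"
  by auto

lemma fchains_sing_piece_coset: "\<alpha> \<in> cosets \<Longrightarrow> c \<in> fchains (sing_piece n \<alpha>) \<Longrightarrow> c \<in> fchains (sing_coset n)"
  by (auto simp: sing_coset_def)

lemma boundary_sing_coset: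
  "c \<in> fchains (sing_coset (Suc n)) \<Longrightarrow> chain_boundary (Suc n) c \<in> fchains (sing_coset n)"
proof (induction c rule: fchains_induct)
  case (one \<sigma>)
  then obtain \<alpha> where \<alpha>: "\<alpha> \<in> cosets" "\<sigma> \<in> sing_piece (Suc n) \<alpha>" by (auto simp: sing_coset_def)
  then have "chain_boundary (Suc n) (frag_of \<sigma>) \<in> fchains (sing_piece n \<alpha>)"
    by (intro boundary_sing_piece) simp
  then show ?case by (rule fchains_sing_piece_coset[OF \<alpha>(1)])
next
  case (diff a b)
  then show ?case unfolding chain_boundary_diff by (rule fchains_diff)
qed simp

lemma boundary_sact:
  "c \<in> fchains (sing (Suc n)) \<Longrightarrow>
    chain_boundary (Suc n) (map_chain (sact (Suc n) g) c) = map_chain (sact n g) (chain_boundary (Suc n) c)"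
  unfolding fchains_sing sact_def chain_map_eq_map_chain[symmetric]
  using chain_boundary_chain_map by fastforce

lemma continuous_translate:
  assumes "g \<in> carrier G" "\<And>f. f \<in> A \<Longrightarrow> milnor_translate G g f \<in> B"
  shows "continuous_map (top_of_set A) (top_of_set B) (milnor_translate G g)"
  using assms continuous_on_subset[OF continuous_milnor_translate[OF is_group subgroup_self] subset_UNIV]
  by (auto simp: image_subset_iff)

lemma free_gset_sing: "free_gset G (sing n) (sact n)"
proof
  fix g \<sigma> assume g: "g \<in> carrier G" and s: "\<sigma> \<in> sing n"
  show "sact n g \<sigma> \<in> sing n"
    using s singular_simplex_simplex_map continuous_translate[OF g milnor_translate_in[OF is_group g]]
    unfolding sing_def sact_def by blast
  show "g = \<one>" if e: "sact n g \<sigma> = \<sigma>"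
  proof -
    obtain v where v: "v \<in> standard_simplex n" using nonempty_standard_simplex by blast
    then have "\<sigma> v \<in> milnor_E G" using s by (auto simp: sing_def singular_simplex_def topology_standard_simplex)
    moreover have "milnor_translate G g (\<sigma> v) = \<sigma> v"
      using fun_cong[OF e, of v] v by (simp add: sact_def simplex_map_def)
    ultimately show ?thesis using milnor_translate_free[OF is_group g] by blast
  qed
next
  fix \<sigma> assume s: "\<sigma> \<in> sing n"
  show "sact n \<one> \<sigma> = \<sigma>"
    unfolding sact_def using s milnor_translate_one[OF is_group]
    by (intro simplex_map_id_gen[of n "top_of_set (milnor_E G)"]) (auto simp: sing_def)
next
  fix g h \<sigma> assume g: "g \<in> carrier G" "h \<in> carrier G"
  have "milnor_translate G (g \<otimes> h) = milnor_translate G g \<circ> milnor_translate G h"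
    using milnor_translate_translate[OF is_group g] by (simp add: fun_eq_iff)
  then show "sact n (g \<otimes> h) \<sigma> = sact n g (sact n h \<sigma>)"
    by (simp add: sact_def simplex_map_compose)
qed

lemma translate_piece:
  assumes "g \<in> carrier G" "\<alpha> \<in> cosets" "f \<in> piece \<alpha>"
  shows "milnor_translate G g f \<in> piece (g <# \<alpha>)"
proof -
  have f: "f \<in> milnor_E G" "\<And>i x. f (i, x) \<noteq> 0 \<Longrightarrow> x \<in> \<alpha>" using assms piece_iff by auto
  have "x \<in> g <# \<alpha>" if "milnor_translate G g f (i, x) \<noteq> 0" for i x
  proof -
    have x: "x \<in> carrier G" "f (i, inv g \<otimes> x) \<noteq> 0"
      using that by (auto simp: milnor_translate_def split: if_splits)
    then have "inv g \<otimes> x \<in> \<alpha>" using f by blast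
    moreover have "x = g \<otimes> (inv g \<otimes> x)" using x assms by (simp add: m_assoc[symmetric])
    ultimately show ?thesis unfolding l_coset_def by blast
  qed
  then show ?thesis
    using translate_coset[OF assms(1,2)] milnor_translate_in[OF is_group assms(1) f(1)] by (simp add: piece_iff)
qed

lemma sact_sing_coset: "\<sigma> \<in> sing_coset n \<Longrightarrow> g \<in> carrier G \<Longrightarrow> sact n g \<sigma> \<in> sing_coset n"
proof -
  assume s: "\<sigma> \<in> sing_coset n" and g: "g \<in> carrier G"
  obtain \<alpha> where \<alpha>: "\<alpha> \<in> cosets" "\<sigma> \<in> sing_piece n \<alpha>" using s by (auto simp: sing_coset_def)
  then have "sact n g \<sigma> \<in> sing_piece n (g <# \<alpha>)"
    using singular_simplex_simplex_map continuous_translate[OF g translate_piece[OF g \<alpha>(1)]]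
    unfolding sing_piece_def sact_def by blast
  then show ?thesis using translate_coset[OF g \<alpha>(1)] by (auto simp: sing_coset_def)
qed

text \<open>The argument of \<sigma> is vertex 0 of the standard simplex. On simplices inside a
  piece the result identifies the piece; on all others it is an arbitrary but equivariant
  choice.\<close>

definition base_coset :: "((nat \<Rightarrow> real) \<Rightarrow> nat \<times> 'g \<Rightarrow> real) \<Rightarrow> 'g set" where
  "base_coset \<sigma> = base_element (\<sigma> (\<lambda>j. if j = 0 then 1 else 0)) <# P"

lemma sing_apply: "\<sigma> \<in> sing n \<Longrightarrow> \<sigma> (\<lambda>j. if j = 0 then 1 else 0) \<in> milnor_E G"
  by (auto simp: sing_def singular_simplex_def topology_standard_simplex Pi_iff)

lemma sing_piece_apply: "\<sigma> \<in> sing_piece n \<alpha> \<Longrightarrow> \<sigma> (\<lambda>j. if j = 0 then 1 else 0) \<in> piece \<alpha>"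
  by (auto simp: sing_piece_def singular_simplex_def topology_standard_simplex Pi_iff)

lemma base_coset_in: "\<sigma> \<in> sing n \<Longrightarrow> base_coset \<sigma> \<in> cosets"
  unfolding base_coset_def cosets_def
  by (intro imageI milnor_E_D(3)[OF sing_apply base_element[OF sing_apply]])

lemma base_coset_piece: "\<alpha> \<in> cosets \<Longrightarrow> \<sigma> \<in> sing_piece n \<alpha> \<Longrightarrow> base_coset \<sigma> = \<alpha>"
proof -
  assume \<alpha>: "\<alpha> \<in> cosets" and s: "\<sigma> \<in> sing_piece n \<alpha>"
  let ?e = "\<sigma> (\<lambda>j. if j = 0 then 1 else 0)"
  have "?e \<in> milnor_E G" "\<And>i x. ?e (i, x) \<noteq> 0 \<Longrightarrow> x \<in> \<alpha>"
    using sing_piece_apply[OF s] piece_iff[OF \<alpha>] by auto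
  then have "base_element ?e \<in> \<alpha>" using base_element by blast
  then show ?thesis using coset_eq[OF \<alpha>] by (simp add: base_coset_def)
qed

lemma base_coset_sact: "\<sigma> \<in> sing n \<Longrightarrow> g \<in> carrier G \<Longrightarrow> base_coset (sact n g \<sigma>) = g <# base_coset \<sigma>"
proof -
  assume s: "\<sigma> \<in> sing n" and g: "g \<in> carrier G"
  let ?e = "\<sigma> (\<lambda>j. if j = 0 then 1 else 0)"
  have "base_element ?e \<in> carrier G"
    using milnor_E_D(3)[OF sing_apply[OF s] base_element[OF sing_apply[OF s]]] .
  then show ?thesis
    using base_element_translate[OF is_group g sing_apply[OF s]] lcos_m_assoc[OF subgroup.subset[OF P] g]
    by (simp add: base_coset_def sact_def simplex_map_def)
qed

lemma contractible_piece: "\<alpha> \<in> cosets \<Longrightarrow> contractible_space (top_of_set (piece \<alpha>))"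
  using contractible_milnor_E[of "G\<lparr>carrier := \<alpha>\<rparr>"] coset_nonempty by simp

lemma contractible_total: "contractible_space (top_of_set (milnor_E G))"
  using contractible_milnor_E[of G] one_closed by blast

text \<open>On chains in the pieces this is the projection to the summand of one piece. It commutes
  with the boundary there because all faces of a simplex in a piece stay in that piece.\<close>

definition part :: "'g set \<Rightarrow> (((nat \<Rightarrow> real) \<Rightarrow> nat \<times> 'g \<Rightarrow> real) \<Rightarrow>\<^sub>0 int) \<Rightarrow> _ \<Rightarrow>\<^sub>0 int" where
  "part \<alpha> = frag_extend (\<lambda>\<sigma>. if base_coset \<sigma> = \<alpha> then frag_of \<sigma> else 0)"

lemma part_diff: "part \<alpha> (a - b) = part \<alpha> a - part \<alpha> b"
  by (simp add: part_def frag_extend_diff)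

lemma part_piece:
  assumes \<beta>: "\<beta> \<in> cosets" and c: "c \<in> fchains (sing_piece n \<beta>)"
  shows "part \<alpha> c = (if \<alpha> = \<beta> then c else 0)"
  using c by (induction c rule: fchains_induct) (auto simp: part_def frag_extend_diff base_coset_piece[OF \<beta>])

lemma part_in: "c \<in> fchains (sing_coset n) \<Longrightarrow> part \<alpha> c \<in> fchains (sing_piece n \<alpha>)"
proof -
  assume c: "c \<in> fchains (sing_coset n)"
  show ?thesis unfolding part_def
  proof (rule fchains_extend[OF c])
    fix \<sigma> assume "\<sigma> \<in> sing_coset n"
    then show "(if base_coset \<sigma> = \<alpha> then frag_of \<sigma> else 0) \<in> fchains (sing_piece n \<alpha>)"
      using base_coset_piece by (auto simp: sing_coset_def)
  qed
qed

lemma part_boundary: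
  "c \<in> fchains (sing_coset (Suc n)) \<Longrightarrow>
     chain_boundary (Suc n) (part \<alpha> c) = part \<alpha> (chain_boundary (Suc n) c)"
proof (induction c rule: fchains_induct)
  case (one \<sigma>)
  then obtain \<beta> where \<beta>: "\<beta> \<in> cosets" "\<sigma> \<in> sing_piece (Suc n) \<beta>" by (auto simp: sing_coset_def)
  then have s: "frag_of \<sigma> \<in> fchains (sing_piece (Suc n) \<beta>)" by simp
  show ?case
    using part_piece[OF \<beta>(1) s, of \<alpha>] part_piece[OF \<beta>(1) boundary_sing_piece[OF s], of \<alpha>] by auto
qed (simp_all add: part_diff chain_boundary_diff, simp add: part_def)

lemma sum_part:
  assumes "finite F" "base_coset ` Poly_Mapping.keys c \<subseteq> F"
  shows "(\<Sum>\<alpha>\<in>F. part \<alpha> c) = c"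
proof -
  have c: "c \<in> fchains (Poly_Mapping.keys c)" by simp
  have "(\<Sum>\<alpha>\<in>F. part \<alpha> b) = b" if "b \<in> fchains (Poly_Mapping.keys c)" for b
    using that
  proof (induction b rule: fchains_induct)
    case (one \<sigma>)
    have "(\<Sum>\<alpha>\<in>F. part \<alpha> (frag_of \<sigma>)) = (\<Sum>\<alpha>\<in>F. if base_coset \<sigma> = \<alpha> then frag_of \<sigma> else 0)"
      by (simp add: part_def)
    also have "\<dots> = frag_of \<sigma>" using assms one by (subst sum.delta') auto
    finally show ?case .
  qed (simp_all add: part_diff sum_subtractf, simp add: part_def)
  then show ?thesis using c by blast
qed

text \<open>On 0-chains in the pieces this gives the class in H_0 of their disjoint union, which is
  Z[G/P] because each piece is contractible. Cosets are written as tuples with one entry so that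
  \<open>bd\<close> supplies the augmentation.\<close>

definition base_chain :: "(((nat \<Rightarrow> real) \<Rightarrow> nat \<times> 'g \<Rightarrow> real) \<Rightarrow>\<^sub>0 int) \<Rightarrow> 'g set list \<Rightarrow>\<^sub>0 int" where
  "base_chain = map_chain (\<lambda>\<sigma>. [base_coset \<sigma>])"

text \<open>Each part of c is a cycle in a contractible piece and bounds there. In degree 0 this
  requires augmentation 0 on every piece separately, which is the content of the condition on
  \<open>base_chain\<close>.\<close>

lemma sing_coset_cycle_bounds:
  assumes c: "c \<in> fchains (sing_coset n)" and cyc: "chain_boundary n c = 0" "n = 0 \<Longrightarrow> base_chain c = 0"
  obtains w where "w \<in> fchains (sing_coset (Suc n))" "chain_boundary (Suc n) w = c"
proof -
  define F where "F = base_coset ` Poly_Mapping.keys c"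
  have F: "F \<subseteq> cosets" using c base_coset_in[OF subsetD[OF sing_coset_subset]] by (auto simp: F_def)
  have "\<exists>w\<in>fchains (sing_piece (Suc n) \<alpha>). chain_boundary (Suc n) w = part \<alpha> c" if \<alpha>: "\<alpha> \<in> F" for \<alpha>
  proof -
    have \<alpha>': "\<alpha> \<in> cosets" using F \<alpha> by blast
    note ch = part_in[OF c, of \<alpha>, unfolded fchains_sing_piece]
    show ?thesis
    proof (cases n)
      case 0
      \<comment> \<open>Reads off the coefficient of [\<alpha>], which in
        \<open>base_chain c\<close> is the augmentation of the part of c in the piece of
        \<alpha>.\<close>
      define t where "t l = (if l = [\<alpha>] then frag_of () else 0)" for l
      have "frag_extend (\<lambda>_. frag_of ()) (part \<alpha> b) = frag_extend t (base_chain b)" if "b \<in> fchains UNIV" for b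
        using that by (induction b rule: fchains_induct)
          (auto simp: part_def base_chain_def frag_extend_diff t_def)
      then have "frag_extend (\<lambda>_. frag_of ()) (part \<alpha> c) = 0" using cyc(2) 0 by simp
      then show ?thesis
        using contractible_zero_chain_bounds[OF contractible_piece[OF \<alpha>'], of "part \<alpha> c" "()"] ch 0
        by (metis fchains_sing_piece)
    next
      case (Suc m)
      have "chain_boundary n (part \<alpha> c) = part \<alpha> (chain_boundary n c)"
        using part_boundary c Suc by simp
      then have "chain_boundary n (part \<alpha> c) = 0" using cyc by (simp add: part_def)
      then show ?thesis
        using contractible_cycle_bounds[OF contractible_piece[OF \<alpha>'] ch] Suc
        by (metis fchains_sing_piece One_nat_def le_add1 plus_1_eq_Suc)
    qed
  qed
  then obtain w where w: "\<And>\<alpha>. \<alpha> \<in> F \<Longrightarrow> w \<alpha> \<in> fchains (sing_piece (Suc n) \<alpha>)"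
      "\<And>\<alpha>. \<alpha> \<in> F \<Longrightarrow> chain_boundary (Suc n) (w \<alpha>) = part \<alpha> c" by metis
  show ?thesis
  proof
    show "sum w F \<in> fchains (sing_coset (Suc n))"
      using F w(1) fchains_sing_piece_coset by (intro fchains_sum) blast
    have "chain_boundary (Suc n) (sum w F) = (\<Sum>\<alpha>\<in>F. part \<alpha> c)"
      using w(2) by (simp add: chain_boundary_sum)
    then show "chain_boundary (Suc n) (sum w F) = c"
      using sum_part[of F c] by (simp add: F_def)
  qed
qed

text \<open>The boundary of v bounds some u inside the pieces, and v - u is then a cycle of the
  contractible total space. Only for n = 0 is there an obstruction to finding u, namely the class of
  the boundary in Z[G/P].\<close>

lemma relative_exact:
  assumes v: "v \<in> fchains (sing (Suc n))" and dv: "chain_boundary (Suc n) v \<in> fchains (sing_coset n)"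
    and b: "n = 0 \<Longrightarrow> base_chain (chain_boundary (Suc n) v) = 0"
  shows "\<exists>w\<in>fchains (sing (Suc (Suc n))). chain_boundary (Suc (Suc n)) w - v \<in> fchains (sing_coset (Suc n))"
proof -
  have "chain_boundary n (chain_boundary (Suc n) v) = 0"
    using v chain_boundary_boundary_alt unfolding fchains_sing by blast
  then obtain u where u: "u \<in> fchains (sing_coset (Suc n))" "chain_boundary (Suc n) u = chain_boundary (Suc n) v"
    using sing_coset_cycle_bounds[OF dv _ b] by metis
  have "v - u \<in> fchains (sing (Suc n))"
    using v fchains_mono[OF u(1) sing_coset_subset] by (rule fchains_diff)
  then obtain w where "singular_chain (Suc (Suc n)) (top_of_set (milnor_E G)) w" "chain_boundary (Suc (Suc n)) w = v - u"
    using contractible_cycle_bounds[OF contractible_total, of "Suc n" "v - u"] u(2)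
    unfolding fchains_sing by (auto simp: chain_boundary_diff)
  then show ?thesis using u(1) unfolding fchains_sing[symmetric]
    by (intro bexI[of _ w]) (auto simp: )
qed

end

section \<open>Tuples of cosets in general position\<close>

text \<open>\<open>gp_avoid\<close> supplies apexes for cones, and \<open>gp_free\<close> makes the
  action free on pairs and hence on all longer tuples.\<close>

locale general_position = coset_tuples +
  assumes gp_translate: "\<And>g \<alpha> \<beta>. g \<in> carrier G \<Longrightarrow> \<alpha> \<in> cosets \<Longrightarrow> \<beta> \<in> cosets \<Longrightarrow> gp \<alpha> \<beta> \<Longrightarrow> gp (g <# \<alpha>) (g <# \<beta>)"
    and gp_free: "\<And>g \<alpha> \<beta>. g \<in> carrier G \<Longrightarrow> \<alpha> \<in> cosets \<Longrightarrow> \<beta> \<in> cosets \<Longrightarrow> gp \<alpha> \<beta> \<Longrightarrow>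
          g <# \<alpha> = \<alpha> \<Longrightarrow> g <# \<beta> = \<beta> \<Longrightarrow> g = \<one>"
    and gp_avoid: "\<And>F. finite F \<Longrightarrow> F \<subseteq> cosets \<Longrightarrow> \<exists>\<beta>\<in>cosets. \<forall>\<alpha>\<in>F. gp \<beta> \<alpha>"
begin

definition "tup n = {xs. length xs = Suc n \<and> set xs \<subseteq> cosets \<and> sorted_wrt gp xs}"

definition "tact g = map (\<lambda>\<alpha>. g <#\<^bsub>G\<^esub> \<alpha>)"

lemma gset_tup: "gset G (tup n) tact"
proof
  fix g xs assume g: "g \<in> carrier G" and xs: "xs \<in> tup n"
  have "sorted_wrt (\<lambda>\<alpha> \<beta>. gp (g <# \<alpha>) (g <# \<beta>)) xs"
    by (rule sorted_wrt_mono_rel[of xs gp]) (use xs gp_translate[OF g] in \<open>auto simp: tup_def\<close>)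
  then show "tact g xs \<in> tup n"
    using xs translate_coset[OF g] by (auto simp: tup_def tact_def sorted_wrt_map)
next
  fix xs assume "xs \<in> tup n"
  then show "tact \<one> xs = xs"
    using lcos_mult_one[OF coset_subset] by (auto simp: tup_def tact_def intro: map_idI)
next
  fix g h xs assume gh: "g \<in> carrier G" "h \<in> carrier G" and xs: "xs \<in> tup n"
  show "tact (g \<otimes> h) xs = tact g (tact h xs)"
    using xs by (auto simp: tup_def tact_def translate_coset_mult[OF gh])
qed

lemma free_gset_tup: "free_gset G (tup (Suc n)) tact"
proof (intro free_gset.intro free_gset_axioms.intro gset_tup)
  fix g xs assume g: "g \<in> carrier G" and xs: "xs \<in> tup (Suc n)" and e: "tact g xs = xs"
  obtain \<alpha> \<beta> zs where "xs = \<alpha> # \<beta> # zs" using xs by (auto simp: tup_def length_Suc_conv)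
  then show "g = \<one>" using xs e gp_free[OF g, of \<alpha> \<beta>] by (auto simp: tup_def tact_def)
qed

lemma tuple_boundary_tup: "xs \<in> tup (Suc n) \<Longrightarrow> tuple_boundary xs \<in> fchains (tup n)"
  using keys_tuple_boundary[of _ xs gp] by (fastforce simp: tup_def)

lemma bd_tup: "c \<in> fchains (tup (Suc n)) \<Longrightarrow> bd c \<in> fchains (tup n)"
  by (rule fchains_extend) (auto dest: tuple_boundary_tup)

lemma bd_tact: "bd (map_chain (tact g) c) = map_chain (tact g) (bd c)"
  unfolding tact_def by (rule bd_map)

text \<open>A cycle bounds the cone with an apex in general position to all its vertices.\<close>
lemma tup_exact:
  assumes c: "c \<in> fchains (tup n)" and b: "bd c = 0"
  shows "\<exists>w\<in>fchains (tup (Suc n)). bd w = c"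
proof -
  define F where "F = \<Union> (set ` Poly_Mapping.keys c)"
  have xs: "xs \<in> tup n" if "xs \<in> Poly_Mapping.keys c" for xs using c that by blast
  have "finite F" by (simp add: F_def)
  moreover have "F \<subseteq> cosets" using xs by (auto simp: F_def tup_def)
  ultimately have "\<exists>\<beta>\<in>cosets. \<forall>\<alpha>\<in>F. gp \<beta> \<alpha>" by (rule gp_avoid)
  then obtain \<beta> where \<beta>: "\<beta> \<in> cosets" "\<forall>\<alpha>\<in>F. gp \<beta> \<alpha>" by (rule bexE)
  have "map_chain (Cons \<beta>) c \<in> fchains (tup (Suc n))"
  proof (rule map_chain_in)
    show "c \<in> fchains (Poly_Mapping.keys c)" by simp
    fix xs assume k: "xs \<in> Poly_Mapping.keys c"
    then have "set xs \<subseteq> F" by (auto simp: F_def)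
    then show "\<beta> # xs \<in> tup (Suc n)" using xs[OF k] \<beta> by (auto simp: tup_def)
  qed
  moreover have "bd (map_chain (Cons \<beta>) c) = c" by (simp add: bd_cone b)
  ultimately show ?thesis by blast
qed

section \<open>Comparison maps between singular chains and tuples\<close>

lemma base_chain_diff: "base_chain (a - b) = base_chain a - base_chain b"
  by (simp add: base_chain_def)

lemma base_chain_tup: "c \<in> fchains (sing n) \<Longrightarrow> base_chain c \<in> fchains (tup 0)"
  unfolding base_chain_def by (rule map_chain_in) (auto simp: tup_def dest: base_coset_in)

lemma base_chain_sact:
  assumes "c \<in> fchains (sing n)" "g \<in> carrier G"
  shows "base_chain (map_chain (sact n g) c) = map_chain (tact g) (base_chain c)"
  by (rule fchains_eq[OF assms(1)])
     (use assms(2) in \<open>auto simp: base_chain_def base_coset_sact tact_def\<close>)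

lemma chain_boundary_1:
  "chain_boundary (Suc 0) (frag_of \<sigma>) = frag_of (singular_face (Suc 0) 0 \<sigma>) - frag_of (singular_face (Suc 0) (Suc 0) \<sigma>)"
  by (simp add: chain_boundary_of)

text \<open>On tuples with one entry \<open>bd\<close> is the augmentation, so the two ends of a
  path cancel.\<close>

lemma bd_base_chain_boundary: "c \<in> fchains (sing (Suc 0)) \<Longrightarrow> bd (base_chain (chain_boundary (Suc 0) c)) = 0"
  by (rule fchains_eq[of c "sing (Suc 0)" _ "\<lambda>_. 0"])
     (auto simp: chain_boundary_1 base_chain_def chain_boundary_diff frag_extend_diff)

text \<open>Both ends of a path inside a piece have the coset of that piece as base coset. This is
  what allows chains in the pieces to be sent to 0 in degree 1.\<close>

lemma base_chain_piece:
  assumes "c \<in> fchains (sing_coset (Suc 0))"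
  shows "base_chain (chain_boundary (Suc 0) c) = 0"
proof (rule fchains_eq[OF assms, of _ "\<lambda>_. 0"])
  fix \<sigma> assume "\<sigma> \<in> sing_coset (Suc 0)"
  then obtain \<alpha> where \<alpha>: "\<alpha> \<in> cosets" "\<sigma> \<in> sing_piece (Suc 0) \<alpha>" by (auto simp: sing_coset_def)
  have "singular_face (Suc 0) k \<sigma> \<in> sing_piece 0 \<alpha>" if "k \<le> Suc 0" for k
    using \<alpha>(2) singular_simplex_singular_face[of "Suc 0" _ \<sigma> k] that by (simp add: sing_piece_def)
  then have "base_coset (singular_face (Suc 0) k \<sigma>) = \<alpha>" if "k \<le> Suc 0" for k
    using base_coset_piece[OF \<alpha>(1)] that by blast
  then show "base_chain (chain_boundary (Suc 0) (frag_of \<sigma>)) = 0"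
    by (simp add: chain_boundary_1 base_chain_def)
qed (auto simp: chain_boundary_diff base_chain_diff)

lemma boundary_boundary_sing: "c \<in> fchains (sing (Suc (Suc n))) \<Longrightarrow> chain_boundary (Suc n) (chain_boundary (Suc (Suc n)) c) = 0"
  unfolding fchains_sing by (rule chain_boundary_boundary_alt)

definition vertex_simplex :: "'g \<Rightarrow> (nat \<Rightarrow> real) \<Rightarrow> nat \<times> 'g \<Rightarrow> real" where
  "vertex_simplex x = restrict (\<lambda>_. vertex_at 0 x) (standard_simplex 0)"

lemma vertex_simplex:
  assumes "\<alpha> \<in> cosets" "x \<in> \<alpha>"
  shows "vertex_simplex x \<in> sing_piece 0 \<alpha>"
  using vertex_at_in[of x "G\<lparr>carrier := \<alpha>\<rparr>" 0] assms
  by (auto simp: vertex_simplex_def sing_piece_def singular_simplex_def)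

lemma zero_simplices_connected:
  assumes "\<sigma> \<in> sing 0" "\<tau> \<in> sing 0"
  obtains v where "v \<in> fchains (sing (Suc 0))" "chain_boundary (Suc 0) v = frag_of \<tau> - frag_of \<sigma>"
proof -
  have "frag_of \<tau> - frag_of \<sigma> \<in> fchains (sing 0)" by (rule fchains_diff) (use assms in auto)
  moreover have "frag_extend (\<lambda>_. frag_of ()) (frag_of \<tau> - frag_of \<sigma>) = 0"
    by (simp add: frag_extend_diff)
  ultimately show ?thesis
    using contractible_zero_chain_bounds[OF contractible_total, of "frag_of \<tau> - frag_of \<sigma>" "()"] that
    unfolding fchains_sing by blast
qed

text \<open>The index n stands for degree n + 1. In degree 1 a path is sent to a chain of pairs
  whose boundary is the difference of the base cosets of its ends; higher degrees come from
  exactness of tuples. The conditions on \<open>sing_coset\<close> make the map one on relative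
  chains.\<close>

lemma sing_to_tup:
  obtains \<phi> where
    "\<And>n c c'. \<phi> n (c - c') = \<phi> n c - \<phi> n c'"
    "\<And>n c. c \<in> fchains (sing (Suc n)) \<Longrightarrow> \<phi> n c \<in> fchains (tup (Suc n))"
    "\<And>n c. c \<in> fchains (sing_coset (Suc n)) \<Longrightarrow> \<phi> n c = 0"
    "\<And>n c g. c \<in> fchains (sing (Suc n)) \<Longrightarrow> g \<in> carrier G \<Longrightarrow>
        \<phi> n (map_chain (sact (Suc n) g) c) = map_chain (tact g) (\<phi> n c)"
    "\<And>n c. c \<in> fchains (sing (Suc (Suc n))) \<Longrightarrow>
        bd (\<phi> (Suc n) c) = \<phi> n (chain_boundary (Suc (Suc n)) c)"
    "\<And>c. c \<in> fchains (sing (Suc 0)) \<Longrightarrow> bd (\<phi> 0 c) = base_chain (chain_boundary (Suc 0) c)"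
proof (rule equivariant_lift[where S = "\<lambda>n. sing (Suc n)" and a = "\<lambda>n. sact (Suc n)" and G = G
      and T = "\<lambda>n. tup (Suc n)" and b = "\<lambda>n. tact" and A = "\<lambda>n. sing_coset (Suc n)"
      and M = "\<lambda>n. {}" and del = "\<lambda>n. chain_boundary (Suc (Suc n))" and d = "\<lambda>n. bd"
      and \<theta> = "\<lambda>n c. 0" and l = 1
      and Q = "\<lambda>s v. bd v = base_chain (chain_boundary (Suc 0) (frag_of s))"])
  fix \<phi>
  assume \<phi>: "\<And>n c c'. \<phi> n (c - c') = \<phi> n c - \<phi> n c'"
      "\<And>n c. c \<in> fchains (sing (Suc n)) \<Longrightarrow> \<phi> n c \<in> fchains (tup (Suc n))"
      "\<And>n c. c \<in> fchains (sing_coset (Suc n)) \<Longrightarrow> \<phi> n c = 0"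
      "\<And>n c g. c \<in> fchains (sing (Suc n)) \<Longrightarrow> g \<in> carrier G \<Longrightarrow>
        \<phi> n (map_chain (sact (Suc n) g) c) = map_chain (tact g) (\<phi> n c)"
    and rel: "\<And>n c. c \<in> fchains (sing (Suc (Suc n))) \<Longrightarrow>
        bd (\<phi> (Suc n) c) - (0 + frag_cmul 1 (\<phi> n (chain_boundary (Suc (Suc n)) c))) \<in> fchains {}"
    and base: "\<And>s. s \<in> sing (Suc 0) \<Longrightarrow> bd (\<phi> 0 (frag_of s)) = base_chain (chain_boundary (Suc 0) (frag_of s))"
  show thesis
  proof (rule that[OF \<phi>])
    show "bd (\<phi> (Suc n) c) = \<phi> n (chain_boundary (Suc (Suc n)) c)" if "c \<in> fchains (sing (Suc (Suc n)))" for n c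
      using rel[OF that, unfolded fchains_empty] by simp
    show "bd (\<phi> 0 c) = base_chain (chain_boundary (Suc 0) c)" if "c \<in> fchains (sing (Suc 0))" for c
      by (rule fchains_eq[OF that]) (simp_all add: base \<phi>(1) frag_extend_diff chain_boundary_diff base_chain_diff)
  qed
next
  fix v n assume v: "v \<in> fchains (tup (Suc (Suc n)))" and b: "bd v \<in> fchains {}"
  then obtain w where "w \<in> fchains (tup (Suc (Suc (Suc n))))" "bd w = v"
    using tup_exact[OF v] unfolding fchains_empty by blast
  then show "\<exists>w\<in>fchains (tup (Suc (Suc (Suc n)))). bd w - v \<in> fchains {}"
    by (intro bexI[of _ w]) auto
next
  fix s assume "s \<in> sing (Suc 0)"
  then have s: "frag_of s \<in> fchains (sing (Suc 0))" by simp
  show "\<exists>v\<in>fchains (tup (Suc 0)). bd v = base_chain (chain_boundary (Suc 0) (frag_of s)) \<and>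
          (s \<in> sing_coset (Suc 0) \<longrightarrow> v = 0)"
  proof (cases "s \<in> sing_coset (Suc 0)")
    case True
    then show ?thesis using base_chain_piece[of "frag_of s"] by (intro bexI[of _ 0]) simp_all
  next
    case False
    then show ?thesis
      using tup_exact[OF base_chain_tup[OF boundary_sing[OF s]] bd_base_chain_boundary[OF s]] by blast
  qed
  fix g v assume "g \<in> carrier G" "bd v = base_chain (chain_boundary (Suc 0) (frag_of s))"
  then show "bd (map_chain (tact g) v) = base_chain (chain_boundary (Suc 0) (frag_of (sact (Suc 0) g s)))"
    using boundary_sact[OF s, of g] base_chain_sact[OF boundary_sing[OF s]] by (simp add: bd_tact)
next
  fix f c
  assume f: "\<And>s. s \<in> sing (Suc 0) \<Longrightarrow> f s \<in> fchains (tup (Suc 0))"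
    "\<And>s. s \<in> sing (Suc 0) \<Longrightarrow> bd (f s) = base_chain (chain_boundary (Suc 0) (frag_of s))"
    and c: "c \<in> fchains (sing (Suc (Suc 0)))"
  note b = boundary_sing[OF c]
  let ?v = "frag_extend f (chain_boundary (Suc (Suc 0)) c)"
  have "bd ?v = base_chain (chain_boundary (Suc 0) (chain_boundary (Suc (Suc 0)) c))"
    by (rule fchains_eq[OF b]) (simp_all add: f frag_extend_diff chain_boundary_diff base_chain_diff)
  also have "\<dots> = 0" using boundary_boundary_sing[OF c] by (simp add: base_chain_def)
  finally have "\<exists>w\<in>fchains (tup (Suc (Suc 0))). bd w = ?v"
    by (rule tup_exact[rotated]) (rule fchains_extend[OF b f(1)])
  then obtain w where "w \<in> fchains (tup (Suc (Suc 0)))" "bd w = ?v" by (rule bexE)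
  then show "\<exists>w\<in>fchains (tup (Suc (Suc 0))). bd w - (0 + frag_cmul 1 ?v) \<in> fchains {}"
    by (intro bexI[of _ w]) auto
qed (assumption | rule free_gset_sing gset_tup sact_sing_coset sing_coset_subset chain_boundary_diff boundary_sing
      boundary_sing_coset boundary_sact boundary_boundary_sing frag_extend_diff bd_tact | simp)+

text \<open>A pair of cosets is sent to a path in E G from a vertex labelled in the first coset to
  one labelled in the second, so that boundaries correspond with the right sign. Higher degrees rest
  on \<open>relative_exact\<close>, hence hold modulo chains in the pieces.\<close>

lemma tup_to_sing:
  obtains \<psi> where
    "\<And>n c c'. \<psi> n (c - c') = \<psi> n c - \<psi> n c'"
    "\<And>n c. c \<in> fchains (tup (Suc n)) \<Longrightarrow> \<psi> n c \<in> fchains (sing (Suc n))"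
    "\<And>n c g. c \<in> fchains (tup (Suc n)) \<Longrightarrow> g \<in> carrier G \<Longrightarrow>
        \<psi> n (map_chain (tact g) c) = map_chain (sact (Suc n) g) (\<psi> n c)"
    "\<And>n c. c \<in> fchains (tup (Suc (Suc n))) \<Longrightarrow>
        chain_boundary (Suc (Suc n)) (\<psi> (Suc n) c) - \<psi> n (bd c) \<in> fchains (sing_coset (Suc n))"
    "\<And>c. c \<in> fchains (tup (Suc 0)) \<Longrightarrow> chain_boundary (Suc 0) (\<psi> 0 c) \<in> fchains (sing_coset 0)"
    "\<And>c. c \<in> fchains (tup (Suc 0)) \<Longrightarrow> base_chain (chain_boundary (Suc 0) (\<psi> 0 c)) = bd c"
proof (rule equivariant_lift[where S = "\<lambda>n. tup (Suc n)" and a = "\<lambda>n. tact" and G = G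
      and T = "\<lambda>n. sing (Suc n)" and b = "\<lambda>n. sact (Suc n)" and A = "\<lambda>n. {}"
      and M = "\<lambda>n. sing_coset (Suc n)" and del = "\<lambda>n. bd" and d = "\<lambda>n. chain_boundary (Suc (Suc n))"
      and \<theta> = "\<lambda>n c. 0" and l = 1
      and Q = "\<lambda>xs v. chain_boundary (Suc 0) v \<in> fchains (sing_coset 0) \<and>
             base_chain (chain_boundary (Suc 0) v) = bd (frag_of xs)"])
  fix \<psi>
  assume \<psi>: "\<And>n c c'. \<psi> n (c - c') = \<psi> n c - \<psi> n c'"
      "\<And>n c. c \<in> fchains (tup (Suc n)) \<Longrightarrow> \<psi> n c \<in> fchains (sing (Suc n))"
      "\<And>n c g. c \<in> fchains (tup (Suc n)) \<Longrightarrow> g \<in> carrier G \<Longrightarrow>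
        \<psi> n (map_chain (tact g) c) = map_chain (sact (Suc n) g) (\<psi> n c)"
    and rel: "\<And>n c. c \<in> fchains (tup (Suc (Suc n))) \<Longrightarrow>
        chain_boundary (Suc (Suc n)) (\<psi> (Suc n) c) - (0 + frag_cmul 1 (\<psi> n (bd c))) \<in> fchains (sing_coset (Suc n))"
    and base: "\<And>xs. xs \<in> tup (Suc 0) \<Longrightarrow> chain_boundary (Suc 0) (\<psi> 0 (frag_of xs)) \<in> fchains (sing_coset 0) \<and>
             base_chain (chain_boundary (Suc 0) (\<psi> 0 (frag_of xs))) = bd (frag_of xs)"
  show thesis
  proof (rule that[OF \<psi>])
    show "chain_boundary (Suc (Suc n)) (\<psi> (Suc n) c) - \<psi> n (bd c) \<in> fchains (sing_coset (Suc n))"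
      if "c \<in> fchains (tup (Suc (Suc n)))" for n c
      using rel[OF that] by simp
    fix c assume c: "c \<in> fchains (tup (Suc 0))"
    show "chain_boundary (Suc 0) (\<psi> 0 c) \<in> fchains (sing_coset 0)"
      by (rule fchains_additive[OF c, of "\<lambda>c. chain_boundary (Suc 0) (\<psi> 0 c)"])
         (use base in \<open>simp_all add: \<psi>(1) chain_boundary_diff\<close>)
    show "base_chain (chain_boundary (Suc 0) (\<psi> 0 c)) = bd c"
      by (rule fchains_eq[OF c]) (use base in \<open>simp_all add: \<psi>(1) frag_extend_diff chain_boundary_diff base_chain_diff\<close>)
  qed
next
  fix xs assume "xs \<in> tup (Suc 0)"
  then obtain \<alpha> \<beta> where xs: "xs = [\<alpha>, \<beta>]" and ab: "\<alpha> \<in> cosets" "\<beta> \<in> cosets"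
    by (auto simp: tup_def length_Suc_conv)
  obtain x y where xy: "x \<in> \<alpha>" "y \<in> \<beta>" using ab coset_nonempty by blast
  note v = vertex_simplex[OF ab(1) xy(1)] vertex_simplex[OF ab(2) xy(2)]
  obtain w where w: "w \<in> fchains (sing (Suc 0))"
      "chain_boundary (Suc 0) w = frag_of (vertex_simplex y) - frag_of (vertex_simplex x)"
    using zero_simplices_connected v sing_piece_subset ab by blast
  have "chain_boundary (Suc 0) w \<in> fchains (sing_coset 0)"
    unfolding w(2) by (rule fchains_diff) (use v ab in \<open>auto simp: sing_coset_def\<close>)
  moreover have "base_chain (chain_boundary (Suc 0) w) = bd (frag_of xs)"
    using base_coset_piece[OF ab(1) v(1)] base_coset_piece[OF ab(2) v(2)]
    by (simp add: w(2) base_chain_def xs)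
  ultimately show "\<exists>w\<in>fchains (sing (Suc 0)). (chain_boundary (Suc 0) w \<in> fchains (sing_coset 0) \<and>
         base_chain (chain_boundary (Suc 0) w) = bd (frag_of xs)) \<and> (xs \<in> {} \<longrightarrow> w = 0)"
    using w(1) by blast
next
  fix g xs v assume g: "g \<in> carrier G" and v: "v \<in> fchains (sing (Suc 0))"
    and Q: "chain_boundary (Suc 0) v \<in> fchains (sing_coset 0) \<and> base_chain (chain_boundary (Suc 0) v) = bd (frag_of xs)"
  have "map_chain (sact 0 g) (chain_boundary (Suc 0) v) \<in> fchains (sing_coset 0)"
    by (rule map_chain_in[of _ "sing_coset 0"]) (use Q sact_sing_coset[OF _ g] in blast)+
  then show "chain_boundary (Suc 0) (map_chain (sact (Suc 0) g) v) \<in> fchains (sing_coset 0) \<and>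
      base_chain (chain_boundary (Suc 0) (map_chain (sact (Suc 0) g) v)) = bd (frag_of (tact g xs))"
    using base_chain_sact[OF boundary_sing[OF v] g] boundary_sact[OF v] Q
    by (simp add: tuple_boundary_map tact_def)
next
  fix n v assume "v \<in> fchains (sing (Suc (Suc n)))" "chain_boundary (Suc (Suc n)) v \<in> fchains (sing_coset (Suc n))"
  then show "\<exists>w\<in>fchains (sing (Suc (Suc (Suc n)))). chain_boundary (Suc (Suc (Suc n))) w - v \<in> fchains (sing_coset (Suc (Suc n)))"
    by (rule relative_exact) simp
next
  fix f c
  assume f: "\<And>xs. xs \<in> tup (Suc 0) \<Longrightarrow> f xs \<in> fchains (sing (Suc 0))"
    "\<And>xs. xs \<in> tup (Suc 0) \<Longrightarrow> chain_boundary (Suc 0) (f xs) \<in> fchains (sing_coset 0) \<and>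
         base_chain (chain_boundary (Suc 0) (f xs)) = bd (frag_of xs)"
    and c: "c \<in> fchains (tup (Suc (Suc 0)))"
  note b = bd_tup[OF c]
  have "chain_boundary (Suc 0) (frag_extend f (bd c)) \<in> fchains (sing_coset 0)"
    by (rule fchains_additive[OF b, of "\<lambda>c. chain_boundary (Suc 0) (frag_extend f c)"])
       (use f(2) in \<open>simp_all add: frag_extend_diff chain_boundary_diff\<close>)
  moreover have "base_chain (chain_boundary (Suc 0) (frag_extend f (bd c))) = bd (bd c)"
    by (rule fchains_eq[OF b]) (use f(2) in \<open>simp_all add: frag_extend_diff chain_boundary_diff base_chain_diff\<close>)
  ultimately show "\<exists>w\<in>fchains (sing (Suc (Suc 0))). chain_boundary (Suc (Suc 0)) w -
       (0 + frag_cmul 1 (frag_extend f (bd c))) \<in> fchains (sing_coset (Suc 0))"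
    using relative_exact[of "frag_extend f (bd c)" 0] fchains_extend[OF b, of f] f(1) by (simp add: bd_bd)
qed (assumption | rule free_gset_tup free_gset.axioms(1)[OF free_gset_sing] sact_sing_coset chain_boundary_diff
      bd_tup bd_tact boundary_sact bd_bd frag_extend_diff | simp)+

end

section \<open>Chain homotopies\<close>

locale comparison = general_position +
  fixes \<phi> :: "nat \<Rightarrow> (((nat \<Rightarrow> real) \<Rightarrow> nat \<times> 'a \<Rightarrow> real) \<Rightarrow>\<^sub>0 int) \<Rightarrow> 'a set list \<Rightarrow>\<^sub>0 int"
    and \<psi> :: "nat \<Rightarrow> ('a set list \<Rightarrow>\<^sub>0 int) \<Rightarrow> ((nat \<Rightarrow> real) \<Rightarrow> nat \<times> 'a \<Rightarrow> real) \<Rightarrow>\<^sub>0 int"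
  assumes \<phi>_diff: "\<And>n a b. \<phi> n (a - b) = \<phi> n a - \<phi> n b"
    and \<phi>_in: "\<And>n c. c \<in> fchains (sing (Suc n)) \<Longrightarrow> \<phi> n c \<in> fchains (tup (Suc n))"
    and \<phi>_coset: "\<And>n c. c \<in> fchains (sing_coset (Suc n)) \<Longrightarrow> \<phi> n c = 0"
    and \<phi>_act: "\<And>n c g. c \<in> fchains (sing (Suc n)) \<Longrightarrow> g \<in> carrier G \<Longrightarrow>
        \<phi> n (map_chain (sact (Suc n) g) c) = map_chain (tact g) (\<phi> n c)"
    and \<phi>_bd: "\<And>n c. c \<in> fchains (sing (Suc (Suc n))) \<Longrightarrow>
        bd (\<phi> (Suc n) c) = \<phi> n (chain_boundary (Suc (Suc n)) c)"
    and \<phi>_bd_0: "\<And>c. c \<in> fchains (sing (Suc 0)) \<Longrightarrow> bd (\<phi> 0 c) = base_chain (chain_boundary (Suc 0) c)"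
    and \<psi>_diff: "\<And>n a b. \<psi> n (a - b) = \<psi> n a - \<psi> n b"
    and \<psi>_in: "\<And>n c. c \<in> fchains (tup (Suc n)) \<Longrightarrow> \<psi> n c \<in> fchains (sing (Suc n))"
    and \<psi>_act: "\<And>n c g. c \<in> fchains (tup (Suc n)) \<Longrightarrow> g \<in> carrier G \<Longrightarrow>
        \<psi> n (map_chain (tact g) c) = map_chain (sact (Suc n) g) (\<psi> n c)"
    and \<psi>_bd: "\<And>n c. c \<in> fchains (tup (Suc (Suc n))) \<Longrightarrow>
        chain_boundary (Suc (Suc n)) (\<psi> (Suc n) c) - \<psi> n (bd c) \<in> fchains (sing_coset (Suc n))"
    and \<psi>_bd_0: "\<And>c. c \<in> fchains (tup (Suc 0)) \<Longrightarrow> chain_boundary (Suc 0) (\<psi> 0 c) \<in> fchains (sing_coset 0)"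
    and \<psi>_base: "\<And>c. c \<in> fchains (tup (Suc 0)) \<Longrightarrow> base_chain (chain_boundary (Suc 0) (\<psi> 0 c)) = bd c"
begin

lemma \<phi>_0: "\<phi> n 0 = 0" using \<phi>_diff[of n 0 0] by simp

lemma \<psi>_0: "\<psi> n 0 = 0" using \<psi>_diff[of n 0 0] by simp

text \<open>The maps \<phi> \<psi> and id have the same boundary in degree 1, so their difference is
  a cycle there and the homotopy can start. The error of \<psi> as a chain map lies in the pieces,
  and \<phi> kills it.\<close>

lemma tup_homotopy:
  obtains h where
    "\<And>n c c'. h n (c - c') = h n c - h n c'"
    "\<And>n c. c \<in> fchains (tup (Suc n)) \<Longrightarrow> h n c \<in> fchains (tup (Suc (Suc n)))"
    "\<And>n c g. c \<in> fchains (tup (Suc n)) \<Longrightarrow> g \<in> carrier G \<Longrightarrow>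
        h n (map_chain (tact g) c) = map_chain (tact g) (h n c)"
    "\<And>n c. c \<in> fchains (tup (Suc (Suc n))) \<Longrightarrow> bd (h (Suc n) c) = \<phi> (Suc n) (\<psi> (Suc n) c) - c - h n (bd c)"
    "\<And>c. c \<in> fchains (tup (Suc 0)) \<Longrightarrow> bd (h 0 c) = \<phi> 0 (\<psi> 0 c) - c"
proof -
  have \<phi>\<psi>_bd: "bd (\<phi> (Suc n) (\<psi> (Suc n) c)) = \<phi> n (\<psi> n (bd c))" if c: "c \<in> fchains (tup (Suc (Suc n)))" for n c
  proof -
    have "\<phi> n (chain_boundary (Suc (Suc n)) (\<psi> (Suc n) c) - \<psi> n (bd c)) = 0"
      using \<phi>_coset[OF \<psi>_bd[OF c]] .
    then show ?thesis using \<phi>_bd[OF \<psi>_in[OF c]] by (simp add: \<phi>_diff)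
  qed
  have \<phi>\<psi>_bd_0: "bd (\<phi> 0 (\<psi> 0 c)) = bd c" if "c \<in> fchains (tup (Suc 0))" for c
    using \<phi>_bd_0[OF \<psi>_in[OF that]] \<psi>_base[OF that] by simp
  have \<theta>_in: "\<phi> n (\<psi> n c) - c \<in> fchains (tup (Suc n))" if "c \<in> fchains (tup (Suc n))" for n c
    using \<phi>_in[OF \<psi>_in[OF that]] that by (rule fchains_diff)
  have exact: "\<exists>w\<in>fchains (tup (Suc n)). bd w - v \<in> fchains {}" if v: "v \<in> fchains (tup n)" "bd v = 0" for n v
  proof -
    obtain w where "w \<in> fchains (tup (Suc n))" "bd w = v" using tup_exact[OF v] by (rule bexE)
    then show ?thesis by (intro bexI[of _ w]) auto
  qed
  show ?thesis
  proof (rule equivariant_lift[where S = "\<lambda>n. tup (Suc n)" and a = "\<lambda>n. tact" and G = G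
        and T = "\<lambda>n. tup (Suc (Suc n))" and b = "\<lambda>n. tact" and A = "\<lambda>n. {}"
        and M = "\<lambda>n. {}" and del = "\<lambda>n. bd" and d = "\<lambda>n. bd"
        and \<theta> = "\<lambda>n c. \<phi> n (\<psi> n c) - c" and l = "-1"
        and Q = "\<lambda>xs v. bd v = \<phi> 0 (\<psi> 0 (frag_of xs)) - frag_of xs"])
    fix h
    assume h: "\<And>n c c'. h n (c - c') = h n c - h n c'"
        "\<And>n c. c \<in> fchains (tup (Suc n)) \<Longrightarrow> h n c \<in> fchains (tup (Suc (Suc n)))"
        "\<And>n c g. c \<in> fchains (tup (Suc n)) \<Longrightarrow> g \<in> carrier G \<Longrightarrow>
          h n (map_chain (tact g) c) = map_chain (tact g) (h n c)"
      and rel: "\<And>n c. c \<in> fchains (tup (Suc (Suc n))) \<Longrightarrow> bd (h (Suc n) c) -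
         (\<phi> (Suc n) (\<psi> (Suc n) c) - c + frag_cmul (-1) (h n (bd c))) \<in> fchains {}"
      and base: "\<And>xs. xs \<in> tup (Suc 0) \<Longrightarrow> bd (h 0 (frag_of xs)) = \<phi> 0 (\<psi> 0 (frag_of xs)) - frag_of xs"
    show thesis
    proof (rule that[OF h])
      show "bd (h (Suc n) c) = \<phi> (Suc n) (\<psi> (Suc n) c) - c - h n (bd c)" if "c \<in> fchains (tup (Suc (Suc n)))" for n c
        using rel[OF that, unfolded fchains_empty] by simp
      show "bd (h 0 c) = \<phi> 0 (\<psi> 0 c) - c" if "c \<in> fchains (tup (Suc 0))" for c
        by (rule fchains_eq[OF that]) (simp_all add: base h(1) frag_extend_diff \<phi>_diff \<psi>_diff)
    qed
  next
    fix n c g assume "c \<in> fchains (tup (Suc (Suc n)))" "g \<in> carrier G"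
    then show "\<phi> (Suc n) (\<psi> (Suc n) (map_chain (tact g) c)) - map_chain (tact g) c =
         map_chain (tact g) (\<phi> (Suc n) (\<psi> (Suc n) c) - c)"
      by (simp add: \<psi>_act \<phi>_act[OF \<psi>_in])
  next
    fix n c assume c: "c \<in> fchains (tup (Suc (Suc (Suc n))))"
    show "bd (\<phi> (Suc (Suc n)) (\<psi> (Suc (Suc n)) c) - c) + frag_cmul (-1) (\<phi> (Suc n) (\<psi> (Suc n) (bd c)) - bd c) \<in> fchains {}"
      using \<phi>\<psi>_bd[OF c] unfolding fchains_empty by (simp add: frag_extend_diff)
  next
    fix n v assume "v \<in> fchains (tup (Suc (Suc (Suc n))))" "bd v \<in> fchains {}"
    then show "\<exists>w\<in>fchains (tup (Suc (Suc (Suc (Suc n))))). bd w - v \<in> fchains {}"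
      unfolding fchains_empty[of "bd v"] by (rule exact)
  next
    fix xs assume "xs \<in> tup (Suc 0)"
    then have c: "frag_of xs \<in> fchains (tup (Suc 0))" by simp
    have "bd (\<phi> 0 (\<psi> 0 (frag_of xs)) - frag_of xs) = 0"
      using \<phi>\<psi>_bd_0[OF c] by (simp add: frag_extend_diff)
    then show "\<exists>v\<in>fchains (tup (Suc (Suc 0))). bd v = \<phi> 0 (\<psi> 0 (frag_of xs)) - frag_of xs \<and> (xs \<in> {} \<longrightarrow> v = 0)"
      using tup_exact[OF \<theta>_in[OF c]] by simp
    fix g v assume "g \<in> carrier G" "bd v = \<phi> 0 (\<psi> 0 (frag_of xs)) - frag_of xs"
    then show "bd (map_chain (tact g) v) = \<phi> 0 (\<psi> 0 (frag_of (tact g xs))) - frag_of (tact g xs)"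
      using \<psi>_act[OF c, of g] \<phi>_act[OF \<psi>_in[OF c], of g] by (simp add: bd_tact)
  next
    fix f c
    assume f: "\<And>xs. xs \<in> tup (Suc 0) \<Longrightarrow> f xs \<in> fchains (tup (Suc (Suc 0)))"
      "\<And>xs. xs \<in> tup (Suc 0) \<Longrightarrow> bd (f xs) = \<phi> 0 (\<psi> 0 (frag_of xs)) - frag_of xs"
      and c: "c \<in> fchains (tup (Suc (Suc 0)))"
    note b = bd_tup[OF c]
    have "bd (frag_extend f (bd c)) = \<phi> 0 (\<psi> 0 (bd c)) - bd c"
      by (rule fchains_eq[OF b]) (simp_all add: f(2) frag_extend_diff \<phi>_diff \<psi>_diff)
    then have "bd (\<phi> (Suc 0) (\<psi> (Suc 0) c) - c - frag_extend f (bd c)) = 0"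
      using \<phi>\<psi>_bd[OF c] by (simp add: frag_extend_diff)
    moreover have "\<phi> (Suc 0) (\<psi> (Suc 0) c) - c - frag_extend f (bd c) \<in> fchains (tup (Suc (Suc 0)))"
      by (rule fchains_diff[OF \<theta>_in[OF c]], rule fchains_extend[OF b f(1)])
    ultimately show "\<exists>w\<in>fchains (tup (Suc (Suc (Suc 0)))). bd w - (\<phi> (Suc 0) (\<psi> (Suc 0) c) - c +
         frag_cmul (-1) (frag_extend f (bd c))) \<in> fchains {}"
      using exact by simp
  qed (assumption | rule free_gset_tup gset_tup bd_tup bd_tact bd_bd \<theta>_in frag_extend_diff
      | simp add: \<phi>_diff \<psi>_diff \<phi>_0 \<psi>_0)+
qed

text \<open>The induction starts in degree 0, where E G has simplices but there are no tuples: a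
  0-simplex outside the pieces is joined to a vertex in its own base coset. Keeping the base coset,
  expressed by the vanishing \<open>base_chain\<close>, removes the obstruction of
  \<open>relative_exact\<close> in degree 1.\<close>

lemma sing_homotopy:
  obtains h where
    "\<And>n c c'. h n (c - c') = h n c - h n c'"
    "\<And>n c. c \<in> fchains (sing n) \<Longrightarrow> h n c \<in> fchains (sing (Suc n))"
    "\<And>n c. c \<in> fchains (sing_coset n) \<Longrightarrow> h n c = 0"
    "\<And>n c g. c \<in> fchains (sing n) \<Longrightarrow> g \<in> carrier G \<Longrightarrow>
        h n (map_chain (sact n g) c) = map_chain (sact (Suc n) g) (h n c)"
    "\<And>n c. c \<in> fchains (sing (Suc n)) \<Longrightarrow> chain_boundary (Suc (Suc n)) (h (Suc n) c) -
          (\<psi> n (\<phi> n c) - c - h n (chain_boundary (Suc n) c)) \<in> fchains (sing_coset (Suc n))"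
    "\<And>c. c \<in> fchains (sing 0) \<Longrightarrow> chain_boundary (Suc 0) (h 0 c) + c \<in> fchains (sing_coset 0)"
proof -
  \<comment> \<open>The maps \<phi> and \<psi> are indexed by the degree minus 1. The value at n = 0
    is only a default: the equations involve \<theta> at successors.\<close>
  let ?\<theta> = "\<lambda>n c. \<psi> (n - 1) (\<phi> (n - 1) c) - c"
  have \<theta>_in: "\<psi> n (\<phi> n c) - c \<in> fchains (sing (Suc n))" if "c \<in> fchains (sing (Suc n))" for n c
    using \<psi>_in[OF \<phi>_in[OF that]] that by (rule fchains_diff)
  show ?thesis
  proof (rule equivariant_lift[where S = "\<lambda>n. sing n" and a = "\<lambda>n. sact n" and G = G
        and T = "\<lambda>n. sing (Suc n)" and b = "\<lambda>n. sact (Suc n)" and A = "\<lambda>n. sing_coset n"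
        and M = "\<lambda>n. sing_coset (Suc n)" and del = "\<lambda>n. chain_boundary (Suc n)" and d = "\<lambda>n. chain_boundary (Suc (Suc n))"
        and \<theta> = ?\<theta> and l = "-1"
        and Q = "\<lambda>s v. chain_boundary (Suc 0) v + frag_of s \<in> fchains (sing_coset 0) \<and>
           base_chain (chain_boundary (Suc 0) v) = 0"])
    fix h
    assume h: "\<And>n c c'. h n (c - c') = h n c - h n c'"
        "\<And>n c. c \<in> fchains (sing n) \<Longrightarrow> h n c \<in> fchains (sing (Suc n))"
        "\<And>n c. c \<in> fchains (sing_coset n) \<Longrightarrow> h n c = 0"
        "\<And>n c g. c \<in> fchains (sing n) \<Longrightarrow> g \<in> carrier G \<Longrightarrow>
          h n (map_chain (sact n g) c) = map_chain (sact (Suc n) g) (h n c)"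
      and rel: "\<And>n c. c \<in> fchains (sing (Suc n)) \<Longrightarrow> chain_boundary (Suc (Suc n)) (h (Suc n) c) -
         (?\<theta> (Suc n) c + frag_cmul (-1) (h n (chain_boundary (Suc n) c))) \<in> fchains (sing_coset (Suc n))"
      and base: "\<And>s. s \<in> sing 0 \<Longrightarrow> chain_boundary (Suc 0) (h 0 (frag_of s)) + frag_of s \<in> fchains (sing_coset 0) \<and>
           base_chain (chain_boundary (Suc 0) (h 0 (frag_of s))) = 0"
    show thesis
    proof (rule that[OF h])
      show "chain_boundary (Suc (Suc n)) (h (Suc n) c) - (\<psi> n (\<phi> n c) - c - h n (chain_boundary (Suc n) c))
          \<in> fchains (sing_coset (Suc n))" if "c \<in> fchains (sing (Suc n))" for n c
        using rel[OF that] by simp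
      show "chain_boundary (Suc 0) (h 0 c) + c \<in> fchains (sing_coset 0)" if "c \<in> fchains (sing 0)" for c
        by (rule fchains_additive[OF that, of "\<lambda>c. chain_boundary (Suc 0) (h 0 c) + c"])
           (use base in \<open>simp_all add: h(1) chain_boundary_diff\<close>)
    qed
  next
    fix n c assume "c \<in> fchains (sing_coset (Suc n))"
    then show "?\<theta> (Suc n) c \<in> fchains (sing_coset (Suc n))" using \<phi>_coset by (simp add: \<psi>_0)
  next
    fix n c g assume "c \<in> fchains (sing (Suc n))" "g \<in> carrier G"
    then show "?\<theta> (Suc n) (map_chain (sact (Suc n) g) c) = map_chain (sact (Suc n) g) (?\<theta> (Suc n) c)"
      by (simp add: \<phi>_act \<psi>_act[OF \<phi>_in])
  next
    fix n c assume c: "c \<in> fchains (sing (Suc (Suc n)))"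
    show "chain_boundary (Suc (Suc n)) (?\<theta> (Suc (Suc n)) c) +
        frag_cmul (-1) (?\<theta> (Suc n) (chain_boundary (Suc (Suc n)) c)) \<in> fchains (sing_coset (Suc n))"
      using \<psi>_bd[OF \<phi>_in[OF c]] \<phi>_bd[OF c] by (simp add: chain_boundary_diff)
  next
    fix n v assume "v \<in> fchains (sing (Suc (Suc n)))" "chain_boundary (Suc (Suc n)) v \<in> fchains (sing_coset (Suc n))"
    then show "\<exists>w\<in>fchains (sing (Suc (Suc (Suc n)))). chain_boundary (Suc (Suc (Suc n))) w - v \<in> fchains (sing_coset (Suc (Suc n)))"
      by (rule relative_exact) simp
  next
    fix s assume s: "s \<in> sing 0"
    show "\<exists>v\<in>fchains (sing (Suc 0)). (chain_boundary (Suc 0) v + frag_of s \<in> fchains (sing_coset 0) \<and>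
           base_chain (chain_boundary (Suc 0) v) = 0) \<and> (s \<in> sing_coset 0 \<longrightarrow> v = 0)"
    proof (cases "s \<in> sing_coset 0")
      case True
      then show ?thesis by (intro bexI[of _ 0]) (simp_all add: base_chain_def)
    next
      case False
      have \<alpha>: "base_coset s \<in> cosets" using base_coset_in[OF s] .
      then obtain x where x: "x \<in> base_coset s" using coset_nonempty by blast
      note v = vertex_simplex[OF \<alpha> x]
      obtain w where w: "w \<in> fchains (sing (Suc 0))" "chain_boundary (Suc 0) w = frag_of (vertex_simplex x) - frag_of s"
        using zero_simplices_connected[OF s subsetD[OF sing_piece_subset[OF \<alpha>] v]] by blast
      have "chain_boundary (Suc 0) w + frag_of s \<in> fchains (sing_coset 0)"
        unfolding w(2) using v \<alpha> by (auto simp: sing_coset_def)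
      moreover have "base_chain (chain_boundary (Suc 0) w) = 0"
        unfolding w(2) using base_coset_piece[OF \<alpha> v] by (simp add: base_chain_def)
      ultimately show ?thesis using w(1) False by blast
    qed
    fix g v assume g: "g \<in> carrier G" and v: "v \<in> fchains (sing (Suc 0))"
      and Q: "chain_boundary (Suc 0) v + frag_of s \<in> fchains (sing_coset 0) \<and> base_chain (chain_boundary (Suc 0) v) = 0"
    have "map_chain (sact 0 g) (chain_boundary (Suc 0) v + frag_of s) \<in> fchains (sing_coset 0)"
      by (rule map_chain_in[of _ "sing_coset 0"]) (use Q sact_sing_coset[OF _ g] in blast)+
    then show "chain_boundary (Suc 0) (map_chain (sact (Suc 0) g) v) + frag_of (sact 0 g s) \<in> fchains (sing_coset 0) \<and>
        base_chain (chain_boundary (Suc 0) (map_chain (sact (Suc 0) g) v)) = 0"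
      using base_chain_sact[OF boundary_sing[OF v] g] boundary_sact[OF v] Q by simp
  next
    fix f c
    assume f: "\<And>s. s \<in> sing 0 \<Longrightarrow> f s \<in> fchains (sing (Suc 0))"
      "\<And>s. s \<in> sing 0 \<Longrightarrow> chain_boundary (Suc 0) (f s) + frag_of s \<in> fchains (sing_coset 0) \<and>
           base_chain (chain_boundary (Suc 0) (f s)) = 0"
      and c: "c \<in> fchains (sing (Suc 0))"
    note b = boundary_sing[OF c]
    have f_bd: "chain_boundary (Suc 0) (frag_extend f e) + e \<in> fchains (sing_coset 0)" if "e \<in> fchains (sing 0)" for e
      by (rule fchains_additive[OF that, of "\<lambda>c. chain_boundary (Suc 0) (frag_extend f c) + c"])
         (use f(2) in \<open>simp_all add: frag_extend_diff chain_boundary_diff\<close>)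
    have f_base: "base_chain (chain_boundary (Suc 0) (frag_extend f e)) = 0" if "e \<in> fchains (sing 0)" for e
      by (rule fchains_eq[OF that, of _ "\<lambda>_. 0"])
         (use f(2) in \<open>simp_all add: frag_extend_diff chain_boundary_diff base_chain_diff\<close>)
    let ?v = "\<psi> 0 (\<phi> 0 c) - c - frag_extend f (chain_boundary (Suc 0) c)"
    have v: "?v \<in> fchains (sing (Suc 0))"
      by (rule fchains_diff[OF \<theta>_in[OF c]], rule fchains_extend[OF b f(1)])
    have e: "chain_boundary (Suc 0) ?v = chain_boundary (Suc 0) (\<psi> 0 (\<phi> 0 c)) -
       (chain_boundary (Suc 0) (frag_extend f (chain_boundary (Suc 0) c)) + chain_boundary (Suc 0) c)"
      by (simp only: chain_boundary_diff) simp
    have "chain_boundary (Suc 0) ?v \<in> fchains (sing_coset 0)"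
      unfolding e by (rule fchains_diff[OF \<psi>_bd_0[OF \<phi>_in[OF c]] f_bd[OF b]])
    moreover have "base_chain (chain_boundary (Suc 0) ?v) = 0"
      using \<psi>_base[OF \<phi>_in[OF c]] \<phi>_bd_0[OF c] f_base[OF b]
      by (simp only: chain_boundary_diff base_chain_diff) simp
    ultimately have "\<exists>w\<in>fchains (sing (Suc (Suc 0))). chain_boundary (Suc (Suc 0)) w - ?v \<in> fchains (sing_coset (Suc 0))"
      by (rule relative_exact[OF v])
    then show "\<exists>w\<in>fchains (sing (Suc (Suc 0))). chain_boundary (Suc (Suc 0)) w -
         (?\<theta> (Suc 0) c + frag_cmul (-1) (frag_extend f (chain_boundary (Suc 0) c))) \<in> fchains (sing_coset (Suc 0))"
      by simp
  qed (assumption | rule free_gset_sing free_gset.axioms(1)[OF free_gset_sing] sact_sing_coset sing_coset_subset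
      chain_boundary_diff boundary_sing boundary_sing_coset boundary_sact boundary_boundary_sing
      | simp add: \<phi>_diff \<psi>_diff \<theta>_in[simplified])+
qed

end

section \<open>Coinvariants and relative homology\<close>

text \<open>The first isomorphism theorem for f followed by the quotient map of B; accordingly f has
  to be surjective only modulo N.\<close>

lemma quotient_iso:
  assumes A: "group A" and N: "N \<lhd> B" and f: "f \<in> hom A B"
    and K: "K = {a \<in> carrier A. f a \<in> N}"
    and surj: "\<And>b. b \<in> carrier B \<Longrightarrow> \<exists>a\<in>carrier A. \<exists>m\<in>N. b = m \<otimes>\<^bsub>B\<^esub> f a"
  shows "A Mod K \<cong> B Mod N" "B Mod N \<cong> A Mod K"
proof -
  interpret A: group A by fact
  interpret N: normal N B by fact
  interpret Q: group "B Mod N" by (rule N.factorgroup_is_group)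
  have fB: "f a \<in> carrier B" if "a \<in> carrier A" for a using f that by (auto simp: hom_def)
  let ?h = "(\<lambda>b. N #>\<^bsub>B\<^esub> b) \<circ> f"
  have "?h \<in> hom A (B Mod N)"
    using hom_compose[OF f N.r_coset_hom_Mod] .
  then interpret h: group_hom A "B Mod N" ?h
    by unfold_locales
  have kernel: "kernel A (B Mod N) ?h = K"
  proof -
    have "N #>\<^bsub>B\<^esub> f a = N \<longleftrightarrow> f a \<in> N" if "a \<in> carrier A" for a
      using N.coset_join1[of N "f a"] N.coset_join2[of "f a" N] fB[OF that] N.is_subgroup by blast
    then show ?thesis by (auto simp: kernel_def K FactGroup_def)
  qed
  have "?h ` carrier A = carrier (B Mod N)"
  proof
    show "carrier (B Mod N) \<subseteq> ?h ` carrier A"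
    proof
      fix X assume "X \<in> carrier (B Mod N)"
      then obtain b where b: "b \<in> carrier B" "X = N #>\<^bsub>B\<^esub> b" by (auto simp: FactGroup_def RCOSETS_def)
      then obtain a m where a: "a \<in> carrier A" "m \<in> N" "b = m \<otimes>\<^bsub>B\<^esub> f a" using surj by blast
      have "X = (N #>\<^bsub>B\<^esub> m) #>\<^bsub>B\<^esub> f a"
        using a b fB N.subset N.coset_mult_assoc[of N m "f a"] by auto
      also have "N #>\<^bsub>B\<^esub> m = N" using a N.subset N.coset_join2[of m N] N.is_subgroup by auto
      finally show "X \<in> ?h ` carrier A" using a by auto
    qed
  qed (use h.hom_closed in blast)
  with kernel show iso: "A Mod K \<cong> B Mod N"
    using h.FactGroup_iso is_isoI by metis
  have "group (A Mod K)"
    using normal.factorgroup_is_group[OF h.normal_kernel] kernel by simp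
  then show "B Mod N \<cong> A Mod K" using group.iso_sym iso by blast
qed

context general_position
begin

text \<open>The kernel of the passage from singular chains of E G to relative chains of (B G, B P),
  as \<open>proj_trivial\<close> and \<open>proj_kernel\<close> show.\<close>

definition "trivial_chains n =
  frag_span (frag_of ` sing_coset n \<union> {frag_of (sact n g s) - frag_of s | g s. g \<in> carrier G \<and> s \<in> sing n})"

text \<open>In degree 0 there are no tuples, since the complex of truncated simplices starts in degree 1.\<close>

definition "tuples n = (if n = 0 then {} else tup n)"

abbreviation "tuple_act_chains n \<equiv> act_chains G (tuples n) tact"

definition "tuples_bd n c = (if n \<ge> 2 then bd c else 0)"

text \<open>Cycles and boundaries of the coinvariants are represented by chains upstairs that
  satisfy the equations modulo \<open>act_chains\<close>.\<close>

definition "tuple_cycles n = {c \<in> fchains (tuples n). n \<ge> 1 \<longrightarrow> tuples_bd n c \<in> tuple_act_chains (n - 1)}"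

definition "tuple_boundaries n =
  {tuples_bd (Suc n) w + m | w m. w \<in> fchains (tuples (Suc n)) \<and> m \<in> tuple_act_chains n}"

definition "tuple_cycle_group n = subgroup_generated (free_Abelian_group (tuples n)) (tuple_cycles n)"

definition "tuple_homology n = tuple_cycle_group n Mod tuple_boundaries n"

lemma tuples_bd_diff: "tuples_bd n (a - b) = tuples_bd n a - tuples_bd n b"
  by (simp add: tuples_bd_def frag_extend_diff)

lemma tuples_bd_add: "tuples_bd n (a + b) = tuples_bd n a + tuples_bd n b"
  by (simp add: tuples_bd_def frag_extend_add)

lemma tuples_bd_in: "c \<in> fchains (tuples (Suc n)) \<Longrightarrow> tuples_bd (Suc n) c \<in> fchains (tuples n)"
  using bd_tup[of c n] by (cases n) (auto simp: tuples_bd_def tuples_def)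

lemma tuples_bd_tuples_bd: "tuples_bd n (tuples_bd (Suc n) c) = 0"
  by (simp add: tuples_bd_def bd_bd)

lemma gset_tuples: "gset G (tuples n) tact"
  using gset_tup[of n] by (cases n) (auto simp: tuples_def gset_def gset_axioms_def)

lemma trivial_chains_diff: "a \<in> trivial_chains n \<Longrightarrow> b \<in> trivial_chains n \<Longrightarrow> a - b \<in> trivial_chains n"
  unfolding trivial_chains_def by (rule frag_span_diff)

lemma trivial_chains_add: "a \<in> trivial_chains n \<Longrightarrow> b \<in> trivial_chains n \<Longrightarrow> a + b \<in> trivial_chains n"
  unfolding trivial_chains_def by (rule frag_span_add)

lemma trivial_chains_0: "0 \<in> trivial_chains n"
  unfolding trivial_chains_def by (rule frag_span_0)

lemma act_diff_trivial_chains: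
  assumes "c \<in> fchains (sing n)" "g \<in> carrier G"
  shows "map_chain (sact n g) c - c \<in> trivial_chains n"
proof (rule act_chains_map[where f = "\<lambda>c. c", OF refl trivial_chains_0 trivial_chains_diff])
  show "map_chain (sact n g) c - c \<in> act_chains G (sing n) (sact n)"
    by (rule gset.act_diff[OF free_gset.axioms(1)[OF free_gset_sing] assms])
qed (auto simp: trivial_chains_def intro: frag_span_base)

lemma sing_coset_trivial: "c \<in> fchains (sing_coset n) \<Longrightarrow> c \<in> trivial_chains n"
  by (induction c rule: fchains_induct)
     (auto simp: trivial_chains_def intro: frag_span_0 frag_span_diff frag_span_base)

lemma trivial_chains_map:
  fixes f :: "_ \<Rightarrow> 'v \<Rightarrow>\<^sub>0 int"
  assumes f: "\<And>a b. f (a - b) = f a - f b"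
    and D: "0 \<in> D" "\<And>a b. a \<in> D \<Longrightarrow> b \<in> D \<Longrightarrow> a - b \<in> D"
    and coset: "\<And>s. s \<in> sing_coset n \<Longrightarrow> f (frag_of s) \<in> D"
    and act: "\<And>g s. g \<in> carrier G \<Longrightarrow> s \<in> sing n \<Longrightarrow> f (frag_of (sact n g s)) - f (frag_of s) \<in> D"
    and c: "c \<in> trivial_chains n"
  shows "f c \<in> D"
  by (rule frag_span_image[where f = f and D = D, OF f D _ c[unfolded trivial_chains_def]])
     (auto simp: f coset act)

lemma tuples_bd_act_chains:
  assumes "c \<in> tuple_act_chains (Suc n)"
  shows "tuples_bd (Suc n) c \<in> tuple_act_chains n"
proof (rule act_chains_map[OF tuples_bd_diff act_chains_0 act_chains_diff _ assms])
  fix g xs assume g: "g \<in> carrier G" and xs: "xs \<in> tuples (Suc n)"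
  have "tuples_bd (Suc n) (frag_of (tact g xs)) = map_chain (tact g) (tuples_bd (Suc n) (frag_of xs))"
    using bd_tact[of g "frag_of xs"] by (simp add: tuples_bd_def)
  then show "tuples_bd (Suc n) (frag_of (tact g xs)) - tuples_bd (Suc n) (frag_of xs) \<in> tuple_act_chains n"
    using gset.act_diff[OF gset_tuples tuples_bd_in g, of "frag_of xs" n] xs by simp
qed

lemma subgroup_tuple_cycles: "subgroup (tuple_cycles n) (free_Abelian_group (tuples n))"
proof -
  interpret F: group "free_Abelian_group (tuples n)" by simp
  have "0 \<in> tuple_cycles n" by (simp add: tuple_cycles_def tuples_bd_def act_chains_0)
  moreover have "a + b \<in> tuple_cycles n" if "a \<in> tuple_cycles n" "b \<in> tuple_cycles n" for a b
    using that fchains_add[of a "tuples n" b] act_chains_add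
    by (auto simp: tuple_cycles_def tuples_bd_add)
  moreover have "- a \<in> tuple_cycles n" if "a \<in> tuple_cycles n" for a
  proof -
    have "tuples_bd n (- a) = 0 - tuples_bd n a" by (simp add: tuples_bd_def frag_extend_minus)
    then show ?thesis using that act_chains_diff[OF act_chains_0]
      by (auto simp: tuple_cycles_def)
  qed
  ultimately show ?thesis
    by (intro F.subgroupI) (auto simp: tuple_cycles_def)
qed

lemma tuple_cycle_group: "group (tuple_cycle_group n)" "carrier (tuple_cycle_group n) = tuple_cycles n"
  "a \<otimes>\<^bsub>tuple_cycle_group n\<^esub> b = a + b"
proof -
  show "group (tuple_cycle_group n)"
    unfolding tuple_cycle_group_def by (rule group.group_subgroup_generated) simp
  show "carrier (tuple_cycle_group n) = tuple_cycles n"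
    unfolding tuple_cycle_group_def
    by (rule subgroup.carrier_subgroup_generated_subgroup[OF subgroup_tuple_cycles])
qed (simp add: tuple_cycle_group_def)

section \<open>Relative singular chains of (B G, B P) as coinvariants\<close>

abbreviation "BG \<equiv> classifying_space G"

abbreviation "BP \<equiv> classifying_map G ` topspace (classifying_space (G\<lparr>carrier := P\<rparr>))"

definition "proj n = chain_map n (milnor_orbit G)"

lemma proj_diff: "proj n (a - b) = proj n a - proj n b"
  by (simp add: proj_def chain_map_diff)

lemma proj_add: "proj n (a + b) = proj n a + proj n b"
  by (simp add: proj_def chain_map_add)

lemma continuous_milnor_orbit: "continuous_map (top_of_set (milnor_E G)) BG (milnor_orbit G)"
  by (rule quotient_imp_continuous_map[OF quotient_map_milnor_orbit])

lemma proj_in: "c \<in> fchains (sing n) \<Longrightarrow> singular_chain n BG (proj n c)"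
  unfolding fchains_sing proj_def by (rule singular_chain_chain_map[OF _ continuous_milnor_orbit])

lemma proj_boundary:
  "c \<in> fchains (sing (Suc n)) \<Longrightarrow> chain_boundary (Suc n) (proj (Suc n) c) = proj n (chain_boundary (Suc n) c)"
  unfolding fchains_sing proj_def using chain_boundary_chain_map by fastforce

text \<open>Translation by the inverse of g takes the piece of g P to that of P and leaves orbits
  unchanged.\<close>

lemma orbit_piece: "f \<in> piece \<alpha> \<Longrightarrow> \<alpha> \<in> cosets \<Longrightarrow> milnor_orbit G f \<in> BP"
proof -
  assume f: "f \<in> piece \<alpha>" and \<alpha>: "\<alpha> \<in> cosets"
  then obtain g where g: "g \<in> carrier G" "\<alpha> = g <# P" by (auto simp: cosets_def)
  have Pg: "P \<subseteq> carrier G" using subgroup.subset[OF P] .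
  have "inv g <# \<alpha> = P" using g lcos_m_assoc[OF Pg, of "inv g" g] lcos_mult_one[OF Pg] by simp
  then have t: "milnor_translate G (inv g) f \<in> piece P" using translate_piece[OF _ \<alpha> f, of "inv g"] g by simp
  have "f \<in> milnor_E G" using f piece_iff[OF \<alpha>] by blast
  then have "milnor_orbit G f = milnor_orbit G (milnor_translate G (inv g) f)"
    using milnor_orbit_translate[OF is_group, of "inv g" f] g by simp
  also have "\<dots> = classifying_map G (milnor_orbit (G\<lparr>carrier := P\<rparr>) (milnor_translate G (inv g) f))"
    using classifying_map_orbit[OF is_group P t] by simp
  finally show ?thesis using t by auto
qed

lemma proj_trivial:
  assumes "c \<in> trivial_chains n"
  shows "singular_chain n (subtopology BG BP) (proj n c)"
proof -
  let ?D = "fchains (singular_simplex_set n (subtopology BG BP))"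
  have "proj n c \<in> ?D"
  proof (rule trivial_chains_map[OF proj_diff _ fchains_diff _ _ assms])
    fix s assume s: "s \<in> sing_coset n"
    then obtain \<alpha> where \<alpha>: "\<alpha> \<in> cosets" "s \<in> sing_piece n \<alpha>" by (auto simp: sing_coset_def)
    have "singular_simplex n BG (simplex_map n (milnor_orbit G) s)"
      using s sing_coset_subset singular_simplex_simplex_map[OF _ continuous_milnor_orbit] by (auto simp: sing_def)
    moreover have "simplex_map n (milnor_orbit G) s ` standard_simplex n \<subseteq> BP"
      using \<alpha> orbit_piece
      by (auto simp: simplex_map_def sing_piece_def singular_simplex_def topology_standard_simplex Pi_iff
               simp del: topspace_classifying_space)
    ultimately show "proj n (frag_of s) \<in> ?D"
      by (simp add: proj_def singular_simplex_subtopology)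
  next
    fix g s assume g: "g \<in> carrier G" and s: "s \<in> sing n"
    have "simplex_map n (milnor_orbit G) (sact n g s) = simplex_map n (milnor_orbit G) s"
      using s milnor_orbit_translate[OF is_group g]
      by (auto simp: sact_def simplex_map_def sing_def singular_simplex_def topology_standard_simplex Pi_iff
          fun_eq_iff restrict_def)
    then show "proj n (frag_of (sact n g s)) - proj n (frag_of s) \<in> ?D"
      by (simp add: proj_def)
  qed simp_all
  then show ?thesis by (simp add: singular_chain_def)
qed

text \<open>A simplex of B P has to be lifted into a piece, not merely into E G. The embedding turns
  it into a simplex of the classifying space of P, and lifting through the bundle of P lands in the
  piece of P.\<close>

lemma lift_simplex:
  assumes "singular_simplex n BG \<tau>"
  shows "\<exists>\<sigma>\<in>sing n. simplex_map n (milnor_orbit G) \<sigma> = \<tau> \<and> (singular_simplex n (subtopology BG BP) \<tau> \<longrightarrow> \<sigma> \<in> sing_coset n)"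
proof (cases "singular_simplex n (subtopology BG BP) \<tau>")
  case False
  then show ?thesis using lift_singular_simplex[OF is_group assms] unfolding sing_def by blast
next
  case True
  let ?GP = "G\<lparr>carrier := P\<rparr>"
  have GP: "group ?GP" by (rule subgroup_imp_group[OF P])
  obtain r where r: "homeomorphic_maps (classifying_space ?GP) (subtopology BG BP) (classifying_map G) r"
    using embedding_classifying_map[OF is_group P] by (auto simp: embedding_map_def homeomorphic_map_maps)
  have rc: "continuous_map (subtopology BG BP) (classifying_space ?GP) r"
    and rr: "\<And>y. y \<in> topspace (subtopology BG BP) \<Longrightarrow> classifying_map G (r y) = y"
    using r by (auto simp: homeomorphic_maps_def)
  obtain \<sigma> where \<sigma>: "singular_simplex n (top_of_set (piece P)) \<sigma>"
      "simplex_map n (milnor_orbit ?GP) \<sigma> = simplex_map n r \<tau>"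
    using lift_singular_simplex[OF GP singular_simplex_simplex_map[OF True rc]] by blast
  have s: "\<sigma> \<in> sing_piece n P" using \<sigma> by (simp add: sing_piece_def)
  have "simplex_map n (milnor_orbit G) \<sigma> = simplex_map n (classifying_map G) (simplex_map n (milnor_orbit ?GP) \<sigma>)"
    using \<sigma>(1) classifying_map_orbit[OF is_group P]
    by (auto simp: simplex_map_def singular_simplex_def topology_standard_simplex Pi_iff fun_eq_iff restrict_def)
  also have "\<dots> = simplex_map n (classifying_map G \<circ> r) \<tau>"
    by (simp add: \<sigma>(2) simplex_map_compose)
  also have "\<dots> = \<tau>"
    by (rule simplex_map_id_gen[OF True]) (use rr in simp)
  finally show ?thesis
    using s sing_piece_subset[OF P_coset] P_coset by (intro bexI[of _ \<sigma>]) (auto simp: sing_coset_def)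
qed

definition "lift n \<tau> = (SOME \<sigma>. \<sigma> \<in> sing n \<and> simplex_map n (milnor_orbit G) \<sigma> = \<tau> \<and>
  (singular_simplex n (subtopology BG BP) \<tau> \<longrightarrow> \<sigma> \<in> sing_coset n))"

lemma lift:
  assumes "singular_simplex n BG \<tau>"
  shows "lift n \<tau> \<in> sing n" "simplex_map n (milnor_orbit G) (lift n \<tau>) = \<tau>"
    "singular_simplex n (subtopology BG BP) \<tau> \<Longrightarrow> lift n \<tau> \<in> sing_coset n"
  using someI_ex[OF lift_simplex[OF assms, unfolded Bex_def], folded lift_def] by blast+

lemma proj_surj:
  assumes "singular_chain n BG c"
  obtains b where "b \<in> fchains (sing n)" "proj n b = c"
proof
  have c: "c \<in> fchains (singular_simplex_set n BG)" using assms by (simp add: singular_chain_def)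
  show "map_chain (lift n) c \<in> fchains (sing n)" by (rule map_chain_in[OF c]) (simp add: lift(1))
  have "proj n (map_chain (lift n) c) = map_chain id c"
    by (rule fchains_eq[OF c]) (auto simp: proj_diff lift(2), simp add: proj_def lift(2))
  also have "\<dots> = c" using frag_expansion[of c] by (simp add: map_chain_def)
  finally show "proj n (map_chain (lift n) c) = c" .
qed

text \<open>Up to translations c equals the chosen lift of its projection, and that lift lies in the
  pieces because \<open>lift\<close> sends simplices of B P there.\<close>

lemma proj_kernel:
  assumes c: "c \<in> fchains (sing n)" and p: "singular_chain n (subtopology BG BP) (proj n c)"
  shows "c \<in> trivial_chains n"
proof -
  have "c - map_chain (lift n) (proj n c) \<in> trivial_chains n"
    using c
  proof (induction c rule: fchains_induct)
    case zero
    show ?case by (simp add: proj_def trivial_chains_0)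
  next
    case (one s)
    let ?t = "simplex_map n (milnor_orbit G) s"
    have t: "singular_simplex n BG ?t"
      using one singular_simplex_simplex_map[OF _ continuous_milnor_orbit] by (auto simp: sing_def)
    obtain h where h: "h \<in> carrier G" "lift n ?t = sact n h s"
      using singular_simplices_same_image[OF is_group, of n s "lift n ?t"] lift[OF t] one
      unfolding sing_def sact_def by auto
    have "map_chain (sact n h) (frag_of s) - frag_of s \<in> trivial_chains n"
      by (rule act_diff_trivial_chains[OF _ h(1)]) (use one in simp)
    then have "0 - (map_chain (sact n h) (frag_of s) - frag_of s) \<in> trivial_chains n"
      using trivial_chains_0 trivial_chains_diff by blast
    then show ?case using h by (simp add: proj_def)
  next
    case (diff a b)
    have "a - b - map_chain (lift n) (proj n (a - b)) =
      (a - map_chain (lift n) (proj n a)) - (b - map_chain (lift n) (proj n b))"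
      by (simp add: proj_diff)
    then show ?case using trivial_chains_diff[OF diff] by (simp only:)
  qed
  moreover have "map_chain (lift n) (proj n c) \<in> trivial_chains n"
  proof (rule sing_coset_trivial, rule map_chain_in)
    show "proj n c \<in> fchains (singular_simplex_set n (subtopology BG BP))" using p by (simp add: singular_chain_def)
    fix t assume "t \<in> singular_simplex_set n (subtopology BG BP)"
    then show "lift n t \<in> sing_coset n" using lift(3)[of n t] by (simp add: singular_simplex_subtopology)
  qed
  ultimately have "(c - map_chain (lift n) (proj n c)) + map_chain (lift n) (proj n c) \<in> trivial_chains n"
    by (rule trivial_chains_add)
  then show ?thesis by simp
qed

end

section \<open>The comparison on coinvariants\<close>

context comparison
begin

text \<open>Reindexed by the true degree, with value 0 in degree 0, where there are no
  tuples.\<close>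

definition "Phi n c = (if n = 0 then 0 else \<phi> (n - 1) c)"
definition "Psi n c = (if n = 0 then 0 else \<psi> (n - 1) c)"

lemma Phi_diff: "Phi n (a - b) = Phi n a - Phi n b" by (simp add: Phi_def \<phi>_diff)
lemma Psi_diff: "Psi n (a - b) = Psi n a - Psi n b" by (simp add: Psi_def \<psi>_diff)

lemma Psi_add: "Psi n (a + b) = Psi n a + Psi n b"
proof -
  have "Psi n (a - (0 - b)) = Psi n a - (Psi n 0 - Psi n b)" by (simp only: Psi_diff)
  moreover have "Psi n 0 = 0" using Psi_diff[of n 0 0] by simp
  ultimately show ?thesis by simp
qed

lemma Phi_in: "c \<in> fchains (sing n) \<Longrightarrow> Phi n c \<in> fchains (tuples n)"
  using \<phi>_in[of c "n - 1"] by (cases n) (auto simp: Phi_def tuples_def)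

lemma Psi_in: "c \<in> fchains (tuples n) \<Longrightarrow> Psi n c \<in> fchains (sing n)"
  using \<psi>_in[of c "n - 1"] by (cases n) (auto simp: Psi_def tuples_def)

lemma Phi_trivial: "c \<in> trivial_chains n \<Longrightarrow> Phi n c \<in> tuple_act_chains n"
proof (rule trivial_chains_map[OF Phi_diff act_chains_0 act_chains_diff])
  fix s assume "s \<in> sing_coset n"
  then have "Phi n (frag_of s) = 0" using \<phi>_coset[of "frag_of s" "n - 1"] by (cases n) (auto simp: Phi_def)
  then show "Phi n (frag_of s) \<in> tuple_act_chains n" by (simp add: act_chains_0)
next
  fix g s assume g: "g \<in> carrier G" and s: "s \<in> sing n"
  have "Phi n (frag_of (sact n g s)) = map_chain (tact g) (Phi n (frag_of s))"
    using \<phi>_act[of "frag_of s" "n - 1" g] g s by (cases n) (auto simp: Phi_def)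
  then show "Phi n (frag_of (sact n g s)) - Phi n (frag_of s) \<in> tuple_act_chains n"
    using gset.act_diff[OF gset_tuples Phi_in g, of "frag_of s" n] s by simp
qed

lemma Psi_act_chains: "c \<in> tuple_act_chains n \<Longrightarrow> Psi n c \<in> trivial_chains n"
proof (rule act_chains_map[OF Psi_diff trivial_chains_0 trivial_chains_diff])
  fix g xs assume g: "g \<in> carrier G" and xs: "xs \<in> tuples n"
  have "Psi n (frag_of (tact g xs)) = map_chain (sact n g) (Psi n (frag_of xs))"
    using \<psi>_act[of "frag_of xs" "n - 1" g] g xs by (cases n) (auto simp: Psi_def tuples_def)
  then show "Psi n (frag_of (tact g xs)) - Psi n (frag_of xs) \<in> trivial_chains n"
    using act_diff_trivial_chains[OF Psi_in g, of "frag_of xs" n] xs by simp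
qed

lemma Phi_boundary:
  "c \<in> fchains (sing (Suc n)) \<Longrightarrow> tuples_bd (Suc n) (Phi (Suc n) c) = Phi n (chain_boundary (Suc n) c)"
  using \<phi>_bd[of c "n - 1"] by (cases n) (auto simp: tuples_bd_def Phi_def)

lemma Psi_boundary:
  "c \<in> fchains (tuples (Suc n)) \<Longrightarrow>
     chain_boundary (Suc n) (Psi (Suc n) c) - Psi n (tuples_bd (Suc n) c) \<in> trivial_chains n"
  using \<psi>_bd[of c "n - 1"] \<psi>_bd_0[of c]
  by (cases n) (auto simp: tuples_bd_def Psi_def tuples_def intro!: sing_coset_trivial)

text \<open>The boundary of c is trivial in the coinvariants, and the equivariant homotopy takes it
  to something that is again trivial. What remains of the homotopy equation is the claim.\<close>

lemma Phi_Psi: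
  assumes c: "c \<in> tuple_cycles n"
  obtains w where "w \<in> fchains (tuples (Suc n))" "Phi n (Psi n c) - c - tuples_bd (Suc n) w \<in> tuple_act_chains n"
proof (cases n)
  case 0
  then have "c = 0" using c by (simp add: tuple_cycles_def tuples_def)
  then show ?thesis using that[of 0] 0 by (simp add: Phi_def tuples_bd_def act_chains_0)
next
  case (Suc m)
  obtain h where h_diff: "\<And>n c c'. h n (c - c') = h n c - h n c'"
    and h: "\<And>n c. c \<in> fchains (tup (Suc n)) \<Longrightarrow> h n c \<in> fchains (tup (Suc (Suc n)))"
    "\<And>n c g. c \<in> fchains (tup (Suc n)) \<Longrightarrow> g \<in> carrier G \<Longrightarrow>
        h n (map_chain (tact g) c) = map_chain (tact g) (h n c)"
    "\<And>n c. c \<in> fchains (tup (Suc (Suc n))) \<Longrightarrow> bd (h (Suc n) c) = \<phi> (Suc n) (\<psi> (Suc n) c) - c - h n (bd c)"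
    "\<And>c. c \<in> fchains (tup (Suc 0)) \<Longrightarrow> bd (h 0 c) = \<phi> 0 (\<psi> 0 c) - c"
    using tup_homotopy by blast
  have c': "c \<in> fchains (tup (Suc m))" using c by (simp add: tuple_cycles_def tuples_def Suc)
  show ?thesis
  proof
    show "h m c \<in> fchains (tuples (Suc n))" using h(1)[OF c'] by (simp add: tuples_def Suc)
    show "Phi n (Psi n c) - c - tuples_bd (Suc n) (h m c) \<in> tuple_act_chains n"
    proof (cases m)
      case 0
      then show ?thesis using h(4)[of c] c' by (simp add: Suc Phi_def Psi_def tuples_bd_def act_chains_0)
    next
      case (Suc k)
      have bc: "bd c \<in> tuple_act_chains (Suc k)"
        using c by (simp add: tuple_cycles_def \<open>n = Suc m\<close> Suc tuples_bd_def)
      have "h k (bd c) \<in> tuple_act_chains (Suc (Suc k))"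
      proof (rule act_chains_map[OF h_diff act_chains_0 act_chains_diff _ bc])
        fix g xs assume g: "g \<in> carrier G" and "xs \<in> tuples (Suc k)"
        then have x: "frag_of xs \<in> fchains (tup (Suc k))" by (simp add: tuples_def)
        show "h k (frag_of (tact g xs)) - h k (frag_of xs) \<in> tuple_act_chains (Suc (Suc k))"
          using gset.act_diff[OF gset_tuples _ g, of "h k (frag_of xs)" "Suc (Suc k)"] h(1)[OF x] h(2)[OF x g]
          by (simp add: tuples_def)
      qed
      then show ?thesis using h(3)[of c k] c' by (simp add: Suc \<open>n = Suc m\<close> Phi_def Psi_def tuples_bd_def)
    qed
  qed
qed

text \<open>The homotopy is equivariant and kills the pieces, so it preserves trivial chains. In
  degree 0 \<open>Psi\<close> is 0, and the claim is that the homotopy pushes c into the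
  pieces.\<close>

lemma Psi_Phi:
  assumes c: "c \<in> fchains (sing n)" and cyc: "n \<ge> 1 \<Longrightarrow> chain_boundary n c \<in> trivial_chains (n - 1)"
  obtains w where "w \<in> fchains (sing (Suc n))" "Psi n (Phi n c) - c - chain_boundary (Suc n) w \<in> trivial_chains n"
proof -
  obtain h where h_diff: "\<And>n c c'. h n (c - c') = h n c - h n c'"
    and h: "\<And>n c. c \<in> fchains (sing n) \<Longrightarrow> h n c \<in> fchains (sing (Suc n))"
    "\<And>n c. c \<in> fchains (sing_coset n) \<Longrightarrow> h n c = 0"
    "\<And>n c g. c \<in> fchains (sing n) \<Longrightarrow> g \<in> carrier G \<Longrightarrow>
        h n (map_chain (sact n g) c) = map_chain (sact (Suc n) g) (h n c)"
    "\<And>n c. c \<in> fchains (sing (Suc n)) \<Longrightarrow> chain_boundary (Suc (Suc n)) (h (Suc n) c) -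
          (\<psi> n (\<phi> n c) - c - h n (chain_boundary (Suc n) c)) \<in> fchains (sing_coset (Suc n))"
    "\<And>c. c \<in> fchains (sing 0) \<Longrightarrow> chain_boundary (Suc 0) (h 0 c) + c \<in> fchains (sing_coset 0)"
    using sing_homotopy by blast
  have h_trivial: "h m b \<in> trivial_chains (Suc m)" if "b \<in> trivial_chains m" for m b
  proof (rule trivial_chains_map[OF h_diff trivial_chains_0 trivial_chains_diff _ _ that])
    fix s assume "s \<in> sing_coset m"
    then have "h m (frag_of s) = 0" by (intro h(2)) simp
    then show "h m (frag_of s) \<in> trivial_chains (Suc m)" by (simp only: trivial_chains_0)
  next
    fix g s assume g: "g \<in> carrier G" and s: "s \<in> sing m"
    have s': "frag_of s \<in> fchains (sing m)" using s by simp
    show "h m (frag_of (sact m g s)) - h m (frag_of s) \<in> trivial_chains (Suc m)"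
      using act_diff_trivial_chains[OF h(1)[OF s'] g] h(3)[OF s' g] by simp
  qed
  show ?thesis
  proof
    show "h n c \<in> fchains (sing (Suc n))" by (rule h(1)[OF c])
    show "Psi n (Phi n c) - c - chain_boundary (Suc n) (h n c) \<in> trivial_chains n"
    proof (cases n)
      case 0
      have "0 - (chain_boundary (Suc 0) (h 0 c) + c) \<in> trivial_chains 0"
        using trivial_chains_diff[OF trivial_chains_0 sing_coset_trivial[OF h(5)]] c 0 by blast
      then show ?thesis by (simp add: 0 Psi_def algebra_simps)
    next
      case (Suc m)
      let ?d = "chain_boundary (Suc (Suc m)) (h (Suc m) c) -
          (\<psi> m (\<phi> m c) - c - h m (chain_boundary (Suc m) c))"
      have "?d \<in> trivial_chains (Suc m)"
        by (rule sing_coset_trivial[OF h(4)]) (use c Suc in simp)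
      moreover have "h m (chain_boundary (Suc m) c) \<in> trivial_chains (Suc m)"
        using h_trivial cyc Suc by simp
      ultimately have "h m (chain_boundary (Suc m) c) - ?d \<in> trivial_chains (Suc m)"
        by (rule trivial_chains_diff[rotated])
      then show ?thesis by (simp add: Suc Psi_def Phi_def algebra_simps)
    qed
  qed
qed

text \<open>The isomorphism is induced by \<open>Psi\<close> followed by projection.
  \<open>Phi_Psi\<close> shows that no more cycles than the boundaries are sent to boundaries, and
  \<open>Psi_Phi\<close> gives surjectivity up to boundaries.\<close>

theorem tuple_homology_iso_relative_group_homology:
  "tuple_homology n \<cong> relative_group_homology n G P"
  unfolding tuple_homology_def relative_group_homology_def nontrivial_relative_homology_group
proof (rule quotient_iso(1)[where f = "\<lambda>c. proj n (Psi n c)"])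
  show "group (tuple_cycle_group n)" by (rule tuple_cycle_group)
  show "singular_relboundary_set n BG BP \<lhd> relcycle_group n BG BP"
    by (rule normal_subgroup_singular_relboundary_relcycle)
  have in_trivial: "chain_boundary n (Psi n c) \<in> trivial_chains (n - 1)" if c: "c \<in> tuple_cycles n" "n \<ge> 1" for c
  proof -
    obtain m where m: "n = Suc m" using c(2) by (cases n) auto
    have c': "c \<in> fchains (tuples (Suc m))" "tuples_bd (Suc m) c \<in> tuple_act_chains m"
      using c by (auto simp: tuple_cycles_def m)
    show ?thesis
      using trivial_chains_add[OF Psi_boundary[OF c'(1)] Psi_act_chains[OF c'(2)]] by (simp add: m)
  qed
  have cyc_iff: "singular_relcycle n BG BP (proj n z) \<longleftrightarrow> (n \<ge> 1 \<longrightarrow> chain_boundary n z \<in> trivial_chains (n - 1))"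
    if z: "z \<in> fchains (sing n)" for z
  proof (cases n)
    case 0
    then show ?thesis using proj_in[OF z] by (simp add: singular_relcycle chain_boundary_def)
  next
    case (Suc m)
    then show ?thesis
      using proj_in[OF z] proj_boundary[of z m] z proj_trivial[of "chain_boundary n z" m]
        proj_kernel[OF boundary_sing, of z m]
      by (auto simp: singular_relcycle)
  qed
  show "(\<lambda>c. proj n (Psi n c)) \<in> hom (tuple_cycle_group n) (relcycle_group n BG BP)"
  proof (rule homI)
    fix c assume "c \<in> carrier (tuple_cycle_group n)"
    then have "c \<in> tuple_cycles n" by (simp add: tuple_cycle_group)
    then show "proj n (Psi n c) \<in> carrier (relcycle_group n BG BP)"
      using in_trivial cyc_iff[OF Psi_in] by (simp add: tuple_cycles_def)
  qed (simp add: tuple_cycle_group Psi_add proj_add)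
  show "tuple_boundaries n = {c \<in> carrier (tuple_cycle_group n). proj n (Psi n c) \<in> singular_relboundary_set n BG BP}"
  proof (intro equalityI subsetI)
    fix c assume "c \<in> tuple_boundaries n"
    then obtain w m where w: "w \<in> fchains (tuples (Suc n))" and m: "m \<in> tuple_act_chains n"
      and c: "c = tuples_bd (Suc n) w + m" by (auto simp: tuple_boundaries_def)
    have "c \<in> fchains (tuples n)"
      unfolding c by (rule fchains_add[OF tuples_bd_in[OF w] gset.act_chains_in[OF gset_tuples m]])
    moreover have "tuples_bd n c \<in> tuple_act_chains (n - 1)" if "n \<ge> 1"
    proof -
      have "tuples_bd n m \<in> tuple_act_chains (n - 1)" using tuples_bd_act_chains[of m "n - 1"] m that by simp
      then show ?thesis by (simp add: c tuples_bd_add tuples_bd_tuples_bd)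
    qed
    ultimately have cyc: "c \<in> tuple_cycles n" by (simp add: tuple_cycles_def)
    let ?y = "Psi n m - (chain_boundary (Suc n) (Psi (Suc n) w) - Psi n (tuples_bd (Suc n) w))"
    have "?y \<in> trivial_chains n" by (rule trivial_chains_diff[OF Psi_act_chains[OF m] Psi_boundary[OF w]])
    then have "singular_chain n (subtopology BG BP) (proj n ?y)" by (rule proj_trivial)
    moreover have "Psi n c = chain_boundary (Suc n) (Psi (Suc n) w) + ?y" by (simp add: c Psi_add)
    then have "proj n (Psi n c) = chain_boundary (Suc n) (proj (Suc n) (Psi (Suc n) w)) + proj n ?y"
      by (simp only: proj_add proj_boundary[OF Psi_in[OF w]])
    ultimately have "singular_relboundary n BG BP (proj n (Psi n c))"
      unfolding singular_relboundary using proj_in[OF Psi_in[OF w]] by metis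
    then show "c \<in> {c \<in> carrier (tuple_cycle_group n). proj n (Psi n c) \<in> singular_relboundary_set n BG BP}"
      using cyc by (simp add: tuple_cycle_group)
  next
    fix c assume "c \<in> {c \<in> carrier (tuple_cycle_group n). proj n (Psi n c) \<in> singular_relboundary_set n BG BP}"
    then have c: "c \<in> tuple_cycles n" and "singular_relboundary n BG BP (proj n (Psi n c))"
      by (auto simp: tuple_cycle_group)
    then obtain d e where d: "singular_chain (Suc n) BG d" and e: "singular_chain n (subtopology BG BP) e"
      and de: "chain_boundary (Suc n) d + e = proj n (Psi n c)" by (auto simp: singular_relboundary)
    obtain d' where d': "d' \<in> fchains (sing (Suc n))" "proj (Suc n) d' = d" using proj_surj[OF d] .
    have c': "c \<in> fchains (tuples n)" using c by (simp add: tuple_cycles_def)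
    have "proj n (Psi n c - chain_boundary (Suc n) d') = e"
      unfolding proj_diff proj_boundary[OF d'(1), symmetric] d'(2) de[symmetric] by simp
    then have "Psi n c - chain_boundary (Suc n) d' \<in> trivial_chains n"
      using e by (intro proj_kernel[OF fchains_diff[OF Psi_in[OF c'] boundary_sing[OF d'(1)]]]) simp
    then have p: "Phi n (Psi n c) - tuples_bd (Suc n) (Phi (Suc n) d') \<in> tuple_act_chains n"
      using Phi_trivial by (fastforce simp: Phi_diff Phi_boundary[OF d'(1)])
    obtain w where w: "w \<in> fchains (tuples (Suc n))" "Phi n (Psi n c) - c - tuples_bd (Suc n) w \<in> tuple_act_chains n"
      using Phi_Psi[OF c] .
    \<comment> \<open>Two expressions for \<open>Phi n (Psi n c)\<close> are compared: one as a
      boundary carried over from E G, one as c plus a boundary. Their difference writes c as the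
      boundary of \<open>Phi (Suc n) d' - w\<close> up to trivial tuples.\<close>
    have "(Phi n (Psi n c) - tuples_bd (Suc n) (Phi (Suc n) d')) - (Phi n (Psi n c) - c - tuples_bd (Suc n) w) \<in> tuple_act_chains n"
      (is "?m \<in> _") by (rule act_chains_diff[OF p w(2)])
    moreover have "c = tuples_bd (Suc n) (Phi (Suc n) d' - w) + ?m"
      by (simp add: tuples_bd_diff)
    moreover have "Phi (Suc n) d' - w \<in> fchains (tuples (Suc n))"
      by (rule fchains_diff[OF Phi_in[OF d'(1)] w(1)])
    ultimately show "c \<in> tuple_boundaries n" unfolding tuple_boundaries_def by blast
  qed
  show "\<exists>a\<in>carrier (tuple_cycle_group n). \<exists>m\<in>singular_relboundary_set n BG BP.
          b = m \<otimes>\<^bsub>relcycle_group n BG BP\<^esub> proj n (Psi n a)" if b: "b \<in> carrier (relcycle_group n BG BP)" for b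
  proof -
    have bc: "singular_relcycle n BG BP b" using b by simp
    then obtain z where z: "z \<in> fchains (sing n)" "proj n z = b" using proj_surj singular_relcycle by metis
    then have dz: "n \<ge> 1 \<longrightarrow> chain_boundary n z \<in> trivial_chains (n - 1)" using cyc_iff bc by blast
    have "tuples_bd n (Phi n z) \<in> tuple_act_chains (n - 1)" if "n \<ge> 1"
      using Phi_boundary[of z "n - 1"] Phi_trivial[of "chain_boundary n z" "n - 1"] dz z that by simp
    then have a: "Phi n z \<in> tuple_cycles n" using Phi_in[OF z(1)] by (simp add: tuple_cycles_def)
    obtain w where w: "w \<in> fchains (sing (Suc n))" "Psi n (Phi n z) - z - chain_boundary (Suc n) w \<in> trivial_chains n"
      using Psi_Phi[OF z(1)] dz by blast
    \<comment> \<open>The preimage sought is \<open>Phi n z\<close> for a lift z of b; the homotopy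
      equation says that its image differs from b by the boundary of the projection of w and a chain
      in B P.\<close>
    let ?y = "Psi n (Phi n z) - z - chain_boundary (Suc n) w"
    have "singular_relboundary n BG BP (chain_boundary (Suc n) (proj (Suc n) w) + proj n ?y)"
      unfolding singular_relboundary using proj_in[OF w(1)] proj_trivial[OF w(2)] by blast
    moreover have "chain_boundary (Suc n) (proj (Suc n) w) + proj n ?y = proj n (Psi n (Phi n z)) - b"
      using z by (simp add: proj_boundary[OF w(1)] proj_diff)
    ultimately have "singular_relboundary n BG BP (- (proj n (Psi n (Phi n z)) - b))"
      using singular_relboundary_minus by metis
    then show ?thesis
      using a by (intro bexI[of _ "Phi n z"] bexI[of _ "b - proj n (Psi n (Phi n z))"]) (auto simp: tuple_cycle_group)
  qed
qed

end

theorem (in general_position) tuple_homology_iso: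
  "tuple_homology n \<cong> relative_group_homology n G P"
proof -
  obtain \<phi> where \<phi>: "\<And>n c c'. \<phi> n (c - c') = \<phi> n c - \<phi> n c'"
    "\<And>n c. c \<in> fchains (sing (Suc n)) \<Longrightarrow> \<phi> n c \<in> fchains (tup (Suc n))"
    "\<And>n c. c \<in> fchains (sing_coset (Suc n)) \<Longrightarrow> \<phi> n c = 0"
    "\<And>n c g. c \<in> fchains (sing (Suc n)) \<Longrightarrow> g \<in> carrier G \<Longrightarrow>
        \<phi> n (map_chain (sact (Suc n) g) c) = map_chain (tact g) (\<phi> n c)"
    "\<And>n c. c \<in> fchains (sing (Suc (Suc n))) \<Longrightarrow>
        bd (\<phi> (Suc n) c) = \<phi> n (chain_boundary (Suc (Suc n)) c)"
    "\<And>c. c \<in> fchains (sing (Suc 0)) \<Longrightarrow> bd (\<phi> 0 c) = base_chain (chain_boundary (Suc 0) c)"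
    using sing_to_tup by blast
  show ?thesis
  proof (rule tup_to_sing, goal_cases)
    case (1 \<psi>)
    show ?case
      by (rule comparison.tuple_homology_iso_relative_group_homology[where \<phi> = \<phi> and \<psi> = \<psi>], unfold_locales)
         (fact \<phi> 1)+
  qed
qed

section \<open>Tensor products with the trivial module\<close>

text \<open>The hypotheses say that \<Theta> identifies C with the coinvariants of the tuple
  complex. Cycles and boundaries of C can then be pulled back to chains of tuples, where
  \<open>quotient_iso\<close> compares them.\<close>

lemma (in general_position) chain_homology_iso_tuple_homology:
  assumes C: "\<And>n. comm_group (C n)"
    and \<Theta>: "\<And>n. \<Theta> n \<in> hom (free_Abelian_group (tuples n)) (C n)"
    and surj: "\<And>n. carrier (C n) = \<Theta> n ` fchains (tuples n)"
    and ker: "\<And>n c. c \<in> fchains (tuples n) \<Longrightarrow> \<Theta> n c = \<one>\<^bsub>C n\<^esub> \<longleftrightarrow> c \<in> tuple_act_chains n"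
    and bd: "\<And>n c. c \<in> fchains (tuples (Suc n)) \<Longrightarrow> d (Suc n) (\<Theta> (Suc n) c) = \<Theta> n (tuples_bd (Suc n) c)"
  shows "chain_homology C d n \<cong> tuple_homology n"
proof -
  have add: "\<Theta> n (a + b) = \<Theta> n a \<otimes>\<^bsub>C n\<^esub> \<Theta> n b" if "a \<in> fchains (tuples n)" "b \<in> fchains (tuples n)" for n a b
    using hom_mult[OF \<Theta>[of n], of a b] that by simp
  have in_C: "\<Theta> n a \<in> carrier (C n)" if "a \<in> fchains (tuples n)" for n a
    using surj that by blast
  have eq_iff: "\<Theta> n a = \<Theta> n b \<longleftrightarrow> a - b \<in> tuple_act_chains n"
    if ab: "a \<in> fchains (tuples n)" "b \<in> fchains (tuples n)" for n a b
  proof -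
    interpret C: comm_group "C n" by (rule C)
    have "\<Theta> n (a - b) \<otimes>\<^bsub>C n\<^esub> \<Theta> n b = \<Theta> n a"
      using add[OF fchains_diff[OF ab] ab(2)] by simp
    then have "\<Theta> n a = \<Theta> n b \<longleftrightarrow> \<Theta> n (a - b) = \<one>\<^bsub>C n\<^esub>"
      using in_C[OF fchains_diff[OF ab]] in_C[OF ab(2)] C.l_one C.r_cancel_one by metis
    then show ?thesis using ker[OF fchains_diff[OF ab]] by simp
  qed
  have d_hom: "d (Suc m) \<in> hom (C (Suc m)) (C m)" for m
  proof (rule homI)
    fix X assume "X \<in> carrier (C (Suc m))"
    then obtain x where "X = \<Theta> (Suc m) x" "x \<in> fchains (tuples (Suc m))" using surj by blast
    then show "d (Suc m) X \<in> carrier (C m)" using bd in_C[OF tuples_bd_in] by metis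
  next
    fix X Y assume "X \<in> carrier (C (Suc m))" "Y \<in> carrier (C (Suc m))"
    then obtain x y where X: "X = \<Theta> (Suc m) x" "x \<in> fchains (tuples (Suc m))"
      and Y: "Y = \<Theta> (Suc m) y" "y \<in> fchains (tuples (Suc m))" using surj by blast
    have "d (Suc m) (X \<otimes>\<^bsub>C (Suc m)\<^esub> Y) = d (Suc m) (\<Theta> (Suc m) (x + y))"
      using add X Y by simp
    also have "\<dots> = \<Theta> m (tuples_bd (Suc m) x + tuples_bd (Suc m) y)"
      using bd[OF fchains_add[OF X(2) Y(2)]] by (simp only: tuples_bd_add)
    also have "\<dots> = d (Suc m) X \<otimes>\<^bsub>C m\<^esub> d (Suc m) Y"
      using add[OF tuples_bd_in[OF X(2)] tuples_bd_in[OF Y(2)]] bd X Y by simp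
    finally show "d (Suc m) (X \<otimes>\<^bsub>C (Suc m)\<^esub> Y) = d (Suc m) X \<otimes>\<^bsub>C m\<^esub> d (Suc m) Y" .
  qed
  let ?K = "if n = 0 then carrier (C 0) else kernel (C n) (C (n - 1)) (d n)"
  let ?B = "subgroup_generated (C n) ?K"
  let ?N = "d (Suc n) ` carrier (C (Suc n))"
  interpret C: comm_group "C n" by (rule C)
  interpret C': comm_group "C (Suc n)" by (rule C)
  have \<Theta>_gh: "group_hom (free_Abelian_group (tuples n)) (C n) (\<Theta> n)"
    by (intro group_hom.intro group_hom_axioms.intro \<Theta> C.is_group) simp
  have K: "?K = \<Theta> n ` tuple_cycles n"
  proof (cases n)
    case 0
    then show ?thesis using surj[of 0] by (auto simp: tuple_cycles_def)
  next
    case (Suc m)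
    have "d (Suc m) (\<Theta> (Suc m) c) = \<one>\<^bsub>C m\<^esub> \<longleftrightarrow> tuples_bd (Suc m) c \<in> tuple_act_chains m"
      if "c \<in> fchains (tuples (Suc m))" for c
      using bd[OF that] ker[OF tuples_bd_in[OF that]] by simp
    then show ?thesis using surj[of "Suc m"] by (auto simp: Suc kernel_def tuple_cycles_def)
  qed
  have K_sub: "subgroup ?K (C n)"
    unfolding K by (rule group_hom.subgroup_img_is_subgroup[OF \<Theta>_gh subgroup_tuple_cycles])
  have carrier_B: "carrier ?B = \<Theta> n ` tuple_cycles n"
    using subgroup.carrier_subgroup_generated_subgroup[OF K_sub] K by simp
  have N_eq: "?N = (\<lambda>w. \<Theta> n (tuples_bd (Suc n) w)) ` fchains (tuples (Suc n))"
    unfolding surj[of "Suc n"] image_image using bd by (intro image_cong) auto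
  have "tuples_bd (Suc n) w \<in> tuple_cycles n" if "w \<in> fchains (tuples (Suc n))" for w
    using tuples_bd_in[OF that] by (simp add: tuple_cycles_def tuples_bd_tuples_bd act_chains_0)
  then have N_K: "?N \<subseteq> carrier ?B" unfolding N_eq carrier_B by blast
  have "subgroup ?N (C n)"
    by (rule group_hom.img_is_subgroup, intro group_hom.intro group_hom_axioms.intro d_hom C.is_group C'.is_group)
  then have N_sub: "subgroup ?N ?B" using C.subgroup_subgroup_generated_iff N_K by blast
  have B: "comm_group ?B" by (rule C.abelian_subgroup_generated[OF C])
  have cyc: "a \<in> fchains (tuples n)" if "a \<in> tuple_cycles n" for a using that by (simp add: tuple_cycles_def)
  have "?B Mod ?N \<cong> tuple_cycle_group n Mod tuple_boundaries n"
  proof (rule quotient_iso(2)[OF tuple_cycle_group(1)])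
    show "?N \<lhd> ?B" by (rule comm_group.subgroup_imp_normal[OF B N_sub])
    show "\<Theta> n \<in> hom (tuple_cycle_group n) ?B"
    proof (rule homI)
      show "\<Theta> n a \<in> carrier ?B" if "a \<in> carrier (tuple_cycle_group n)" for a
        using that unfolding carrier_B tuple_cycle_group(2) by blast
      show "\<Theta> n (a \<otimes>\<^bsub>tuple_cycle_group n\<^esub> b) = \<Theta> n a \<otimes>\<^bsub>?B\<^esub> \<Theta> n b"
        if "a \<in> carrier (tuple_cycle_group n)" "b \<in> carrier (tuple_cycle_group n)" for a b
        using add[OF cyc cyc] that unfolding tuple_cycle_group(2) by (simp add: tuple_cycle_group(3))
    qed
    show "tuple_boundaries n = {a \<in> carrier (tuple_cycle_group n). \<Theta> n a \<in> ?N}"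
    proof (intro equalityI subsetI)
      fix c assume "c \<in> tuple_boundaries n"
      then obtain w m where w: "w \<in> fchains (tuples (Suc n))" and m: "m \<in> tuple_act_chains n"
        and c: "c = tuples_bd (Suc n) w + m" by (auto simp: tuple_boundaries_def)
      have m': "m \<in> tuple_cycles n"
        using gset.act_chains_in[OF gset_tuples m] tuples_bd_act_chains[of m "n - 1"] m
        by (cases n) (auto simp: tuple_cycles_def)
      have w': "tuples_bd (Suc n) w \<in> tuple_cycles n"
        using tuples_bd_in[OF w] by (simp add: tuple_cycles_def tuples_bd_tuples_bd act_chains_0)
      have cc: "c \<in> tuple_cycles n"
        using subgroup.m_closed[OF subgroup_tuple_cycles w' m'] by (simp add: c)
      have "\<Theta> n c = \<Theta> n (tuples_bd (Suc n) w)"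
        using eq_iff[OF cyc[OF cc] cyc[OF w']] m by (simp add: c)
      then show "c \<in> {a \<in> carrier (tuple_cycle_group n). \<Theta> n a \<in> ?N}"
        unfolding N_eq tuple_cycle_group(2) using cc w by blast
    next
      fix c assume "c \<in> {a \<in> carrier (tuple_cycle_group n). \<Theta> n a \<in> ?N}"
      then obtain w where c: "c \<in> tuple_cycles n" and w: "w \<in> fchains (tuples (Suc n))" "\<Theta> n c = \<Theta> n (tuples_bd (Suc n) w)"
        unfolding N_eq tuple_cycle_group(2) by blast
      then have "c - tuples_bd (Suc n) w \<in> tuple_act_chains n"
        using eq_iff[OF cyc[OF c] tuples_bd_in[OF w(1)]] by simp
      moreover have "c = tuples_bd (Suc n) w + (c - tuples_bd (Suc n) w)" by simp
      ultimately show "c \<in> tuple_boundaries n" unfolding tuple_boundaries_def using w(1) by blast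
    qed
    fix b assume "b \<in> carrier ?B"
    then obtain a where a: "a \<in> tuple_cycles n" "b = \<Theta> n a" unfolding carrier_B by blast
    have "\<one>\<^bsub>?B\<^esub> \<in> ?N" using subgroup.one_closed[OF N_sub] .
    moreover have "b = \<one>\<^bsub>?B\<^esub> \<otimes>\<^bsub>?B\<^esub> \<Theta> n a" using in_C[OF cyc[OF a(1)]] a by simp
    ultimately show "\<exists>a\<in>carrier (tuple_cycle_group n). \<exists>m\<in>?N. b = m \<otimes>\<^bsub>?B\<^esub> \<Theta> n a"
      unfolding tuple_cycle_group(2) using a(1) by blast
  qed
  then show ?thesis by (simp only: tuple_homology_def chain_homology_def)
qed

lemma fchains_additive_induct [consumes 1, case_names zero one diff]:
  assumes "c \<in> fchains S" "P 0" "\<And>x. x \<in> S \<Longrightarrow> P (frag_of x)"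
    "\<And>a b. a \<in> fchains S \<Longrightarrow> b \<in> fchains S \<Longrightarrow> P a \<Longrightarrow> P b \<Longrightarrow> P (a - b)"
  shows "P c"
proof -
  have "c \<in> fchains S \<and> P c"
    using assms(1)
  proof (induction c rule: fchains_induct)
    case (diff a b)
    then show ?case using assms(4) fchains_diff by blast
  qed (use assms in auto)
  then show ?thesis ..
qed

lemma generate_free_Abelian_group:
  assumes "S \<subseteq> carrier (free_Abelian_group T)"
  shows "generate (free_Abelian_group T) S = frag_span S"
proof (intro equalityI subsetI)
  fix x assume "x \<in> generate (free_Abelian_group T) S"
  then show "x \<in> frag_span S"
  proof (induction rule: generate.induct)
    case (inv h)
    then have "h \<in> carrier (free_Abelian_group T)" using assms by blast
    then have "inv\<^bsub>free_Abelian_group T\<^esub> h = - h" by simp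
    then show ?case using inv by (simp add: frag_span_minus frag_span_base)
  qed (simp_all add: frag_span_0 frag_span_base frag_span_add)
next
  interpret F: group "free_Abelian_group T" by simp
  fix x assume "x \<in> frag_span S"
  then show "x \<in> generate (free_Abelian_group T) S"
  proof (induction rule: frag_span.induct)
    case frag_span_0
    then show ?case using generate.one[of "free_Abelian_group T" S] by simp
  next
    case (frag_span_diff a b)
    then have b: "b \<in> carrier (free_Abelian_group T)" using F.generate_in_carrier[OF assms] by blast
    have "inv\<^bsub>free_Abelian_group T\<^esub> b \<in> generate (free_Abelian_group T) S"
      using F.generate_m_inv_closed[OF assms] frag_span_diff by blast
    then show ?case using generate.eng[OF frag_span_diff(3)] b by fastforce
  qed (rule generate.incl)
qed

section \<open>Tensoring with the trivial module yields coinvariants\<close>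

locale tensor_free = gset G S a for G :: "('g, 'm) monoid_scheme" (structure) and S :: "'s set" and a
begin

abbreviation "act \<equiv> \<lambda>g. map_chain (a g)"

abbreviation "mod_act \<equiv> act_chains G S a"

abbreviation "R \<equiv> tensor_relations G act (free_Abelian_group S)"

abbreviation "F \<equiv> free_Abelian_group (fchains S \<times> (UNIV :: int set))"

lemma carrier_S: "carrier (free_Abelian_group S) = fchains S"
  by auto

lemma relatorE:
  assumes "b \<in> tensor_relators G act (free_Abelian_group S)"
  obtains (add) x y k where "b = frag_of (x + y, k) - frag_of (x, k) - frag_of (y, k)" "x \<in> fchains S" "y \<in> fchains S"
    | (scalar) x k l where "b = frag_of (x, k + l) - frag_of (x, k) - frag_of (x, l)" "x \<in> fchains S"
    | (act) g x k where "b = frag_of (act (inv g) x, k) - frag_of (x, k)" "g \<in> carrier G" "x \<in> fchains S"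
  using assms unfolding tensor_relators_def Un_iff
  by (elim disjE CollectE exE conjE; simp only: mult_free_Abelian_group carrier_S)

lemma relators_in: "tensor_relators G act (free_Abelian_group S) \<subseteq> fchains (fchains S \<times> UNIV)"
proof
  fix b assume "b \<in> tensor_relators G act (free_Abelian_group S)"
  then show "b \<in> fchains (fchains S \<times> UNIV)"
  proof (cases rule: relatorE)
    case (add x y k)
    then show ?thesis using fchains_add[OF add(2,3)] unfolding add(1) by (intro fchains_diff) auto
  next
    case (scalar x k l)
    then show ?thesis unfolding scalar(1) by (intro fchains_diff) auto
  next
    case (act g x k)
    then show ?thesis using map_chain_act_in[of "inv g" x] unfolding act(1) by (intro fchains_diff) auto
  qed
qed

lemma R_eq: "R = frag_span (tensor_relators G act (free_Abelian_group S))"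
  unfolding tensor_relations_def carrier_S
  by (rule generate_free_Abelian_group) (use relators_in in auto)

lemma R_add_rel: "x \<in> fchains S \<Longrightarrow> y \<in> fchains S \<Longrightarrow> frag_of (x + y, k) - frag_of (x, k) - frag_of (y, k) \<in> R"
  unfolding R_eq by (rule frag_span_base) (unfold tensor_relators_def carrier_S mult_free_Abelian_group, blast)

lemma R_scalar_rel: "x \<in> fchains S \<Longrightarrow> frag_of (x, k + l) - frag_of (x, k) - frag_of (x, l) \<in> R"
  unfolding R_eq by (rule frag_span_base) (unfold tensor_relators_def carrier_S mult_free_Abelian_group, blast)

lemma R_act_rel: "x \<in> fchains S \<Longrightarrow> g \<in> carrier G \<Longrightarrow> frag_of (act g x, k) - frag_of (x, k) \<in> R"
proof -
  assume x: "x \<in> fchains S" and g: "g \<in> carrier G"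
  have "frag_of (act (inv (inv g)) x, k) - frag_of (x, k) \<in> R"
    unfolding R_eq
    by (rule frag_span_base) (use x g in \<open>unfold tensor_relators_def carrier_S, blast\<close>)
  then show ?thesis using g by simp
qed

lemma R_diff: "u \<in> R \<Longrightarrow> v \<in> R \<Longrightarrow> u - v \<in> R"
  unfolding R_eq by (rule frag_span_diff)

lemma R_add: "u \<in> R \<Longrightarrow> v \<in> R \<Longrightarrow> u + v \<in> R"
  unfolding R_eq by (rule frag_span_add)

lemma R_0: "0 \<in> R"
  unfolding R_eq by (rule frag_span_0)

lemma R_minus: "u \<in> R \<Longrightarrow> - u \<in> R"
  unfolding R_eq by (rule frag_span_minus)

lemma R_in: "R \<subseteq> fchains (fchains S \<times> UNIV)"
  unfolding R_eq using frag_span_keys[of "tensor_relators G act (free_Abelian_group S)"] relators_in by blast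

lemma R_normal: "R \<lhd> F"
proof -
  interpret F: comm_group F by (rule abelian_free_Abelian_group)
  have "subgroup R F"
  proof (rule F.subgroupI)
    show "R \<subseteq> carrier F" using R_in by auto
    show "R \<noteq> {}" using R_0 by blast
    show "inv\<^bsub>F\<^esub> u \<in> R" if "u \<in> R" for u using that R_in R_minus by (subst inv_free_Abelian_group) auto
  qed (simp add: R_add)
  then show ?thesis by (rule F.subgroup_imp_normal)
qed

lemma R_diff_rel:
  "x \<in> fchains S \<Longrightarrow> y \<in> fchains S \<Longrightarrow> frag_of (x - y, k) - (frag_of (x, k) - frag_of (y, k)) \<in> R"
  using R_minus[OF R_add_rel[OF fchains_diff, of x y y k]] by (simp add: algebra_simps)

lemma R_zero_rel: "frag_of (0, k) \<in> R"
  using R_minus[OF R_add_rel[of 0 0 k]] by simp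

lemma R_scalar_zero_rel: "x \<in> fchains S \<Longrightarrow> frag_of (x, 0) \<in> R"
  using R_minus[OF R_scalar_rel[of x 0 0]] by simp

text \<open>By biadditivity both symbols change by x \<otimes> 1 when k changes by 1, and both
  vanish for k = 0; hence an induction in both directions.\<close>

lemma R_cmul_rel:
  assumes x: "x \<in> fchains S"
  shows "frag_of (x, k) - frag_of (frag_cmul k x, 1) \<in> R"
proof (induction k rule: int_induct[of _ 0])
  case base
  show ?case using R_diff[OF R_scalar_zero_rel[OF x] R_zero_rel[of 1]] by simp
next
  case (step1 i)
  have "(frag_of (x, i + 1) - frag_of (x, i) - frag_of (x, 1)) + (frag_of (x, i) - frag_of (frag_cmul i x, 1))
      - (frag_of (frag_cmul i x + x, 1) - frag_of (frag_cmul i x, 1) - frag_of (x, 1)) \<in> R"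
    by (intro R_diff[OF R_add] step1 R_scalar_rel[OF x] R_add_rel[OF fchains_cmul[OF x] x])
  then show ?case by (simp add: frag_cmul_distrib algebra_simps)
next
  case (step2 i)
  have "(frag_of (x, i) - frag_of (frag_cmul i x, 1)) - (frag_of (x, i - 1 + 1) - frag_of (x, i - 1) - frag_of (x, 1))
      - (frag_of (frag_cmul i x - x, 1) - (frag_of (frag_cmul i x, 1) - frag_of (x, 1))) \<in> R"
    by (intro R_diff[OF R_diff] step2 R_scalar_rel[OF x] R_diff_rel[OF fchains_cmul[OF x] x])
  then show ?case by (simp add: frag_cmul_diff_distrib algebra_simps)
qed

text \<open>The evaluation x \<otimes> k \<mapsto> k x, which induces the inverse of x \<mapsto> x
  \<otimes> 1 on coinvariants.\<close>

definition "ev = frag_extend (\<lambda>(x :: 's \<Rightarrow>\<^sub>0 int, k). frag_cmul k x)"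

lemma ev_diff: "ev (u - v) = ev u - ev v"
  by (simp add: ev_def frag_extend_diff)

lemma ev_of: "ev (frag_of (x, k)) = frag_cmul k x"
  by (simp add: ev_def)

lemma ev_in: "z \<in> fchains (fchains S \<times> UNIV) \<Longrightarrow> ev z \<in> fchains S"
  unfolding ev_def by (rule fchains_extend) (auto intro!: fchains_cmul)

lemma ev_rel:
  assumes "z \<in> fchains (fchains S \<times> UNIV)"
  shows "z - frag_of (ev z, 1) \<in> R"
  using assms
proof (induction z rule: fchains_additive_induct)
  case zero
  then show ?case using R_minus[OF R_zero_rel[of 1]] by (simp add: ev_def)
next
  case (one p)
  then show ?case using R_cmul_rel by (cases p) (auto simp: ev_of)
next
  case (diff u v)
  have "(u - frag_of (ev u, 1)) - (v - frag_of (ev v, 1)) - (frag_of (ev u - ev v, 1) - (frag_of (ev u, 1) - frag_of (ev v, 1))) \<in> R"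
    by (intro R_diff diff(3,4) R_diff_rel ev_in diff(1,2))
  then show ?case by (simp add: ev_diff algebra_simps)
qed

lemma ev_R: "z \<in> R \<Longrightarrow> ev z \<in> mod_act"
  unfolding R_eq
proof (rule frag_span_image[of ev, OF ev_diff act_chains_0 act_chains_diff], assumption+)
  fix b assume "b \<in> tensor_relators G act (free_Abelian_group S)"
  then show "ev b \<in> mod_act"
  proof (cases rule: relatorE)
    case (add x y k)
    then show ?thesis by (simp add: ev_diff ev_of frag_cmul_distrib2 act_chains_0)
  next
    case (scalar x k l)
    then show ?thesis by (simp add: ev_diff ev_of frag_cmul_distrib act_chains_0)
  next
    case (act g x k)
    then show ?thesis
      using act_diff[OF fchains_cmul[OF act(3), of k], of "inv g"]
      by (simp add: ev_diff ev_of map_chain_cmul)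
  qed
qed

text \<open>\<open>ev\<close> takes relations into \<open>mod_act\<close>, which makes x \<mapsto> x
  \<otimes> 1 injective on coinvariants; the converse is a computation on the generators g s -
  s.\<close>

lemma frag_of_R_iff: "x \<in> fchains S \<Longrightarrow> frag_of (x, 1) \<in> R \<longleftrightarrow> x \<in> mod_act"
proof
  assume "frag_of (x, 1) \<in> R"
  then show "x \<in> mod_act" using ev_R by (fastforce simp: ev_of)
next
  assume "x \<in> mod_act"
  then show "frag_of (x, 1) \<in> R"
    unfolding act_chains_def
  proof (induction rule: frag_span.induct)
    case frag_span_0
    then show ?case by (rule R_zero_rel)
  next
    case (frag_span_base b)
    then obtain g s where b: "b = frag_of (a g s) - frag_of s" "g \<in> carrier G" "s \<in> S" by blast
    then have s: "frag_of s \<in> fchains S" "frag_of (a g s) \<in> fchains S" using act_in by auto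
    have "(frag_of (frag_of (a g s) - frag_of s, 1) - (frag_of (frag_of (a g s), 1) - frag_of (frag_of s, 1)))
       + (frag_of (act g (frag_of s), 1) - frag_of (frag_of s, 1)) \<in> R"
      by (rule R_add[OF R_diff_rel[OF s(2,1)] R_act_rel[OF s(1) b(2)]])
    then show ?case by (simp add: b)
  next
    case (frag_span_diff u v)
    have u: "u \<in> fchains S" "v \<in> fchains S"
      using act_chains_in frag_span_diff(1,2) unfolding act_chains_def by blast+
    have "(frag_of (u - v, 1) - (frag_of (u, 1) - frag_of (v, 1))) + (frag_of (u, 1) - frag_of (v, 1)) \<in> R"
      by (intro R_add R_diff_rel u R_diff frag_span_diff)
    then show ?case by simp
  qed
qed

definition "unit_tensor x = R #>\<^bsub>F\<^esub> frag_of (x, 1)"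

lemma tensor_trivial_eq: "tensor_trivial G act (free_Abelian_group S) = F Mod R"
  by (simp add: tensor_trivial_def carrier_S)

lemma comm_group_tensor: "comm_group (tensor_trivial G act (free_Abelian_group S))"
  unfolding tensor_trivial_eq
  by (rule comm_group.abelian_FactGroup[OF abelian_free_Abelian_group normal_imp_subgroup[OF R_normal]])

lemma coset_eq_iff:
  assumes "u \<in> fchains (fchains S \<times> UNIV)" "v \<in> fchains (fchains S \<times> UNIV)"
  shows "R #>\<^bsub>F\<^esub> u = R #>\<^bsub>F\<^esub> v \<longleftrightarrow> u - v \<in> R"
proof
  assume e: "R #>\<^bsub>F\<^esub> u = R #>\<^bsub>F\<^esub> v"
  have "u \<in> R #>\<^bsub>F\<^esub> u" using R_0 by (force simp: r_coset_def)
  then obtain r where "r \<in> R" "u = r + v" unfolding e by (auto simp: r_coset_def)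
  then show "u - v \<in> R" by simp
next
  assume uv: "u - v \<in> R"
  show "R #>\<^bsub>F\<^esub> u = R #>\<^bsub>F\<^esub> v"
  proof (intro equalityI subsetI)
    fix z assume "z \<in> R #>\<^bsub>F\<^esub> u"
    then obtain r where "r \<in> R" "z = r + u" by (auto simp: r_coset_def)
    then have "r + (u - v) \<in> R" "z = (r + (u - v)) + v" using R_add uv by auto
    then show "z \<in> R #>\<^bsub>F\<^esub> v" unfolding r_coset_def by (auto intro!: bexI[of _ "r + (u - v)"])
  next
    fix z assume "z \<in> R #>\<^bsub>F\<^esub> v"
    then obtain r where "r \<in> R" "z = r + v" by (auto simp: r_coset_def)
    then have "r - (u - v) \<in> R" "z = (r - (u - v)) + u" using R_diff uv by auto
    then show "z \<in> R #>\<^bsub>F\<^esub> u" unfolding r_coset_def by (auto intro!: bexI[of _ "r - (u - v)"])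
  qed
qed

lemma unit_tensor_hom: "unit_tensor \<in> hom (free_Abelian_group S) (tensor_trivial G act (free_Abelian_group S))"
proof (rule homI)
  interpret N: normal R F by (rule R_normal)
  have c: "frag_of (x, 1) \<in> carrier F" if "x \<in> fchains S" for x using that by simp
  fix x assume "x \<in> carrier (free_Abelian_group S)"
  then show "unit_tensor x \<in> carrier (tensor_trivial G act (free_Abelian_group S))"
    using c[of x] by (auto simp: tensor_trivial_eq unit_tensor_def FactGroup_def RCOSETS_def)
  fix y assume "x \<in> carrier (free_Abelian_group S)" "y \<in> carrier (free_Abelian_group S)"
  then have xy: "x \<in> fchains S" "y \<in> fchains S" by auto
  have "unit_tensor x <#>\<^bsub>F\<^esub> unit_tensor y = R #>\<^bsub>F\<^esub> (frag_of (x, 1) + frag_of (y, 1))"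
    unfolding unit_tensor_def using N.rcos_sum[OF c[OF xy(1)] c[OF xy(2)]] by simp
  also have "\<dots> = unit_tensor (x + y)"
  proof -
    have "(frag_of (x, 1) + frag_of (y, 1)) - frag_of (x + y, 1) \<in> R"
      using R_minus[OF R_add_rel[OF xy, of 1]] by (simp add: algebra_simps)
    moreover have "frag_of (x, 1) + frag_of (y, 1) \<in> fchains (fchains S \<times> (UNIV :: int set))"
      by (rule fchains_add) (use xy in auto)
    moreover have "frag_of (x + y, 1) \<in> fchains (fchains S \<times> (UNIV :: int set))"
      using fchains_add[OF xy] by simp
    ultimately show ?thesis unfolding unit_tensor_def by (subst coset_eq_iff)
  qed
  finally show "unit_tensor (x \<otimes>\<^bsub>free_Abelian_group S\<^esub> y) =
      unit_tensor x \<otimes>\<^bsub>tensor_trivial G act (free_Abelian_group S)\<^esub> unit_tensor y"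
    by (simp add: tensor_trivial_eq FactGroup_def)
qed

lemma unit_tensor_surj: "carrier (tensor_trivial G act (free_Abelian_group S)) = unit_tensor ` fchains S"
proof (intro equalityI subsetI)
  fix X assume "X \<in> carrier (tensor_trivial G act (free_Abelian_group S))"
  then obtain z where z: "z \<in> fchains (fchains S \<times> UNIV)" "X = R #>\<^bsub>F\<^esub> z"
    by (auto simp: tensor_trivial_eq FactGroup_def RCOSETS_def)
  have "X = unit_tensor (ev z)"
    unfolding z(2) unit_tensor_def using ev_in[OF z(1)] by (subst coset_eq_iff) (use z ev_rel in auto)
  then show "X \<in> unit_tensor ` fchains S" using ev_in[OF z(1)] by blast
next
  fix X assume "X \<in> unit_tensor ` fchains S"
  then show "X \<in> carrier (tensor_trivial G act (free_Abelian_group S))"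
    using unit_tensor_hom by (auto simp: hom_def)
qed

lemma unit_tensor_kernel:
  assumes "x \<in> fchains S"
  shows "unit_tensor x = \<one>\<^bsub>tensor_trivial G act (free_Abelian_group S)\<^esub> \<longleftrightarrow> x \<in> mod_act"
proof -
  have "\<one>\<^bsub>tensor_trivial G act (free_Abelian_group S)\<^esub> = R #>\<^bsub>F\<^esub> 0"
    by (auto simp: tensor_trivial_eq FactGroup_def r_coset_def)
  then show ?thesis
    unfolding unit_tensor_def using assms frag_of_R_iff[OF assms] by (simp add: coset_eq_iff)
qed

end

text \<open>The induced map takes relators to relations, so all representatives of a class yield one
  and the same coset, and the union in \<open>tensor_map\<close> collapses to it.\<close>

lemma tensor_map_unit_tensor:
  assumes "tensor_free G S a" "tensor_free G T b"
    and f: "\<And>x y. f (x + y) = f x + f y" "\<And>x. x \<in> fchains S \<Longrightarrow> f x \<in> fchains T"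
      "\<And>g x. g \<in> carrier G \<Longrightarrow> x \<in> fchains S \<Longrightarrow> f (map_chain (a g) x) = map_chain (b g) (f x)"
    and x: "x \<in> fchains S"
  shows "tensor_map G (\<lambda>g. map_chain (b g)) (free_Abelian_group T) f (tensor_free.unit_tensor G S a x) =
         tensor_free.unit_tensor G T b (f x)"
proof -
  interpret S: tensor_free G S a by fact
  interpret T: tensor_free G T b by fact
  let ?f = "frag_extend (\<lambda>(x, k :: int). frag_of (f x, k))"
  have fR: "?f r \<in> T.R" if "r \<in> S.R" for r
  proof (rule frag_span_image[where f = ?f and D = T.R, OF frag_extend_diff T.R_0 T.R_diff _ that[unfolded S.R_eq]])
    fix u assume "u \<in> tensor_relators G S.act (free_Abelian_group S)"
    then show "?f u \<in> T.R"
    proof (cases rule: S.relatorE)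
      case (add x y k)
      then show ?thesis using T.R_add_rel[OF f(2)[OF add(2)] f(2)[OF add(3)], of k] by (simp add: frag_extend_diff f(1))
    next
      case (scalar x k l)
      then show ?thesis using T.R_scalar_rel[OF f(2)[OF scalar(2)], of k l] by (simp add: frag_extend_diff)
    next
      case (act g x k)
      then show ?thesis using T.R_act_rel[OF f(2)[OF act(3)], of "inv\<^bsub>G\<^esub> g" k] f(3) by (simp add: frag_extend_diff)
    qed
  qed
  have fx: "frag_of (f x, 1) \<in> fchains (fchains T \<times> UNIV)" using f(2)[OF x] by simp
  have "T.R #>\<^bsub>T.F\<^esub> ?f z = T.unit_tensor (f x)" if z: "z \<in> S.unit_tensor x" for z
  proof -
    obtain r where r: "r \<in> S.R" "z = r + frag_of (x, 1)" using z by (auto simp: S.unit_tensor_def r_coset_def)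
    then have "?f z = ?f r + frag_of (f x, 1)" by (simp add: frag_extend_add)
    moreover have "?f r + frag_of (f x, 1) \<in> fchains (fchains T \<times> UNIV)"
      using fR[OF r(1)] T.R_in fx by (intro fchains_add) auto
    ultimately show ?thesis
      unfolding T.unit_tensor_def using fx fR[OF r(1)] by (subst T.coset_eq_iff) auto
  qed
  moreover have "frag_of (x, 1) \<in> S.unit_tensor x"
    using S.R_0 by (force simp: S.unit_tensor_def r_coset_def)
  ultimately show ?thesis
    unfolding tensor_map_def T.carrier_S by blast
qed

section \<open>Labelings as tuples of cosets\<close>

text \<open>Links the recursive boundary, suited to cones, with the alternating sum over discarded
  positions by which labelings are treated.\<close>

lemma tuple_boundary_sum:
  "tuple_boundary xs = (\<Sum>k<length xs. frag_cmul ((-1) ^ k) (frag_of (take k xs @ drop (Suc k) xs)))"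
proof (induction xs)
  case (Cons x xs)
  have "map_chain (Cons x) (\<Sum>k<m. f k) = (\<Sum>k<m. map_chain (Cons x) (f k))" for m :: nat and f
    by (induction m) auto
  then have "map_chain (Cons x) (tuple_boundary xs) =
      (\<Sum>k<length xs. frag_cmul ((-1) ^ k) (frag_of (take (Suc k) (x # xs) @ drop (Suc (Suc k)) (x # xs))))"
    by (simp add: Cons map_chain_cmul)
  moreover have "frag_cmul ((-1) ^ Suc k) c = - frag_cmul ((-1) ^ k) c" for k and c :: "'a list \<Rightarrow>\<^sub>0 int" by simp
  ultimately show ?case
    by (simp only: length_Cons sum.lessThan_Suc_shift tuple_boundary.simps sum_negf) simp
qed simp

text \<open>The group-theoretic facts behind labelings, with P for the unipotent and D for the
  counter diagonal elements. \<open>D_unique\<close> lets cosets determine labels,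
  \<open>D_apart\<close> makes the labels near one vertex distinct, and \<open>D_avoid\<close>
  produces a coset in general position to finitely many given ones.\<close>

locale coset_labels = group G for G :: "('g, 'm) monoid_scheme" (structure) +
  fixes P D :: "'g set"
  assumes P_subgroup: "subgroup P G" and D_subset: "D \<subseteq> carrier G"
    and D_inv: "k \<in> D \<Longrightarrow> inv k \<in> D"
    and D_unique: "k \<in> D \<Longrightarrow> k' \<in> D \<Longrightarrow> p \<in> P \<Longrightarrow> p' \<in> P \<Longrightarrow> k \<otimes> p' = p \<otimes> k' \<Longrightarrow> p = \<one>"
    and D_apart: "k \<in> D \<Longrightarrow> k' \<in> D \<Longrightarrow> k'' \<in> D \<Longrightarrow> p \<in> P \<Longrightarrow> p' \<in> P \<Longrightarrow> k' \<noteq> k \<otimes> (p \<otimes> (k'' \<otimes> p'))"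
    and D_avoid: "finite F \<Longrightarrow> F \<subseteq> carrier G \<Longrightarrow>
      \<exists>h\<in>carrier G. \<forall>g\<in>F. \<exists>p\<in>P. \<exists>p'\<in>P. \<exists>k\<in>D. g \<otimes> p' = h \<otimes> (p \<otimes> k)"
begin

definition "opposite \<alpha> \<beta> \<longleftrightarrow> (\<exists>x\<in>\<alpha>. \<exists>y\<in>\<beta>. inv x \<otimes> y \<in> D)"

sublocale coset_tuples G P opposite
  by (intro coset_tuples.intro coset_tuples_axioms.intro is_group P_subgroup)

lemma P_carrier: "p \<in> P \<Longrightarrow> p \<in> carrier G" using subgroup.subset[OF P] by blast

lemma D_carrier: "k \<in> D \<Longrightarrow> k \<in> carrier G" using D_subset by blast

lemma coset_elt: "\<alpha> \<in> cosets \<Longrightarrow> x \<in> \<alpha> \<Longrightarrow> x \<in> carrier G" using coset_subset by blast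

lemma coset_diffE:
  assumes "\<alpha> \<in> cosets" "x \<in> \<alpha>" "x' \<in> \<alpha>"
  obtains p where "p \<in> P" "x' = x \<otimes> p"
  using assms coset_eq[of \<alpha> x] unfolding l_coset_def by auto

text \<open>Writing x' = x p and y' = y p', the two elements k, k' of D satisfy k p' = p k', which
  forces p = 1.\<close>

lemma opposite_unique:
  assumes c: "\<alpha> \<in> cosets" "\<beta> \<in> cosets" and x: "x \<in> \<alpha>" "x' \<in> \<alpha>" and y: "y \<in> \<beta>" "y' \<in> \<beta>"
    and D: "inv x \<otimes> y \<in> D" "inv x' \<otimes> y' \<in> D"
  shows "x = x'"
proof -
  obtain p where p: "p \<in> P" "x' = x \<otimes> p" using coset_diffE[OF c(1) x] .
  obtain p' where p': "p' \<in> P" "y' = y \<otimes> p'" using coset_diffE[OF c(2) y] .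
  note car = coset_elt[OF c(1) x(1)] coset_elt[OF c(2) y(1)] P_carrier[OF p(1)] P_carrier[OF p'(1)]
  have "p \<otimes> (inv x' \<otimes> y') = (inv x \<otimes> y) \<otimes> p'"
    using car by (simp add: p(2) p'(2) inv_mult_group m_assoc inv_solve_left)
       (simp add: m_assoc[symmetric])
  then have "p = \<one>" using D_unique[OF D p(1) p'(1)] by simp
  then show ?thesis using p car by simp
qed

lemma opposite_sym:
  assumes "\<alpha> \<in> cosets" "\<beta> \<in> cosets" "x \<in> \<alpha>" "y \<in> \<beta>" "inv x \<otimes> y \<in> D"
  shows "inv y \<otimes> x \<in> D"
proof -
  have "inv (inv x \<otimes> y) = inv y \<otimes> x" using assms coset_elt by (simp add: inv_mult_group)
  then show ?thesis using D_inv[OF assms(5)] by simp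
qed

lemma translate_inv: "g \<in> carrier G \<Longrightarrow> x \<in> carrier G \<Longrightarrow> y \<in> carrier G \<Longrightarrow> inv (g \<otimes> x) \<otimes> (g \<otimes> y) = inv x \<otimes> y"
  by (simp add: inv_mult_group m_assoc) (simp add: m_assoc[symmetric])

sublocale general_position G P opposite
proof
  fix g \<alpha> \<beta> assume g: "g \<in> carrier G" and c: "\<alpha> \<in> cosets" "\<beta> \<in> cosets" and o: "opposite \<alpha> \<beta>"
  obtain x y where xy: "x \<in> \<alpha>" "y \<in> \<beta>" "inv x \<otimes> y \<in> D" using o by (auto simp: opposite_def)
  have gxy: "g \<otimes> x \<in> g <# \<alpha>" "g \<otimes> y \<in> g <# \<beta>" "inv (g \<otimes> x) \<otimes> (g \<otimes> y) \<in> D"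
    using xy g coset_elt c by (auto simp: l_coset_def translate_inv)
  then show "opposite (g <# \<alpha>) (g <# \<beta>)" unfolding opposite_def by blast
  assume "g <# \<alpha> = \<alpha>" "g <# \<beta> = \<beta>"
  \<comment> \<open>If g fixes both cosets, it takes one distinguished pair of representatives to
    another one, and there is only one.\<close>
  then have "x = g \<otimes> x" using opposite_unique[OF c xy(1) _ xy(2) _ xy(3) gxy(3)] gxy by simp
  then show "g = \<one>" using g coset_elt[OF c(1) xy(1)] by (metis r_cancel_one)
next
  fix F assume F: "finite F" "F \<subseteq> cosets"
  then obtain r where r: "\<And>\<alpha>. \<alpha> \<in> F \<Longrightarrow> r \<alpha> \<in> carrier G \<and> \<alpha> = r \<alpha> <# P"
    unfolding cosets_def by (metis (no_types, lifting) image_iff subsetD)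
  have "finite (r ` F)" "r ` F \<subseteq> carrier G" using F r by auto
  then obtain h where h: "h \<in> carrier G" "\<And>g. g \<in> r ` F \<Longrightarrow> \<exists>p\<in>P. \<exists>p'\<in>P. \<exists>k\<in>D. g \<otimes> p' = h \<otimes> (p \<otimes> k)"
    using D_avoid by metis
  have "opposite (h <# P) \<alpha>" if a: "\<alpha> \<in> F" for \<alpha>
  proof -
    obtain p p' k where p: "p \<in> P" "p' \<in> P" "k \<in> D" "r \<alpha> \<otimes> p' = h \<otimes> (p \<otimes> k)" using h(2) a by blast
    have "inv (h \<otimes> p) \<otimes> (r \<alpha> \<otimes> p') = k"
      unfolding p(4) using h p P_carrier D_carrier
      by (simp add: m_assoc[symmetric] l_inv inv_solve_left)
         (simp add: inv_mult_group m_assoc)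
    moreover have "h \<otimes> p \<in> h <# P" "r \<alpha> \<otimes> p' \<in> r \<alpha> <# P"
      using p(1,2) by (auto simp: l_coset_def)
    ultimately show ?thesis using r[OF a] p(3) unfolding opposite_def by metis
  qed
  then show "\<exists>\<beta>\<in>cosets. \<forall>\<alpha>\<in>F. opposite \<beta> \<alpha>" using h(1) unfolding cosets_def by blast
qed

definition "label \<alpha> \<beta> = (THE x. x \<in> \<alpha> \<and> (\<exists>y\<in>\<beta>. inv x \<otimes> y \<in> D))"

lemma label_eq:
  assumes "\<alpha> \<in> cosets" "\<beta> \<in> cosets" "x \<in> \<alpha>" "y \<in> \<beta>" "inv x \<otimes> y \<in> D"
  shows "label \<alpha> \<beta> = x"
  unfolding label_def by (rule the_equality) (use assms opposite_unique in blast)+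

lemma label:
  assumes c: "\<alpha> \<in> cosets" "\<beta> \<in> cosets" "opposite \<alpha> \<beta>"
  shows "label \<alpha> \<beta> \<in> \<alpha>" "label \<beta> \<alpha> \<in> \<beta>" "inv (label \<alpha> \<beta>) \<otimes> label \<beta> \<alpha> \<in> D"
proof -
  obtain x y where xy: "x \<in> \<alpha>" "y \<in> \<beta>" "inv x \<otimes> y \<in> D" using c(3) by (auto simp: opposite_def)
  have "label \<alpha> \<beta> = x" "label \<beta> \<alpha> = y"
    using label_eq[OF c(1,2) xy] label_eq[OF c(2,1) xy(2,1) opposite_sym[OF c(1,2) xy]] by auto
  then show "label \<alpha> \<beta> \<in> \<alpha>" "label \<beta> \<alpha> \<in> \<beta>" "inv (label \<alpha> \<beta>) \<otimes> label \<beta> \<alpha> \<in> D" using xy by auto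
qed

lemma label_translate:
  assumes "\<alpha> \<in> cosets" "\<beta> \<in> cosets" "opposite \<alpha> \<beta>" "g \<in> carrier G"
  shows "label (g <# \<alpha>) (g <# \<beta>) = g \<otimes> label \<alpha> \<beta>"
proof (rule label_eq)
  note l = label[OF assms(1-3)]
  show "g \<otimes> label \<alpha> \<beta> \<in> g <# \<alpha>" "g \<otimes> label \<beta> \<alpha> \<in> g <# \<beta>" using l by (auto simp: l_coset_def)
  show "inv (g \<otimes> label \<alpha> \<beta>) \<otimes> (g \<otimes> label \<beta> \<alpha>) \<in> D"
    using l translate_inv[OF assms(4)] coset_elt assms by simp
qed (use translate_coset assms in auto)

text \<open>If the two labels were equal, going around the truncated triangle would close up: the
  long edges contribute elements of D, the two remaining short edges elements of P, and the result
  is k' = k p k'' p', which \<open>D_apart\<close> excludes.\<close>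

lemma label_distinct:
  assumes c: "\<alpha> \<in> cosets" "\<beta> \<in> cosets" "\<gamma> \<in> cosets"
    and o: "opposite \<alpha> \<beta>" "opposite \<alpha> \<gamma>" "opposite \<beta> \<gamma>"
  shows "label \<alpha> \<beta> \<noteq> label \<alpha> \<gamma>"
proof
  assume e: "label \<alpha> \<beta> = label \<alpha> \<gamma>"
  let ?x = "label \<alpha> \<beta>" let ?y = "label \<beta> \<alpha>" let ?z = "label \<gamma> \<alpha>"
  note l = label[OF c(1,2) o(1)] label[OF c(1,3) o(2)] label[OF c(2,3) o(3)]
  obtain p where p: "p \<in> P" "label \<beta> \<gamma> = ?y \<otimes> p" using coset_diffE[OF c(2) l(2,7)] .
  obtain p' where p': "p' \<in> P" "?z = label \<gamma> \<beta> \<otimes> p'" using coset_diffE[OF c(3) l(8,5)] .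
  define k where "k = inv ?x \<otimes> ?y"
  define k' where "k' = inv ?x \<otimes> ?z"
  define k'' where "k'' = inv (label \<beta> \<gamma>) \<otimes> label \<gamma> \<beta>"
  have k: "k \<in> D" "k' \<in> D" "k'' \<in> D" using l e by (auto simp: k_def k'_def k''_def)
  have car: "?x \<in> carrier G" "?y \<in> carrier G" "label \<gamma> \<beta> \<in> carrier G" "p \<in> carrier G" "p' \<in> carrier G" "label \<beta> \<gamma> \<in> carrier G"
    using l c coset_elt P_carrier p p' by auto
  have "k \<otimes> (p \<otimes> (k'' \<otimes> p')) = inv ?x \<otimes> (?y \<otimes> p) \<otimes> (inv (label \<beta> \<gamma>) \<otimes> (label \<gamma> \<beta> \<otimes> p'))"
    using car by (simp add: k_def k''_def m_assoc)
  also have "\<dots> = inv ?x \<otimes> (label \<beta> \<gamma> \<otimes> inv (label \<beta> \<gamma>)) \<otimes> ?z"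
    unfolding p(2)[symmetric] p'(2)[symmetric]
    using car coset_elt[OF c(3) l(5)] by (simp only: m_assoc inv_closed m_closed)
  also have "\<dots> = k'" using car by (simp add: k'_def)
  finally show False using D_apart[OF k p(1) p'(1)] by simp
qed

section \<open>Labelings correspond bijectively to tuples of cosets\<close>

definition "labellings n = {g \<in> truncated_vertices n \<rightarrow>\<^sub>E carrier G. n \<ge> 1 \<and>
     (\<forall>i\<le>n. \<forall>j\<le>n. \<forall>k\<le>n. j \<noteq> i \<and> k \<noteq> i \<and> j \<noteq> k \<longrightarrow>
        g (i, j) \<noteq> g (i, k) \<and> g (i, j) <# P = g (i, k) <# P) \<and>
     (\<forall>i\<le>n. \<forall>j\<le>n. i \<noteq> j \<longrightarrow> inv (g (i, j)) \<otimes> g (j, i) \<in> D)}"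

definition "labelling n xs = (\<lambda>(i, j)\<in>truncated_vertices n. label (xs ! i) (xs ! j))"

definition "label_act n h g = (\<lambda>v\<in>truncated_vertices n. h \<otimes> g v)"

lemma tuples_nth:
  assumes "xs \<in> tuples n"
  shows "n \<ge> 1" "length xs = Suc n" "i \<le> n \<Longrightarrow> xs ! i \<in> cosets"
    "i \<le> n \<Longrightarrow> j \<le> n \<Longrightarrow> i \<noteq> j \<Longrightarrow> opposite (xs ! i) (xs ! j)"
proof -
  have xs: "n \<ge> 1" "length xs = Suc n" "set xs \<subseteq> cosets" "sorted_wrt opposite xs"
    using assms by (auto simp: tuples_def tup_def split: if_splits)
  then show "n \<ge> 1" "length xs = Suc n" by auto
  show c: "xs ! i \<in> cosets" if "i \<le> n" for i using xs that nth_mem[of i xs] by auto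
  assume ij: "i \<le> n" "j \<le> n" "i \<noteq> j"
  show "opposite (xs ! i) (xs ! j)"
  proof (cases "i < j")
    case True
    then show ?thesis using xs ij by (auto simp: sorted_wrt_iff_nth_less)
  next
    case False
    then have "opposite (xs ! j) (xs ! i)" using xs ij by (auto simp: sorted_wrt_iff_nth_less)
    then show ?thesis using opposite_sym[OF c c] ij unfolding opposite_def by metis
  qed
qed

lemma labelling_apply: "(i, j) \<in> truncated_vertices n \<Longrightarrow> labelling n xs (i, j) = label (xs ! i) (xs ! j)"
  by (simp add: labelling_def)

lemma labelling_in: "xs \<in> tuples n \<Longrightarrow> labelling n xs \<in> labellings n"
proof -
  assume xs: "xs \<in> tuples n"
  note t = tuples_nth[OF xs]
  have l: "labelling n xs (i, j) = label (xs ! i) (xs ! j)" if "i \<le> n" "j \<le> n" "i \<noteq> j" for i j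
    using that by (simp add: labelling_apply truncated_vertices_def)
  have m: "label (xs ! i) (xs ! j) \<in> xs ! i" "inv (label (xs ! i) (xs ! j)) \<otimes> label (xs ! j) (xs ! i) \<in> D"
    if "i \<le> n" "j \<le> n" "i \<noteq> j" for i j
    using label[OF t(3)[OF that(1)] t(3)[OF that(2)] t(4)[OF that]] by auto
  have "labelling n xs \<in> truncated_vertices n \<rightarrow>\<^sub>E carrier G"
    using m(1) t(3) coset_elt by (fastforce simp: labelling_def truncated_vertices_def)
  moreover have "labelling n xs (i, j) \<noteq> labelling n xs (i, k) \<and> labelling n xs (i, j) <# P = labelling n xs (i, k) <# P"
    if "i \<le> n" "j \<le> n" "k \<le> n" "j \<noteq> i" "k \<noteq> i" "j \<noteq> k" for i j k
  proof -
    note ij = that(1,2) that(4)[symmetric] and ik = that(1,3) that(5)[symmetric]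
    have "label (xs ! i) (xs ! j) \<noteq> label (xs ! i) (xs ! k)"
      by (rule label_distinct[OF t(3)[OF that(1)] t(3)[OF that(2)] t(3)[OF that(3)] t(4)[OF ij] t(4)[OF ik] t(4)[OF that(2,3,6)]])
    moreover have "label (xs ! i) (xs ! j) <# P = label (xs ! i) (xs ! k) <# P"
      by (simp only: coset_eq[OF t(3)[OF that(1)] m(1)[OF ij]] coset_eq[OF t(3)[OF that(1)] m(1)[OF ik]])
    ultimately show ?thesis unfolding l[OF ij] l[OF ik] by (rule conjI)
  qed
  moreover have "inv (labelling n xs (i, j)) \<otimes> labelling n xs (j, i) \<in> D" if "i \<le> n" "j \<le> n" "i \<noteq> j" for i j
    using m(2)[OF that] unfolding l[OF that] l[OF that(2,1) that(3)[symmetric]] .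
  ultimately show ?thesis unfolding labellings_def mem_Collect_eq using t(1) by blast
qed

text \<open>The second index is merely some index other than i; it exists since n \<ge> 1, and any
  other choice gives the same coset in a labeling.\<close>

definition "vertex_coset g i = g (i, if i = 0 then 1 else 0 :: nat) <# P"

definition "unlabelling n g = map (vertex_coset g) [0..<Suc n]"

lemma unlabelling:
  assumes g: "g \<in> labellings n"
  shows "unlabelling n g \<in> tuples n" "labelling n (unlabelling n g) = g"
proof -
  have n: "n \<ge> 1" and gE: "g \<in> truncated_vertices n \<rightarrow>\<^sub>E carrier G"
    and g1': "\<And>i j k. i \<le> n \<Longrightarrow> j \<le> n \<Longrightarrow> k \<le> n \<Longrightarrow> j \<noteq> i \<Longrightarrow> k \<noteq> i \<Longrightarrow> j \<noteq> k \<Longrightarrow> g (i, j) <# P = g (i, k) <# P"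
    and g2: "\<And>i j. i \<le> n \<Longrightarrow> j \<le> n \<Longrightarrow> i \<noteq> j \<Longrightarrow> inv (g (i, j)) \<otimes> g (j, i) \<in> D"
    using g unfolding labellings_def by (blast, blast, blast, blast)
  have g1: "g (i, j) <# P = g (i, k) <# P" if "i \<le> n" "j \<le> n" "k \<le> n" "j \<noteq> i" "k \<noteq> i" for i j k
    using g1'[OF that] by (cases "j = k") auto
  have gc: "g (i, j) \<in> carrier G" if "i \<le> n" "j \<le> n" "i \<noteq> j" for i j
    using gE that by (auto simp: truncated_vertices_def PiE_iff)
  have u: "unlabelling n g ! i = g (i, j) <# P" if "i \<le> n" "j \<le> n" "i \<noteq> j" for i j
  proof -
    have "unlabelling n g ! i = vertex_coset g i" using that by (simp add: unlabelling_def del: upt_Suc)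
    also have "\<dots> = g (i, j) <# P" unfolding vertex_coset_def by (rule g1) (use that n in auto)
    finally show ?thesis .
  qed
  have mem: "g (i, j) \<in> unlabelling n g ! i" if "i \<le> n" "j \<le> n" "i \<noteq> j" for i j
    unfolding u[OF that] using subgroup.one_closed[OF P] gc[OF that] by (force simp: l_coset_def)
  have c: "unlabelling n g ! i \<in> cosets" if "i \<le> n" for i
    using u[OF that, of "if i = 0 then 1 else 0"] gc[OF that, of "if i = 0 then 1 else 0"] that n
    by (auto simp: cosets_def)
  have len: "length (unlabelling n g) = Suc n" by (simp add: unlabelling_def)
  have "set (unlabelling n g) \<subseteq> cosets" using c len by (auto simp: in_set_conv_nth less_Suc_eq_le)
  moreover have "opposite (unlabelling n g ! i) (unlabelling n g ! j)" if "i \<le> n" "j \<le> n" "i \<noteq> j" for i j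
    unfolding opposite_def using mem[OF that] mem[of j i] g2[OF that] that by blast
  ultimately show "unlabelling n g \<in> tuples n"
    using n len by (auto simp: tuples_def tup_def sorted_wrt_iff_nth_less)
  show "labelling n (unlabelling n g) = g"
  proof
    fix v :: "nat \<times> nat" obtain i j where v: "v = (i, j)" by (cases v)
    show "labelling n (unlabelling n g) v = g v"
    proof (cases "v \<in> truncated_vertices n")
      case True
      then have ij: "i \<le> n" "j \<le> n" "i \<noteq> j" "j \<noteq> i" by (auto simp: v truncated_vertices_def)
      have "label (unlabelling n g ! i) (unlabelling n g ! j) = g (i, j)"
        by (rule label_eq[OF c[OF ij(1)] c[OF ij(2)] mem[OF ij(1-3)] mem[OF ij(2,1,4)] g2[OF ij(1-3)]])
      then show ?thesis using True by (simp add: v labelling_apply)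
    next
      case False
      then show ?thesis using gE by (auto simp: labelling_def PiE_def extensional_def v)
    qed
  qed
qed

lemma unlabelling_labelling:
  assumes xs: "xs \<in> tuples n"
  shows "unlabelling n (labelling n xs) = xs"
proof (rule nth_equalityI)
  note t = tuples_nth[OF xs]
  show len: "length (unlabelling n (labelling n xs)) = length xs" by (simp add: unlabelling_def t)
  fix i assume "i < length (unlabelling n (labelling n xs))"
  then have i: "i \<le> n" by (simp add: unlabelling_def)
  let ?j = "if i = 0 then 1 else 0"
  have j: "?j \<le> n" "i \<noteq> ?j" using t(1) by auto
  have "labelling n xs (i, ?j) = label (xs ! i) (xs ! ?j)"
    using i j by (intro labelling_apply) (auto simp: truncated_vertices_def)
  then have "vertex_coset (labelling n xs) i = xs ! i"
    using coset_eq[OF t(3)[OF i] label(1)[OF t(3)[OF i] t(3)[OF j(1)] t(4)[OF i j]]] by (simp add: vertex_coset_def)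
  then show "unlabelling n (labelling n xs) ! i = xs ! i" using i by (simp add: unlabelling_def del: upt_Suc)
qed

lemma labelling_tact:
  assumes xs: "xs \<in> tuples n" and g: "g \<in> carrier G"
  shows "labelling n (tact g xs) = label_act n g (labelling n xs)"
proof
  note t = tuples_nth[OF xs]
  fix v :: "nat \<times> nat" obtain i j where v: "v = (i, j)" by (cases v)
  show "labelling n (tact g xs) v = label_act n g (labelling n xs) v"
  proof (cases "v \<in> truncated_vertices n")
    case True
    then have ij: "i \<le> n" "j \<le> n" "i \<noteq> j" by (auto simp: v truncated_vertices_def)
    then show ?thesis using True label_translate[OF t(3)[OF ij(1)] t(3)[OF ij(2)] t(4)[OF ij] g] t(2)
      by (simp add: v labelling_def label_act_def tact_def)
  qed (simp add: labelling_def label_act_def)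
qed

lemma labellings_image: "labellings n = labelling n ` tuples n"
proof (intro equalityI subsetI)
  fix g assume "g \<in> labellings n"
  then show "g \<in> labelling n ` tuples n"
    by (intro image_eqI[of _ _ "unlabelling n g"] unlabelling(1) unlabelling(2)[symmetric])
qed (use labelling_in in blast)

lemma fchains_labellings: "fchains (labellings n) = map_chain (labelling n) ` fchains (tuples n)"
proof (intro equalityI subsetI)
  fix c assume c: "c \<in> fchains (labellings n)"
  have "map_chain (labelling n) (map_chain (unlabelling n) c) = c"
    by (rule fchains_eq[OF c]) (auto simp: unlabelling(2))
  then show "c \<in> map_chain (labelling n) ` fchains (tuples n)"
    by (intro image_eqI[of _ _ "map_chain (unlabelling n) c"] map_chain_in[OF c unlabelling(1)]) simp
next
  fix c assume "c \<in> map_chain (labelling n) ` fchains (tuples n)"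
  then obtain b where b: "b \<in> fchains (tuples n)" "c = map_chain (labelling n) b" by (rule imageE)
  show "c \<in> fchains (labellings n)" unfolding b(2) by (rule map_chain_in[OF b(1) labelling_in])
qed

lemma map_chain_labelling_tact:
  assumes "c \<in> fchains (tuples n)" "g \<in> carrier G"
  shows "map_chain (labelling n) (map_chain (tact g) c) = map_chain (label_act n g) (map_chain (labelling n) c)"
  by (rule fchains_eq[OF assms(1)]) (auto simp: labelling_tact assms(2))

lemma gset_labellings: "gset G (labellings n) (label_act n)"
proof -
  interpret T: gset G "tuples n" tact by (rule gset_tuples)
  show ?thesis
  proof
    fix l assume "l \<in> labellings n"
    then obtain xs where xs: "xs \<in> tuples n" "l = labelling n xs" using labellings_image by blast
    show "label_act n \<one> l = l" using labelling_tact[OF xs(1) one_closed] T.act_one[OF xs(1)] xs by simp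
    fix g assume g: "g \<in> carrier G"
    show "label_act n g l \<in> labellings n"
      using labelling_tact[OF xs(1) g] labelling_in[OF T.act_in[OF g xs(1)]] xs by simp
    fix h assume h: "h \<in> carrier G"
    show "label_act n (g \<otimes> h) l = label_act n g (label_act n h l)"
      using labelling_tact[OF xs(1)] labelling_tact[OF T.act_in[OF h xs(1)] g] T.act_mult[OF g h xs(1)] xs g h
      by (metis m_closed)
  qed
qed

lemma labelling_act_chains:
  assumes c: "c \<in> fchains (tuples n)"
  shows "map_chain (labelling n) c \<in> act_chains G (labellings n) (label_act n) \<longleftrightarrow> c \<in> tuple_act_chains n"
    (is "_ \<in> ?N \<longleftrightarrow> _")
proof
  interpret T: gset G "tuples n" tact by (rule gset_tuples)
  assume m: "map_chain (labelling n) c \<in> ?N"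
  have "map_chain (unlabelling n) (map_chain (labelling n) c) \<in> tuple_act_chains n"
  proof (rule act_chains_map[OF map_chain_simps(3) act_chains_0 act_chains_diff _ m])
    fix g s assume g: "g \<in> carrier G" and "s \<in> labellings n"
    then obtain xs where xs: "xs \<in> tuples n" "s = labelling n xs" using labellings_image by blast
    show "map_chain (unlabelling n) (frag_of (label_act n g s)) - map_chain (unlabelling n) (frag_of s) \<in> tuple_act_chains n"
      using labelling_tact[OF xs(1) g] unlabelling_labelling[OF xs(1)]
        unlabelling_labelling[OF T.act_in[OF g xs(1)]] T.act_diff[OF _ g, of "frag_of xs"] xs by simp
  qed
  moreover have "map_chain (unlabelling n) (map_chain (labelling n) c) = c"
    by (rule fchains_eq[OF c]) (auto simp: unlabelling_labelling)
  ultimately show "c \<in> tuple_act_chains n" by simp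
next
  assume m: "c \<in> tuple_act_chains n"
  show "map_chain (labelling n) c \<in> ?N"
  proof (rule act_chains_map[OF map_chain_simps(3) act_chains_0 act_chains_diff _ m])
    fix g xs assume g: "g \<in> carrier G" and xs: "xs \<in> tuples n"
    show "map_chain (labelling n) (frag_of (tact g xs)) - map_chain (labelling n) (frag_of xs) \<in> ?N"
      using gset.act_diff[OF gset_labellings _ g, of "frag_of (labelling n xs)" n] labelling_in[OF xs]
      by (simp add: labelling_tact[OF xs g])
  qed
qed

lemma labelling_face:
  assumes xs: "xs \<in> tuples (Suc n)" and k: "k \<le> Suc n"
  shows "(\<lambda>(i, j)\<in>truncated_vertices n. labelling (Suc n) xs (skip k i, skip k j)) =
    labelling n (take k xs @ drop (Suc k) xs)"
proof
  note t = tuples_nth[OF xs]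
  have nth: "(take k xs @ drop (Suc k) xs) ! i = xs ! skip k i" if "i \<le> n" for i
    using that t(2) k by (auto simp: nth_append skip_def)
  fix v :: "nat \<times> nat" obtain i j where v: "v = (i, j)" by (cases v)
  show "(\<lambda>(i, j)\<in>truncated_vertices n. labelling (Suc n) xs (skip k i, skip k j)) v =
      labelling n (take k xs @ drop (Suc k) xs) v"
  proof (cases "v \<in> truncated_vertices n")
    case True
    then have ij: "i \<le> n" "j \<le> n" "i \<noteq> j" by (auto simp: v truncated_vertices_def)
    then have "(skip k i, skip k j) \<in> truncated_vertices (Suc n)" by (auto simp: truncated_vertices_def skip_def)
    then show ?thesis using True nth ij by (simp add: v labelling_def)
  qed (simp add: labelling_def)
qed

end

section \<open>Matrix computations in PSL(2, C)\<close>

definition mat2 :: "complex \<Rightarrow> complex \<Rightarrow> complex \<Rightarrow> complex \<Rightarrow> complex^2^2" where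
  "mat2 a b c d = vector [vector [a, b], vector [c, d]]"

lemma mat2_nth [simp]:
  "mat2 a b c d $ 1 $ 1 = a" "mat2 a b c d $ 1 $ 2 = b" "mat2 a b c d $ 2 $ 1 = c" "mat2 a b c d $ 2 $ 2 = d"
  by (simp_all add: mat2_def vector_2)

lemma mat2_mult: "mat2 a b c d ** mat2 a' b' c' d' =
    mat2 (a * a' + b * c') (a * b' + b * d') (c * a' + d * c') (c * b' + d * d')"
  by (simp add: vec_eq_iff forall_2 matrix_matrix_mult_def sum_2)

lemma det_mat2: "det (mat2 a b c d) = a * d - b * c"
  by (simp add: det_2)

lemma mat2_cases: obtains a b c d where "A = mat2 a b c d"
proof
  show "A = mat2 (A $ 1 $ 1) (A $ 1 $ 2) (A $ 2 $ 1) (A $ 2 $ 2)"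
    by (simp add: vec_eq_iff forall_2)
qed

lemma mat2_one: "mat 1 = mat2 1 0 0 1"
  by (simp add: vec_eq_iff forall_2 mat_def)

lemma mat2_eq_iff: "mat2 a b c d = mat2 a' b' c' d' \<longleftrightarrow> a = a' \<and> b = b' \<and> c = c' \<and> d = d'"
  by (metis mat2_nth)

lemma to_PSL2C_hom: "group_hom SL2C PSL2C to_PSL2C"
proof -
  interpret N: normal "{mat 1, - mat 1}" SL2C by (rule normal_center_SL2C)
  show ?thesis
    unfolding to_PSL2C_def PSL2C_def
    by (intro group_hom.intro group_hom_axioms.intro group_SL2C N.factorgroup_is_group N.r_coset_hom_Mod)
qed

lemma to_PSL2C_in: "det A = 1 \<Longrightarrow> to_PSL2C A \<in> carrier PSL2C"
  using group_hom.hom_closed[OF to_PSL2C_hom, of A] by (simp add: SL2C_def)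

lemma to_PSL2C_mult: "det A = 1 \<Longrightarrow> det B = 1 \<Longrightarrow> to_PSL2C A \<otimes>\<^bsub>PSL2C\<^esub> to_PSL2C B = to_PSL2C (A ** B)"
  using group_hom.hom_mult[OF to_PSL2C_hom, of A B] by (simp add: SL2C_def)

lemma to_PSL2C_one: "to_PSL2C (mat2 1 0 0 1) = \<one>\<^bsub>PSL2C\<^esub>"
  using group_hom.hom_one[OF to_PSL2C_hom] by (simp add: SL2C_def mat2_one)

lemma to_PSL2C_surj: "X \<in> carrier PSL2C \<Longrightarrow> \<exists>A. det A = 1 \<and> X = to_PSL2C A"
  unfolding PSL2C_def to_PSL2C_def by (auto simp: FactGroup_def RCOSETS_def SL2C_def)

lemma to_PSL2C_eq: "to_PSL2C A = {A, - A}"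
proof -
  have "(- mat 1) ** A = - A"
    by (simp add: matrix_matrix_mult_def mat_def vec_eq_iff forall_2 sum_2)
  then show ?thesis by (auto simp: to_PSL2C_def r_coset_def SL2C_def)
qed

lemma to_PSL2C_mat2_eq:
  "to_PSL2C (mat2 a b c d) = to_PSL2C (mat2 a' b' c' d') \<Longrightarrow>
     a = a' \<and> b = b' \<and> c = c' \<and> d = d' \<or> a = - a' \<and> b = - b' \<and> c = - c' \<and> d = - d'"
proof -
  assume "to_PSL2C (mat2 a b c d) = to_PSL2C (mat2 a' b' c' d')"
  then have "mat2 a b c d = mat2 a' b' c' d' \<or> mat2 a b c d = - mat2 a' b' c' d'"
    unfolding to_PSL2C_eq by blast
  moreover have "- mat2 a' b' c' d' = mat2 (- a') (- b') (- c') (- d')"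
    by (simp add: vec_eq_iff forall_2)
  ultimately show ?thesis by (auto simp: mat2_eq_iff)
qed

lemma PSL2C_P_iff: "X \<in> PSL2C_P \<longleftrightarrow> (\<exists>t. X = to_PSL2C (mat2 1 t 0 1))"
proof
  assume "X \<in> PSL2C_P"
  then obtain A where "X = to_PSL2C A" "A $ 1 $ 1 = 1" "A $ 2 $ 2 = 1" "A $ 2 $ 1 = 0"
    by (auto simp: PSL2C_P_def)
  moreover from this have "A = mat2 1 (A $ 1 $ 2) 0 1" by (simp add: vec_eq_iff forall_2)
  ultimately show "\<exists>t. X = to_PSL2C (mat2 1 t 0 1)" by metis
qed (auto simp: PSL2C_P_def)

lemma counter_diagonal_iff: "X \<in> counter_diagonal \<longleftrightarrow> (\<exists>a. a \<noteq> 0 \<and> X = to_PSL2C (mat2 0 (- inverse a) a 0))"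
  by (auto simp: counter_diagonal_def mat2_def)

lemma counter_diagonalE:
  assumes "k \<in> counter_diagonal"
  obtains a where "a \<noteq> 0" "k = to_PSL2C (mat2 0 (- inverse a) a 0)" "det (mat2 0 (- inverse a) a 0) = 1"
  using assms by (auto simp: counter_diagonal_iff det_mat2)

interpretation PSL2C: coset_labels PSL2C PSL2C_P counter_diagonal
proof (intro coset_labels.intro coset_labels_axioms.intro group_PSL2C subgroup_PSL2C_P)
  interpret group PSL2C by (rule group_PSL2C)
  note mult = to_PSL2C_mult mat2_mult det_mat2
  show "counter_diagonal \<subseteq> carrier PSL2C"
    by (auto simp: counter_diagonal_iff det_mat2 intro!: to_PSL2C_in)
  fix k assume k: "k \<in> counter_diagonal"
  obtain a where a: "a \<noteq> 0" "k = to_PSL2C (mat2 0 (- inverse a) a 0)" using counter_diagonalE[OF k] .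
  have "to_PSL2C (mat2 0 (inverse a) (- a) 0) \<otimes>\<^bsub>PSL2C\<^esub> k = \<one>\<^bsub>PSL2C\<^esub>"
    using a by (simp add: mult to_PSL2C_one)
  moreover have "k \<in> carrier PSL2C" "to_PSL2C (mat2 0 (inverse a) (- a) 0) \<in> carrier PSL2C"
    unfolding a(2) by (rule to_PSL2C_in, simp add: det_mat2 a(1))+
  ultimately have "inv\<^bsub>PSL2C\<^esub> k = to_PSL2C (mat2 0 (inverse a) (- a) 0)"
    by (rule inv_equality)
  then show "inv\<^bsub>PSL2C\<^esub> k \<in> counter_diagonal"
    unfolding counter_diagonal_iff using a(1) by (intro exI[of _ "- a"]) simp
  fix k' p p' assume k': "k' \<in> counter_diagonal" and p: "p \<in> PSL2C_P" "p' \<in> PSL2C_P"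
  obtain b where b: "b \<noteq> 0" "k' = to_PSL2C (mat2 0 (- inverse b) b 0)" using counter_diagonalE[OF k'] .
  obtain s t where st: "p = to_PSL2C (mat2 1 s 0 1)" "p' = to_PSL2C (mat2 1 t 0 1)"
    using p by (auto simp: PSL2C_P_iff)
  show "p = \<one>\<^bsub>PSL2C\<^esub>" if "k \<otimes>\<^bsub>PSL2C\<^esub> p' = p \<otimes>\<^bsub>PSL2C\<^esub> k'"
  proof -
    \<comment> \<open>The top left entries give s b = 0 up to sign, and b is nonzero.\<close>
    have "to_PSL2C (mat2 0 (- inverse a) a (a * t)) = to_PSL2C (mat2 (s * b) (- inverse b) b 0)"
      using that a b st by (simp add: mult)
    then have "s = 0" by (elim to_PSL2C_mat2_eq[THEN disjE]) (use b(1) in auto)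
    then show ?thesis using st to_PSL2C_one by simp
  qed
  fix k'' assume k'': "k'' \<in> counter_diagonal"
  obtain c where c: "c \<noteq> 0" "k'' = to_PSL2C (mat2 0 (- inverse c) c 0)" using counter_diagonalE[OF k''] .
  show "k' \<noteq> k \<otimes>\<^bsub>PSL2C\<^esub> (p \<otimes>\<^bsub>PSL2C\<^esub> (k'' \<otimes>\<^bsub>PSL2C\<^esub> p'))"
  proof
    assume "k' = k \<otimes>\<^bsub>PSL2C\<^esub> (p \<otimes>\<^bsub>PSL2C\<^esub> (k'' \<otimes>\<^bsub>PSL2C\<^esub> p'))"
    \<comment> \<open>The product on the right has top left entry - c / a, which is nonzero, whereas
      a counter diagonal matrix has 0 there.\<close>
    then have "to_PSL2C (mat2 0 (- inverse b) b 0) = to_PSL2C (mat2 0 (- inverse a) a 0 **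
       (mat2 1 s 0 1 ** (mat2 0 (- inverse c) c 0 ** mat2 1 t 0 1)))"
      using a b c st by (simp add: to_PSL2C_mult det_mat2 det_mul)
    then show False
      unfolding mat2_mult by (elim to_PSL2C_mat2_eq[THEN disjE]) (use a(1) c(1) in auto)
  qed
next
  interpret group PSL2C by (rule group_PSL2C)
  fix F assume F: "finite F" "F \<subseteq> carrier PSL2C"
  then have "\<forall>g\<in>F. \<exists>A. det A = 1 \<and> g = to_PSL2C A" using to_PSL2C_surj by blast
  then obtain r where r: "\<And>g. g \<in> F \<Longrightarrow> det (r g) = 1" "\<And>g. g \<in> F \<Longrightarrow> g = to_PSL2C (r g)" by metis
  \<comment> \<open>The vector (1, t) must avoid the lines spanned by the first columns of the given
    matrices. A vertical column makes the quotient default to 0, which only excludes one more value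
    of t.\<close>
  have "finite ((\<lambda>g. r g $ 2 $ 1 / r g $ 1 $ 1) ` F)" using F by simp
  then obtain t :: complex where t: "t \<notin> (\<lambda>g. r g $ 2 $ 1 / r g $ 1 $ 1) ` F"
    using ex_new_if_finite[OF infinite_UNIV_char_0] by blast
  show "\<exists>h\<in>carrier PSL2C. \<forall>g\<in>F. \<exists>p\<in>PSL2C_P. \<exists>p'\<in>PSL2C_P. \<exists>k\<in>counter_diagonal.
        g \<otimes>\<^bsub>PSL2C\<^esub> p' = h \<otimes>\<^bsub>PSL2C\<^esub> (p \<otimes>\<^bsub>PSL2C\<^esub> k)"
  proof (rule bexI[of _ "to_PSL2C (mat2 1 0 t 1)"], rule ballI)
    fix g assume g: "g \<in> F"
    obtain a b c d where A: "r g = mat2 a b c d" by (rule mat2_cases)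
    have det: "a * d - b * c = 1" using r(1)[OF g] by (simp add: A det_mat2)
    \<comment> \<open>The determinant of the first columns of h and g; it is nonzero exactly if
      these are independent.\<close>
    define e where "e = c - t * a"
    define f where "f = d - t * b"
    have e: "e \<noteq> 0"
    proof (cases "a = 0")
      case True
      then show ?thesis using det by (auto simp: e_def)
    next
      case False
      have "t \<noteq> c / a" using t g A by (metis (no_types, lifting) image_eqI mat2_nth(1,3))
      then show ?thesis using False by (auto simp: e_def field_simps)
    qed
    have "a * f - b * e = 1" using det by (simp add: e_def f_def algebra_simps)
    then have b: "b = (a * f - 1) / e" using e by (simp add: field_simps)
    have cd: "c = e + t * a" "d = f + t * b" by (auto simp: e_def f_def)
    \<comment> \<open>The Bruhat decomposition of the product of the inverse of h with g, which has
      rows (a, b) and (e, f), with the right unipotent factor moved to the other side.\<close>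
    have "mat2 a b c d ** mat2 1 (- f / e) 0 1 = mat2 1 0 t 1 ** (mat2 1 (a / e) 0 1 ** mat2 0 (- inverse e) e 0)"
      using e unfolding mat2_mult mat2_eq_iff cd b by (auto simp: field_simps)
    then have "g \<otimes>\<^bsub>PSL2C\<^esub> to_PSL2C (mat2 1 (- f / e) 0 1) =
        to_PSL2C (mat2 1 0 t 1) \<otimes>\<^bsub>PSL2C\<^esub> (to_PSL2C (mat2 1 (a / e) 0 1) \<otimes>\<^bsub>PSL2C\<^esub> to_PSL2C (mat2 0 (- inverse e) e 0))"
      using r[OF g] e det unfolding A by (simp add: to_PSL2C_mult det_mat2 det_mul)
    moreover have "to_PSL2C (mat2 0 (- inverse e) e 0) \<in> counter_diagonal"
      using e by (auto simp: counter_diagonal_iff)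
    ultimately show "\<exists>p\<in>PSL2C_P. \<exists>p'\<in>PSL2C_P. \<exists>k\<in>counter_diagonal.
        g \<otimes>\<^bsub>PSL2C\<^esub> p' = to_PSL2C (mat2 1 0 t 1) \<otimes>\<^bsub>PSL2C\<^esub> (p \<otimes>\<^bsub>PSL2C\<^esub> k)"
      using PSL2C_P_iff by blast
  qed (auto intro!: to_PSL2C_in simp: det_mat2)
qed

section \<open>The labeled complex as the complex of tuples\<close>

lemma labelings_eq: "labelings n = PSL2C.labellings n"
  by (simp add: labelings_def PSL2C.labellings_def)

lemma truncated_act_eq: "truncated_act n = (\<lambda>h. map_chain (PSL2C.label_act n h))"
  by (simp add: fun_eq_iff truncated_act_def map_chain_def PSL2C.label_act_def o_def)

interpretation tensor: tensor_free PSL2C "labelings n" "PSL2C.label_act n" for n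
  unfolding labelings_eq using PSL2C.gset_labellings by (rule tensor_free.intro)

text \<open>Discarding the labels that involve k amounts to deleting the k-th coset, since each
  label depends only on its two cosets. For n = 0 both boundaries are 0 by the cut-off.\<close>

lemma truncated_boundary_labelling:
  assumes c: "c \<in> fchains (PSL2C.tuples (Suc n))"
  shows "truncated_boundary (Suc n) (map_chain (PSL2C.labelling (Suc n)) c) =
    map_chain (PSL2C.labelling n) (PSL2C.tuples_bd (Suc n) c)"
proof (cases n)
  case 0
  then show ?thesis by (simp add: truncated_boundary_def PSL2C.tuples_bd_def)
next
  case (Suc m)
  show ?thesis
  proof (rule fchains_eq[OF c])
    fix xs assume xs: "xs \<in> PSL2C.tuples (Suc n)"
    have "map_chain (PSL2C.labelling n) (\<Sum>k\<in>I. f k) = (\<Sum>k\<in>I. map_chain (PSL2C.labelling n) (f k))" for I :: "nat set" and f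
      by (induction I rule: infinite_finite_induct) auto
    moreover have "{..<length xs} = {..Suc n}" using PSL2C.tuples_nth(2)[OF xs] by auto
    moreover have "truncated_face (Suc n) k (PSL2C.labelling (Suc n) xs) = PSL2C.labelling n (take k xs @ drop (Suc k) xs)"
      if "k \<le> Suc n" for k
      using PSL2C.labelling_face[OF xs that] by (simp add: truncated_face_def)
    ultimately show "truncated_boundary (Suc n) (map_chain (PSL2C.labelling (Suc n)) (frag_of xs)) =
        map_chain (PSL2C.labelling n) (PSL2C.tuples_bd (Suc n) (frag_of xs))"
      using Suc by (simp add: truncated_boundary_def PSL2C.tuples_bd_def tuple_boundary_sum map_chain_cmul del: sum.atMost_Suc)
  qed (auto simp: truncated_boundary_def frag_extend_diff PSL2C.tuples_bd_diff)
qed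

theorem corollary3p8:
  fixes n :: nat
  shows "chain_homology B_bar B_bar_boundary n \<cong> relative_group_homology n PSL2C PSL2C_P"
proof -
  \<comment> \<open>A tuple goes to the class of its labeling tensored with 1. The conditions to
    check split into those for the bijection \<open>labelling\<close> and those for
    \<open>unit_tensor\<close>.\<close>
  let ?\<Theta> = "\<lambda>n c. tensor.unit_tensor n (map_chain (PSL2C.labelling n) c)"
  have B: "B_bar n = tensor_trivial PSL2C (\<lambda>g. map_chain (PSL2C.label_act n g)) (free_Abelian_group (labelings n))" for n
    by (simp add: B_bar_def truncated_chains_def truncated_act_eq)
  have lab: "map_chain (PSL2C.labelling n) c \<in> fchains (labelings n)" if "c \<in> fchains (PSL2C.tuples n)" for n c
    unfolding labelings_eq PSL2C.fchains_labellings using that by blast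
  have lab_hom: "map_chain (PSL2C.labelling n) \<in> hom (free_Abelian_group (PSL2C.tuples n)) (free_Abelian_group (labelings n))" for n
    by (rule homI) (use lab in auto)
  have "chain_homology B_bar B_bar_boundary n \<cong> PSL2C.tuple_homology n"
  proof (rule PSL2C.chain_homology_iso_tuple_homology[where \<Theta> = ?\<Theta>])
    fix n
    show "comm_group (B_bar n)" unfolding B by (rule tensor.comm_group_tensor)
    show "?\<Theta> n \<in> hom (free_Abelian_group (PSL2C.tuples n)) (B_bar n)"
      unfolding B using hom_compose[OF lab_hom tensor.unit_tensor_hom] by (simp add: o_def)
    show "carrier (B_bar n) = ?\<Theta> n ` fchains (PSL2C.tuples n)"
      using tensor.unit_tensor_surj[of n] PSL2C.fchains_labellings[of n]
      by (simp only: B image_image labelings_eq)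
    fix c
    show "?\<Theta> n c = \<one>\<^bsub>B_bar n\<^esub> \<longleftrightarrow> c \<in> PSL2C.tuple_act_chains n" if c: "c \<in> fchains (PSL2C.tuples n)"
      unfolding B tensor.unit_tensor_kernel[OF lab[OF c]] unfolding labelings_eq by (rule PSL2C.labelling_act_chains[OF c])
    assume c: "c \<in> fchains (PSL2C.tuples (Suc n))"
    have "B_bar_boundary (Suc n) (?\<Theta> (Suc n) c) =
        tensor.unit_tensor n (truncated_boundary (Suc n) (map_chain (PSL2C.labelling (Suc n)) c))"
      unfolding B_bar_boundary_def truncated_act_eq truncated_chains_def diff_Suc_1
    proof (rule tensor_map_unit_tensor[OF tensor.tensor_free_axioms tensor.tensor_free_axioms _ _ _ lab[OF c]])
      show "truncated_boundary (Suc n) (x + y) = truncated_boundary (Suc n) x + truncated_boundary (Suc n) y" for x y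
        by (simp add: truncated_boundary_def frag_extend_add)
      fix x assume "x \<in> fchains (labelings (Suc n))"
      then obtain b where b: "b \<in> fchains (PSL2C.tuples (Suc n))" "x = map_chain (PSL2C.labelling (Suc n)) b"
        unfolding labelings_eq PSL2C.fchains_labellings by blast
      show "truncated_boundary (Suc n) x \<in> fchains (labelings n)"
        unfolding b(2) truncated_boundary_labelling[OF b(1)] by (rule lab[OF PSL2C.tuples_bd_in[OF b(1)]])
      fix g assume g: "g \<in> carrier PSL2C"
      interpret T: gset PSL2C "PSL2C.tuples (Suc n)" PSL2C.tact by (rule PSL2C.gset_tuples)
      have "PSL2C.tuples_bd (Suc n) (map_chain (PSL2C.tact g) b) = map_chain (PSL2C.tact g) (PSL2C.tuples_bd (Suc n) b)"
        by (simp add: PSL2C.tuples_bd_def PSL2C.bd_tact)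
      then show "truncated_boundary (Suc n) (map_chain (PSL2C.label_act (Suc n) g) x) =
          map_chain (PSL2C.label_act n g) (truncated_boundary (Suc n) x)"
        unfolding b(2) PSL2C.map_chain_labelling_tact[OF b(1) g, symmetric]
          truncated_boundary_labelling[OF b(1)] truncated_boundary_labelling[OF T.map_chain_act_in[OF g b(1)]]
        using PSL2C.map_chain_labelling_tact[OF PSL2C.tuples_bd_in[OF b(1)] g] by simp
    qed
    then show "B_bar_boundary (Suc n) (?\<Theta> (Suc n) c) = ?\<Theta> n (PSL2C.tuples_bd (Suc n) c)"
      by (simp only: truncated_boundary_labelling[OF c])
  qed
  then show ?thesis using PSL2C.tuple_homology_iso iso_trans by blast
qed

end
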